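(* There exist a prime number $p$ and a finitely generated lacunary hyperbolic non-virtually cyclic elementary amenable group $G$ satisfying the following additional properties: (i) $G$ is 2-generated; (ii) $G$ is (locally nilpotent $p$-group)-by-(infinite cyclic), i.e. $G$ has a normal subgroup that is a locally nilpotent $p$-group with infinite cyclic quotient; (iii) $G$ is residually (finite $p$-group); in particular it is residually nilpotent.
   Context: A finitely generated group $G$ (with the word metric of a finite generating set) is lacunary hyperbolic if at least one of its asymptotic cones is an $\mathbb R$-tree. Here, for a non-principal ultrafilter $\omega$ on $\mathbb N$ and an unbounded non-decreasing sequence $d=(d_n)$ of positive reals, the asymptotic cone $\mathrm{Con}^\omega(G,d)$ is the set of sequences $(g_n)$ in $G$ with $\mathrm{dist}(1,g_n)/d_n$ bounded, modulo $\lim^\omega \mathrm{dist}(g_n,h_n)/d_n=0$, with metric $\lim^\omega \mathrm{dist}(g_n,h_n)/d_n$. The class of elementary amenable groups is the smallest class containing all finite and all Abelian groups and closed under taking directed unions, extensions, quotients and subgroups. *)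

theory Defs
  imports "HOL-Analysis.Abstract_Metric_Spaces" "HOL-Algebra.Algebra"
begin

section \<open>Word metrics\<close>

definition finitely_generated :: "('a, 'b) monoid_scheme \<Rightarrow> bool" where
  "finitely_generated G \<longleftrightarrow> (\<exists>S. finite S \<and> S \<subseteq> carrier G \<and> generate G S = carrier G)"

definition word_length :: "('a, 'b) monoid_scheme \<Rightarrow> 'a set \<Rightarrow> 'a \<Rightarrow> nat" where
  "word_length G S g =
     (LEAST n. \<exists>w. length w = n \<and> set w \<subseteq> S \<union> m_inv G ` S \<and>
                   foldr (\<otimes>\<^bsub>G\<^esub>) w \<one>\<^bsub>G\<^esub> = g)"

definition word_dist :: "('a, 'b) monoid_scheme \<Rightarrow> 'a set \<Rightarrow> 'a \<Rightarrow> 'a \<Rightarrow> real" where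
  "word_dist G S g h = real (word_length G S (inv\<^bsub>G\<^esub> g \<otimes>\<^bsub>G\<^esub> h))"


section \<open>Asymptotic cones\<close>

text \<open>Ultrafilters are represented by filters; a set \<open>A\<close> is large when \<open>n \<in> A\<close> holds
  eventually, and \<open>\<omega>\<close>-limits are limits along the filter.\<close>

definition nonprincipal_ultrafilter :: "nat filter \<Rightarrow> bool" where
  "nonprincipal_ultrafilter \<omega> \<longleftrightarrow>
     \<omega> \<noteq> bot \<and>
     (\<forall>P. eventually P \<omega> \<or> eventually (\<lambda>n. \<not> P n) \<omega>) \<and>
     (\<forall>k. \<not> eventually (\<lambda>n. n = k) \<omega>)"

definition scaling_sequence :: "(nat \<Rightarrow> real) \<Rightarrow> bool" where
  "scaling_sequence d \<longleftrightarrow> (\<forall>n. d n > 0) \<and> mono d \<and> \<not> bdd_above (range d)"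

definition cone_seqs :: "('a, 'b) monoid_scheme \<Rightarrow> 'a set \<Rightarrow> (nat \<Rightarrow> real) \<Rightarrow> (nat \<Rightarrow> 'a) set" where
  "cone_seqs G S d =
     {g. (\<forall>n. g n \<in> carrier G) \<and> (\<exists>C. \<forall>n. word_dist G S \<one>\<^bsub>G\<^esub> (g n) / d n \<le> C)}"

definition cone_rel ::
  "('a, 'b) monoid_scheme \<Rightarrow> 'a set \<Rightarrow> nat filter \<Rightarrow> (nat \<Rightarrow> real) \<Rightarrow> ((nat \<Rightarrow> 'a) \<times> (nat \<Rightarrow> 'a)) set"
  where
  "cone_rel G S \<omega> d =
     {(g, h). g \<in> cone_seqs G S d \<and> h \<in> cone_seqs G S d \<and>
              ((\<lambda>n. word_dist G S (g n) (h n) / d n) \<longlongrightarrow> 0) \<omega>}"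

definition cone ::
  "('a, 'b) monoid_scheme \<Rightarrow> 'a set \<Rightarrow> nat filter \<Rightarrow> (nat \<Rightarrow> real) \<Rightarrow> (nat \<Rightarrow> 'a) set set" where
  "cone G S \<omega> d = cone_seqs G S d // cone_rel G S \<omega> d"

text \<open>The value outside the cone is irrelevant; it is set to \<open>0\<close> because the locale
  \<open>Metric_space\<close> requires nonnegativity and symmetry on the whole type.\<close>

definition cone_dist ::
  "('a, 'b) monoid_scheme \<Rightarrow> 'a set \<Rightarrow> nat filter \<Rightarrow> (nat \<Rightarrow> real) \<Rightarrow>
   (nat \<Rightarrow> 'a) set \<Rightarrow> (nat \<Rightarrow> 'a) set \<Rightarrow> real" where
  "cone_dist G S \<omega> d A B =
     (if A \<in> cone G S \<omega> d \<and> B \<in> cone G S \<omega> d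
      then THE r. \<forall>g\<in>A. \<forall>h\<in>B. ((\<lambda>n. word_dist G S (g n) (h n) / d n) \<longlongrightarrow> r) \<omega>
      else 0)"


section \<open>Real trees and lacunary hyperbolic groups\<close>

definition geodesic_segment ::
  "'a set \<Rightarrow> ('a \<Rightarrow> 'a \<Rightarrow> real) \<Rightarrow> 'a \<Rightarrow> 'a \<Rightarrow> 'a set \<Rightarrow> bool" where
  "geodesic_segment M d x y S \<longleftrightarrow>
     (\<exists>c l. 0 \<le> (l::real) \<and> c 0 = x \<and> c l = y \<and> c ` {0..l} = S \<and> S \<subseteq> M \<and>
            (\<forall>s\<in>{0..l}. \<forall>t\<in>{0..l}. d (c s) (c t) = \<bar>s - t\<bar>))"

text \<open>The definition of Bridson and Haefliger (Metric Spaces of Non-Positive Curvature,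
  Definition II.1.20): geodesic segments exist and are unique, and two of them that meet only
  in a common endpoint concatenate to a geodesic segment.\<close>

definition real_tree :: "'a set \<Rightarrow> ('a \<Rightarrow> 'a \<Rightarrow> real) \<Rightarrow> bool" where
  "real_tree M d \<longleftrightarrow>
     Metric_space M d \<and>
     (\<forall>x\<in>M. \<forall>y\<in>M. \<exists>!S. geodesic_segment M d x y S) \<and>
     (\<forall>x y z S T. geodesic_segment M d y x S \<and> geodesic_segment M d x z T \<and> S \<inter> T = {x} \<longrightarrow>
                  geodesic_segment M d y z (S \<union> T))"

definition lacunary_hyperbolic :: "('a, 'b) monoid_scheme \<Rightarrow> bool" where
  "lacunary_hyperbolic G \<longleftrightarrow>
     group G \<and>
     (\<exists>S. finite S \<and> S \<subseteq> carrier G \<and> generate G S = carrier G \<and>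
        (\<exists>\<omega> d. nonprincipal_ultrafilter \<omega> \<and> scaling_sequence d \<and>
               real_tree (cone G S \<omega> d) (cone_dist G S \<omega> d)))"


section \<open>Elementary amenable groups\<close>

text \<open>The operations are applied to groups carried by subsets of one type \<open>'a\<close>; since quotients
  live on a type of cosets, the quotient and extension rules refer to isomorphic copies on \<open>'a\<close>
  (the quotient rule with trivial \<open>N\<close> closes the class under isomorphism). For infinite \<open>'a\<close> the
  groups concerned are, up to isomorphism, all groups of cardinality at most that of \<open>'a\<close>.
  Nothing is lost by the bound: by induction along the unrestricted closure, all subgroups of
  bounded cardinality of elementary amenable groups are already obtained within the bound.\<close>

inductive elementary_amenable :: "'a monoid \<Rightarrow> bool" where
  finite: "\<lbrakk>group G; finite (carrier G)\<rbrakk> \<Longrightarrow> elementary_amenable G"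
| abelian: "comm_group G \<Longrightarrow> elementary_amenable G"
| subgroup: "\<lbrakk>group G; elementary_amenable G; subgroup H G\<rbrakk> \<Longrightarrow>
    elementary_amenable (G\<lparr>carrier := H\<rparr>)"
| quotient: "\<lbrakk>elementary_amenable G; N \<lhd> G; group Q; Q \<cong> G Mod N\<rbrakk> \<Longrightarrow> elementary_amenable Q"
| extension: "\<lbrakk>N \<lhd> G; elementary_amenable (G\<lparr>carrier := N\<rparr>);
    group Q; Q \<cong> G Mod N; elementary_amenable Q\<rbrakk> \<Longrightarrow> elementary_amenable G"
| directed_union: "\<lbrakk>group G; \<H> \<noteq> {};
    \<And>H. H \<in> \<H> \<Longrightarrow> subgroup H G;
    \<And>H. H \<in> \<H> \<Longrightarrow> elementary_amenable (G\<lparr>carrier := H\<rparr>);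
    \<And>H K. \<lbrakk>H \<in> \<H>; K \<in> \<H>\<rbrakk> \<Longrightarrow> \<exists>L\<in>\<H>. H \<subseteq> L \<and> K \<subseteq> L;
    \<Union>\<H> = carrier G\<rbrakk> \<Longrightarrow> elementary_amenable G"


section \<open>Further group properties\<close>

definition virtually_cyclic :: "('a, 'b) monoid_scheme \<Rightarrow> bool" where
  "virtually_cyclic G \<longleftrightarrow>
     (\<exists>H. subgroup H G \<and> cyclic_group (G\<lparr>carrier := H\<rparr>) \<and> finite (rcosets\<^bsub>G\<^esub> H))"

primrec lower_central :: "('a, 'b) monoid_scheme \<Rightarrow> nat \<Rightarrow> 'a set" where
  "lower_central G 0 = carrier G"
| "lower_central G (Suc n) =
     generate G {g \<otimes>\<^bsub>G\<^esub> h \<otimes>\<^bsub>G\<^esub> inv\<^bsub>G\<^esub> g \<otimes>\<^bsub>G\<^esub> inv\<^bsub>G\<^esub> h | g h.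
                 g \<in> carrier G \<and> h \<in> lower_central G n}"

definition nilpotent_group :: "('a, 'b) monoid_scheme \<Rightarrow> bool" where
  "nilpotent_group G \<longleftrightarrow> group G \<and> (\<exists>n. lower_central G n = {\<one>\<^bsub>G\<^esub>})"

definition locally_nilpotent :: "('a, 'b) monoid_scheme \<Rightarrow> bool" where
  "locally_nilpotent G \<longleftrightarrow>
     group G \<and>
     (\<forall>H. subgroup H G \<and> finitely_generated (G\<lparr>carrier := H\<rparr>) \<longrightarrow>
          nilpotent_group (G\<lparr>carrier := H\<rparr>))"

text \<open>Elements of infinite order have \<open>ord\<close> equal to \<open>0\<close>, which is not a power of a prime.\<close>

definition p_group :: "nat \<Rightarrow> ('a, 'b) monoid_scheme \<Rightarrow> bool" where
  "p_group p G \<longleftrightarrow> group G \<and> (\<forall>x\<in>carrier G. \<exists>k. group.ord G x = p ^ k)"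

definition residually :: "('a set monoid \<Rightarrow> bool) \<Rightarrow> ('a, 'b) monoid_scheme \<Rightarrow> bool" where
  "residually P G \<longleftrightarrow>
     group G \<and> (\<forall>g\<in>carrier G. g \<noteq> \<one>\<^bsub>G\<^esub> \<longrightarrow> (\<exists>N. N \<lhd> G \<and> g \<notin> N \<and> P (G Mod N)))"

end

theory Submission
  imports Defs "HOL-Library.Sublist" "HOL-Real_Asymp.Real_Asymp"
begin

text \<open>Put \<open>p = 2\<close>. The group is a limit of markings of groups by two letters \<open>a\<close> and \<open>t\<close> with \<open>a\<^sup>2 = 1\<close>.
  Suppose that \<open>a, t\<close> generate a finite 2-group \<open>Q\<close>, and let \<open>C\<close> be its subgroup generated by
  \<open>t\<^sup>i a t\<inverse>\<^sup>i\<close> for \<open>1 \<le> i \<le> n\<close>. Let \<open>F\<close> be the free product of groups of order two with one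
  generator \<open>y\<^bsub>e\<^esub>\<close> for each coset \<open>e\<close> in \<open>Q/C\<close>; then \<open>Q\<close> acts on \<open>F\<close>, and \<open>(1, a)\<close> and \<open>(y\<^bsub>C\<^esub>, t)\<close> generate
  a subgroup of \<open>F \<rtimes> Q\<close>. This subgroup is quasi-isometric to a tree: reading the \<open>F\<close>-coordinate as
  a reduced word, a multiplication by \<open>t\<close> adds or removes one letter, and the fibres are finite. The
  elements \<open>t\<^sup>i a t\<inverse>\<^sup>i\<close> with \<open>0 \<le> i \<le> n\<close> still generate a group isomorphic to the one in \<open>Q\<close>.
  Replacing \<open>F\<close> by a large finite 2-quotient, given by unitriangular matrices over the field of two
  elements, yields the next finite 2-group, which agrees with \<open>F \<rtimes> Q\<close> on a large ball. In the limit
  the conjugates of \<open>a\<close> generate a locally finite 2-group, all stages are finite 2-quotients, and the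
  ball of radius \<open>c\<^sub>n\<close> is \<open>\<delta>\<^sub>n\<close>-hyperbolic, where \<open>c\<^sub>n\<close> is chosen after \<open>\<delta>\<^sub>n\<close> and much larger.\<close>

section \<open>Real trees as asymptotic cones\<close>

text \<open>The index 0 is left out of C so that conjugation by t^-1 carries C into the finite group
  A generated by all t^i a t^-i with 0 \<le> i \<le> n. The subgroup of the semidirect product is
  then in effect the HNN extension of A in which t shifts these generators by one, and the tree is
  its Bass-Serre tree: a reduced word in F is the path from the root to a coset of A. Letters of
  order two allow unitriangular representations over the field of two elements, but make both
  directions of an edge look alike; stage 0 therefore remembers the exponent of t modulo 2, which
  restores the direction.

  The scales are not circular. A is the same at stage n and in the limit, so its diameter, which
  governs the hyperbolicity constant, is known before c_n has to be chosen.

  Neither F nor the semidirect product is built. A group is given by the set of words trivial in it,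
  and the F-coordinate of a word is the list of edges that its path crosses.\<close>

lemma ex_nonprincipal_ultrafilter: "\<exists>\<omega>. nonprincipal_ultrafilter \<omega>"
proof -
  \<comment> \<open>Families with the finite intersection property. Containing every complement of a
    point is what makes a maximal one non-principal.\<close>
  define \<S> where "\<S> = {A :: nat set set. (\<forall>k. - {k} \<in> A) \<and> (\<forall>B. finite B \<and> B \<subseteq> A \<longrightarrow> \<Inter>B \<noteq> {})}"
  have "\<exists>M\<in>\<S>. \<forall>Z\<in>\<S>. M \<subseteq> Z \<longrightarrow> Z = M"
  proof (rule subset_Zorn_nonempty)
    have "range (\<lambda>k::nat. - {k}) \<in> \<S>"
    proof -
      have "\<Inter>B \<noteq> {}" if B: "finite B" "B \<subseteq> range (\<lambda>k::nat. - {k})" for B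
      proof -
        obtain C where C: "finite C" "B = (\<lambda>k::nat. - {k}) ` C"
          using finite_subset_image[OF B] by blast
        obtain m :: nat where "m \<notin> C" using C(1) infinite_UNIV_nat ex_new_if_finite by blast
        then show ?thesis using C(2) by auto
      qed
      then show ?thesis by (auto simp: \<S>_def)
    qed
    then show "\<S> \<noteq> {}" by blast
  next
    fix \<C> assume ne: "\<C> \<noteq> {}" and ch: "subset.chain \<S> \<C>"
    have fip: "\<Inter>B \<noteq> {}" if B: "finite B" "B \<subseteq> \<Union>\<C>" for B
    proof -
      obtain A where "A \<in> \<C>" "B \<subseteq> A"
        using finite_subset_Union_chain[OF B ne ch] by blast
      then show ?thesis using ch B(1) by (auto simp: \<S>_def subset.chain_def)
    qed
    obtain A where A: "A \<in> \<C>" "A \<in> \<S>" using ne ch unfolding subset.chain_def by blast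
    then have "- {k} \<in> \<Union>\<C>" for k by (auto simp: \<S>_def)
    with fip show "\<Union>\<C> \<in> \<S>" by (simp add: \<S>_def)
  qed
  then obtain M where M: "M \<in> \<S>" and mx: "\<And>Z. Z \<in> \<S> \<Longrightarrow> M \<subseteq> Z \<Longrightarrow> Z = M" by blast
  have fip: "\<Inter>B \<noteq> {}" if "finite B" "B \<subseteq> M" for B using M that by (auto simp: \<S>_def)
  have dich: "Z \<in> M" if Z: "\<And>B. finite B \<Longrightarrow> B \<subseteq> M \<Longrightarrow> Z \<inter> \<Inter>B \<noteq> {}" for Z
  proof -
    have "insert Z M \<in> \<S>"
    proof -
      have "\<Inter>B \<noteq> {}" if B: "finite B" "B \<subseteq> insert Z M" for B
      proof -
        have "Z \<inter> \<Inter>(B - {Z}) \<noteq> {}" using Z[of "B - {Z}"] B by blast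
        moreover have "Z \<inter> \<Inter>(B - {Z}) \<subseteq> \<Inter>B" by auto
        ultimately show ?thesis by blast
      qed
      then show ?thesis using M by (auto simp: \<S>_def)
    qed
    then show ?thesis using mx[of "insert Z M"] by blast
  qed
  have up: "Y \<in> M" if "Z \<in> M" "Z \<subseteq> Y" for Z Y
  proof (rule dich)
    fix B assume "finite B" "B \<subseteq> M"
    then have "\<Inter>(insert Z B) \<noteq> {}" using that by (intro fip) auto
    then show "Y \<inter> \<Inter>B \<noteq> {}" using that by auto
  qed
  have int: "Z \<inter> Y \<in> M" if "Z \<in> M" "Y \<in> M" for Z Y
  proof (rule dich)
    fix B assume "finite B" "B \<subseteq> M"
    then have "\<Inter>(insert Z (insert Y B)) \<noteq> {}" using that by (intro fip) auto
    then show "Z \<inter> Y \<inter> \<Inter>B \<noteq> {}" by (simp add: Int_assoc)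
  qed
  have univ: "UNIV \<in> M" using M up[of "- {0}" UNIV] by (auto simp: \<S>_def)
  have alt: "Z \<in> M \<or> - Z \<in> M" for Z
  proof (rule ccontr)
    assume "\<not> ?thesis"
    then obtain B B' where "finite B" "B \<subseteq> M" "Z \<inter> \<Inter>B = {}" "finite B'" "B' \<subseteq> M" "- Z \<inter> \<Inter>B' = {}"
      using dich by meson
    moreover then have "\<Inter>(B \<union> B') \<noteq> {}" by (intro fip) auto
    ultimately show False by blast
  qed
  define \<omega> where "\<omega> = Abs_filter (\<lambda>P. Collect P \<in> M)"
  have ev: "eventually P \<omega> \<longleftrightarrow> Collect P \<in> M" for P
    unfolding \<omega>_def
  proof (rule eventually_Abs_filter, unfold_locales)
    show "Collect (\<lambda>x. True) \<in> M" using univ by simp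
    show "Collect (\<lambda>x. P x \<and> Q x) \<in> M" if "Collect P \<in> M" "Collect Q \<in> M" for P Q
      using int[OF that] by (simp add: Collect_conj_eq)
    show "Collect Q \<in> M" if "\<forall>x. P x \<longrightarrow> Q x" "Collect P \<in> M" for P Q
      using up[OF that(2)] that(1) by blast
  qed
  have empty: "{} \<notin> M" using fip[of "{{}}"] by auto
  have "\<omega> \<noteq> bot" using ev[of "\<lambda>_. False"] empty by (auto simp: trivial_limit_def)
  moreover have "eventually P \<omega> \<or> eventually (\<lambda>n. \<not> P n) \<omega>" for P
    using alt[of "Collect P"] ev by (simp add: Collect_neg_eq)
  moreover have "\<not> eventually (\<lambda>n. n = k) \<omega>" for k
  proof
    assume "eventually (\<lambda>n. n = k) \<omega>"
    then have "{k} \<in> M" using ev by simp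
    moreover have "- {k} \<in> M" using M by (auto simp: \<S>_def)
    ultimately show False using int[of "{k}" "- {k}"] empty by simp
  qed
  ultimately show ?thesis unfolding nonprincipal_ultrafilter_def by blast
qed

lemma nonprincipal_ultrafilter_le_sequentially:
  assumes "nonprincipal_ultrafilter \<omega>"
  shows "\<omega> \<le> sequentially"
proof -
  have "eventually (\<lambda>n. N \<le> n) \<omega>" for N
  proof (induction N)
    case (Suc N)
    have "eventually (\<lambda>n. n \<noteq> N) \<omega>"
      using assms unfolding nonprincipal_ultrafilter_def by blast
    with Suc show ?case by eventually_elim auto
  qed simp
  then show ?thesis
    by (intro filter_leI) (metis (mono_tags, lifting) eventually_mono eventually_sequentially)
qed

text \<open>Compactness of the interval gives the image filter a cluster point, and an ultrafilter
  converges to each of its cluster points.\<close>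

lemma ultrafilter_bounded_tendsto:
  fixes r :: "nat \<Rightarrow> real"
  assumes \<omega>: "nonprincipal_ultrafilter \<omega>" and r: "\<And>n. a \<le> r n" "\<And>n. r n \<le> b"
  obtains l where "(r \<longlongrightarrow> l) \<omega>"
proof -
  let ?F = "filtermap r \<omega>"
  have "?F \<noteq> bot" using \<omega> by (simp add: nonprincipal_ultrafilter_def filtermap_bot_iff)
  moreover have "eventually (\<lambda>x. x \<in> {a..b}) ?F" using r by (simp add: eventually_filtermap)
  ultimately obtain x where x: "inf (nhds x) ?F \<noteq> bot"
    using compact_Icc[of a b] unfolding compact_filter by blast
  have "(r \<longlongrightarrow> x) \<omega>"
  proof (rule topological_tendstoI, rule ccontr)
    fix S assume S: "open S" "x \<in> S" "\<not> eventually (\<lambda>n. r n \<in> S) \<omega>"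
    then have "eventually (\<lambda>n. r n \<notin> S) \<omega>" using \<omega> unfolding nonprincipal_ultrafilter_def by blast
    then have "eventually (\<lambda>y. y \<notin> S) ?F" by (simp add: eventually_filtermap)
    moreover have "eventually (\<lambda>y. y \<in> S) (nhds x)" using S eventually_nhds by blast
    ultimately have "eventually (\<lambda>_. False) (inf (nhds x) ?F)" by (auto simp: eventually_inf)
    with x show False by (simp add: trivial_limit_def)
  qed
  then show ?thesis by (rule that)
qed

section \<open>Real trees from the four-point inequality\<close>

lemma geodesic_segmentE:
  assumes "geodesic_segment M d x y S"
  obtains c l where "0 \<le> (l::real)" "c 0 = x" "c l = y" "c ` {0..l} = S" "S \<subseteq> M"
    "\<And>s t. s \<in> {0..l} \<Longrightarrow> t \<in> {0..l} \<Longrightarrow> d (c s) (c t) = \<bar>s - t\<bar>"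
  using assms unfolding geodesic_segment_def
  by (elim exE conjE) (rule that, assumption+, drule (1) bspec, drule (1) bspec, assumption)

text \<open>Without an error term the four-point inequality makes every segment equal to the metric
  interval between its endpoints (fact \<open>seg\<close>). Uniqueness and concatenation then become
  equations between distances.\<close>

lemma real_tree_four_point:
  assumes "Metric_space M d"
    and geo: "\<And>x y. x \<in> M \<Longrightarrow> y \<in> M \<Longrightarrow> \<exists>S. geodesic_segment M d x y S"
    and four: "\<And>x y z w. \<lbrakk>x \<in> M; y \<in> M; z \<in> M; w \<in> M\<rbrakk> \<Longrightarrow>
      d x y + d z w \<le> max (d x z + d y w) (d y z + d x w)"
  shows "real_tree M d"
proof -
  interpret Metric_space M d by fact
  have seg: "x \<in> M \<and> y \<in> M \<and> S = {m \<in> M. d x m + d m y = d x y}"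
    if g: "geodesic_segment M d x y S" for x y S
  proof -
    obtain c l where c: "0 \<le> (l::real)" "c 0 = x" "c l = y" "c ` {0..l} = S" "S \<subseteq> M"
      and iso: "\<And>s t. s \<in> {0..l} \<Longrightarrow> t \<in> {0..l} \<Longrightarrow> d (c s) (c t) = \<bar>s - t\<bar>"
      by (rule geodesic_segmentE[OF g], rule that)
    have "c 0 \<in> c ` {0..l}" "c l \<in> c ` {0..l}" using c(1) by auto
    then have xy: "x \<in> M" "y \<in> M" using c(2-5) by auto
    have dxy: "d x y = l" using iso[of 0 l] c by simp
    have "S \<subseteq> {m \<in> M. d x m + d m y = d x y}"
    proof
      fix m assume "m \<in> S"
      then obtain s where s: "s \<in> {0..l}" "m = c s" using c(4) by blast
      then show "m \<in> {m \<in> M. d x m + d m y = d x y}"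
        using iso[of 0 s] iso[of s l] c dxy \<open>m \<in> S\<close> by auto
    qed
    moreover have "m \<in> S" if m: "m \<in> M" "d x m + d m y = d x y" for m
    proof -
      let ?s = "d x m"
      have s: "?s \<in> {0..l}" using m dxy nonneg[of m y] nonneg[of x m] by auto
      have cs: "c ?s \<in> M" using s c by blast
      have "d x (c ?s) = ?s" "d (c ?s) y = l - ?s"
        using iso[of 0 ?s] iso[of ?s l] s c by auto
      \<comment> \<open>Both points have the same distances from \<open>x\<close> and from
        \<open>y\<close>, so each term of the maximum equals \<open>l\<close> and nothing is left
        for the distance between them.\<close>
      then have "d m (c ?s) + d x y \<le> l"
        using four[OF m(1) cs xy] m dxy commute[of m x] commute[of "c ?s" x] by auto
      then have "m = c ?s" using dxy nonneg[of m "c ?s"] zero[OF m(1) cs] by auto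
      then show ?thesis using s c(4) by blast
    qed
    ultimately show ?thesis using xy by blast
  qed
  have concat: "geodesic_segment M d y z (S \<union> T)"
    if S: "geodesic_segment M d y x S" and T: "geodesic_segment M d x z T" and ST: "S \<inter> T = {x}"
    for x y z S T
  proof -
    have M: "x \<in> M" "y \<in> M" "z \<in> M" using seg[OF S] seg[OF T] by auto
    \<comment> \<open>The Gromov product of \<open>y\<close> and \<open>z\<close> at
      \<open>x\<close>: in a tree, the length shared by the segments from \<open>x\<close> to
      \<open>y\<close> and to \<open>z\<close>. The point \<open>s\<close> of \<open>S\<close> at
      this distance from \<open>x\<close> also lies on \<open>T\<close>, so
      \<open>k = 0\<close>.\<close>
    define k where "k = (d x y + d x z - d y z) / 2"
    have yx: "d y x = d x y" by (rule commute)
    have k0: "0 \<le> k" using triangle[OF M(2,1,3)] yx unfolding k_def by simp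
    have kxy: "k \<le> d x y" using triangle[OF M(1,2,3)] unfolding k_def by simp
    obtain c l where c: "0 \<le> (l::real)" "c 0 = y" "c l = x" "c ` {0..l} = S" "S \<subseteq> M"
      and iso: "\<And>s t. s \<in> {0..l} \<Longrightarrow> t \<in> {0..l} \<Longrightarrow> d (c s) (c t) = \<bar>s - t\<bar>"
      by (rule geodesic_segmentE[OF S], rule that)
    have l: "l = d x y" using iso[of 0 l] c yx by simp
    define s where "s = c (l - k)"
    have sk: "s \<in> S" "s \<in> M" "d y s = l - k" "d s x = k"
      using iso[of 0 "l - k"] iso[of "l - k" l] c l k0 kxy unfolding s_def by auto
    have "d s z + d x y \<le> d x y + d x z - k"
      using four[OF sk(2) M(3,1,2)] sk yx l commute[of s y] commute[of z y] commute[of z x]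
      unfolding k_def by (auto simp: field_simps max_def split: if_splits)
    then have "d x s + d s z = d x z"
      using triangle[OF M(1) sk(2) M(3)] sk(4) commute[of x s] by simp
    then have "s \<in> T" using seg[OF T] sk by auto
    then have "s = x" using ST sk by blast
    then have "k = 0" using sk M by simp
    then have add: "d y z = d y x + d x z" unfolding k_def using yx by simp
    obtain U where U: "geodesic_segment M d y z U" using geo M by blast
    have "U = S \<union> T"
    proof (intro equalityI subsetI)
      fix m assume "m \<in> U"
      then have m: "m \<in> M" "d y m + d m z = d y z" using seg[OF U] by auto
      have "d m x + d y z \<le> max (d y m + d x z) (d m z + d y x)"
        using four[OF m(1) M(1,2,3)] commute[of m y] yx by (simp add: add.commute)
      then have "d m x \<le> \<bar>d y m - d y x\<bar>" using m add by (auto simp: max_def split: if_splits)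
      then consider "d y m + d m x \<le> d y x" | "d x m + d m z \<le> d x z"
        using m add commute[of x m] by linarith
      then show "m \<in> S \<union> T"
        using seg[OF S] seg[OF T] m triangle[OF M(2) m(1) M(1)] triangle[OF M(1) m(1) M(3)]
        by cases auto
    next
      fix m assume "m \<in> S \<union> T"
      then have "m \<in> M \<and> d y m + d m z = d y z"
      proof
        assume "m \<in> S"
        then have "m \<in> M" "d y m + d m x = d y x" using seg[OF S] by auto
        then show ?thesis
          using triangle[of m x z] triangle[of y m z] M add by simp
      next
        assume "m \<in> T"
        then have "m \<in> M" "d x m + d m z = d x z" using seg[OF T] by auto
        then show ?thesis
          using triangle[of y x m] triangle[of y m z] M add by simp
      qed
      then show "m \<in> U" using seg[OF U] by auto
    qed
    then show ?thesis using U by simp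
  qed
  show ?thesis
    unfolding real_tree_def
    using assms(1) geo seg concat by (metis (no_types, lifting))
qed


text \<open>An error \<open>e n\<close> of smaller order than \<open>d n\<close> vanishes in the
  limit. Balls of radius \<open>n * d n\<close> suffice in \<open>hyp\<close>, because a sequence of
  the cone stays within a fixed multiple of \<open>d n\<close>. The discrete geodesics in
  \<open>geo\<close> rescale to segments.\<close>

lemma real_tree_cone:
  fixes G :: "('a, 'b) monoid_scheme" and S :: "'a set" and d e :: "nat \<Rightarrow> real"
  defines "D \<equiv> word_dist G S"
  assumes \<omega>: "nonprincipal_ultrafilter \<omega>" and d: "scaling_sequence d"
    and one: "\<one>\<^bsub>G\<^esub> \<in> carrier G"
    and refl: "\<And>x. x \<in> carrier G \<Longrightarrow> D x x = 0"
    and sym: "\<And>x y. \<lbrakk>x \<in> carrier G; y \<in> carrier G\<rbrakk> \<Longrightarrow> D x y = D y x"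
    and tri: "\<And>x y z. \<lbrakk>x \<in> carrier G; y \<in> carrier G; z \<in> carrier G\<rbrakk> \<Longrightarrow> D x z \<le> D x y + D y z"
    and geo: "\<And>x y. \<lbrakk>x \<in> carrier G; y \<in> carrier G\<rbrakk> \<Longrightarrow>
      \<exists>p N. p 0 = x \<and> p N = y \<and> (\<forall>i\<le>N. p i \<in> carrier G) \<and>
        (\<forall>i\<le>N. \<forall>j\<le>N. D (p i) (p j) = \<bar>real i - real j\<bar>)"
    and hyp: "\<And>n x y z w. \<lbrakk>x \<in> carrier G; y \<in> carrier G; z \<in> carrier G; w \<in> carrier G;
      \<forall>v\<in>{x, y, z, w}. D \<one>\<^bsub>G\<^esub> v \<le> real n * d n\<rbrakk> \<Longrightarrow>
      D x y + D z w \<le> max (D x z + D y w) (D y z + D x w) + e n"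
    and e: "(\<lambda>n. e n / d n) \<longlonglongrightarrow> 0"
  shows "real_tree (cone G S \<omega> d) (cone_dist G S \<omega> d)"
proof -
  have nb: "\<omega> \<noteq> bot" using \<omega> by (simp add: nonprincipal_ultrafilter_def)
  have seq: "\<omega> \<le> sequentially" by (rule nonprincipal_ultrafilter_le_sequentially[OF \<omega>])
  have dpos: "d n > 0" for n using d by (simp add: scaling_sequence_def)
  have dinf: "filterlim d at_top sequentially"
  proof (rule filterlim_at_top[THEN iffD2], rule allI)
    fix Z :: real
    obtain N where "d N > Z" using d unfolding scaling_sequence_def bdd_above_def by (auto simp: not_le)
    then have "\<And>n. n \<ge> N \<Longrightarrow> Z \<le> d n"
      using d unfolding scaling_sequence_def mono_def by (meson less_imp_le order_trans)
    then show "eventually (\<lambda>n. Z \<le> d n) sequentially" by (auto simp: eventually_sequentially)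
  qed
  define Q where "Q = cone_seqs G S d"
  define r where "r g h n = D (g n) (h n) / d n" for g h n
  define L where "L g h = Lim \<omega> (r g h)" for g h
  have D0: "0 \<le> D x y" for x y by (simp add: D_def word_dist_def)
  have Qc: "g n \<in> carrier G" if "g \<in> Q" for g n using that by (simp add: Q_def cone_seqs_def)
  have Qb: "\<exists>C. \<forall>n. D \<one>\<^bsub>G\<^esub> (g n) \<le> C * d n" if "g \<in> Q" for g
    using that dpos by (auto simp: Q_def cone_seqs_def D_def pos_divide_le_eq)
  have QI: "g \<in> Q" if "\<And>n. g n \<in> carrier G" "\<And>n. D \<one>\<^bsub>G\<^esub> (g n) \<le> C * d n" for g C
    using that dpos by (auto simp: Q_def cone_seqs_def D_def pos_divide_le_eq)
  have lim: "(r g h \<longlongrightarrow> L g h) \<omega>" if gh: "g \<in> Q" "h \<in> Q" for g h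
  proof -
    obtain A where A: "\<And>n. D \<one>\<^bsub>G\<^esub> (g n) \<le> A * d n" using Qb gh by blast
    obtain B where B: "\<And>n. D \<one>\<^bsub>G\<^esub> (h n) \<le> B * d n" using Qb gh by blast
    have "r g h n \<le> A + B" for n
    proof -
      have "D (g n) (h n) \<le> D \<one>\<^bsub>G\<^esub> (g n) + D \<one>\<^bsub>G\<^esub> (h n)"
        using tri[of "g n" "\<one>\<^bsub>G\<^esub>" "h n"] sym[of "g n" "\<one>\<^bsub>G\<^esub>"] Qc gh one by simp
      also have "\<dots> \<le> (A + B) * d n" using A[of n] B[of n] by (simp add: algebra_simps)
      finally show ?thesis unfolding r_def using dpos[of n] by (simp add: pos_divide_le_eq)
    qed
    moreover have "0 \<le> r g h n" for n using D0 dpos[of n] by (simp add: r_def)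
    ultimately obtain l where "(r g h \<longlongrightarrow> l) \<omega>"
      using ultrafilter_bounded_tendsto[OF \<omega>, of 0 "r g h" "A + B"] by blast
    then show ?thesis unfolding L_def using tendsto_Lim[OF nb] by metis
  qed
  have Luniq: "L g h = l" if "(r g h \<longlongrightarrow> l) \<omega>" for g h l
    unfolding L_def using tendsto_Lim[OF nb that] .
  have r0: "0 \<le> r g h n" for g h n using D0 dpos[of n] by (simp add: r_def)
  have L0: "0 \<le> L g h" if "g \<in> Q" "h \<in> Q" for g h
    using tendsto_lowerbound[OF lim[OF that] always_eventually nb] r0 by blast
  have Lrefl: "L g g = 0" if "g \<in> Q" for g
  proof (rule Luniq)
    have "r g g = (\<lambda>n. 0)" using refl Qc[OF that] by (auto simp: r_def)
    then show "(r g g \<longlongrightarrow> 0) \<omega>" by simp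
  qed
  have Lsym: "L g h = L h g" if "g \<in> Q" "h \<in> Q" for g h
  proof -
    have "r g h = r h g" using sym[OF Qc[OF that(1)] Qc[OF that(2)]] by (auto simp: r_def)
    then show ?thesis by (simp add: L_def)
  qed
  have Ltri: "L f h \<le> L f g + L g h" if fgh: "f \<in> Q" "g \<in> Q" "h \<in> Q" for f g h
  proof (rule tendsto_le[OF nb])
    show "(r f h \<longlongrightarrow> L f h) \<omega>" using lim fgh by blast
    show "((\<lambda>n. r f g n + r g h n) \<longlongrightarrow> L f g + L g h) \<omega>"
      by (intro tendsto_add lim fgh)
    show "\<forall>\<^sub>F n in \<omega>. r f h n \<le> r f g n + r g h n"
    proof (rule always_eventually, rule allI)
      fix n
      have "D (f n) (h n) \<le> D (f n) (g n) + D (g n) (h n)"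
        by (rule tri[OF Qc[OF fgh(1)] Qc[OF fgh(2)] Qc[OF fgh(3)]])
      then have "D (f n) (h n) / d n \<le> (D (f n) (g n) + D (g n) (h n)) / d n"
        using dpos[of n] by (intro divide_right_mono) auto
      then show "r f h n \<le> r f g n + r g h n" by (simp add: r_def add_divide_distrib)
    qed
  qed
  have L4: "L x y + L z w \<le> max (L x z + L y w) (L y z + L x w)"
    if xyzw: "x \<in> Q" "y \<in> Q" "z \<in> Q" "w \<in> Q" for x y z w
  proof (rule tendsto_le[OF nb])
    show "((\<lambda>n. r x y n + r z w n) \<longlongrightarrow> L x y + L z w) \<omega>"
      by (intro tendsto_add lim xyzw)
    have e0: "((\<lambda>n. e n / d n) \<longlongrightarrow> 0) \<omega>" using e seq by (rule tendsto_mono[rotated])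
    have "((\<lambda>n. max (r x z n + r y w n) (r y z n + r x w n) + e n / d n) \<longlongrightarrow>
       max (L x z + L y w) (L y z + L x w) + 0) \<omega>"
      by (intro tendsto_add tendsto_max lim xyzw e0)
    then show "((\<lambda>n. max (r x z n + r y w n) (r y z n + r x w n) + e n / d n) \<longlongrightarrow>
       max (L x z + L y w) (L y z + L x w)) \<omega>" by simp
    have bd: "\<forall>\<^sub>F n in \<omega>. D \<one>\<^bsub>G\<^esub> (g n) \<le> real n * d n" if "g \<in> Q" for g
    proof -
      obtain A where A: "\<And>n. D \<one>\<^bsub>G\<^esub> (g n) \<le> A * d n" using Qb \<open>g \<in> Q\<close> by blast
      have "\<forall>\<^sub>F n in sequentially. A \<le> real n"
        using filterlim_real_sequentially by (simp add: filterlim_at_top)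
      then have "\<forall>\<^sub>F n in \<omega>. A \<le> real n" using seq by (simp add: filter_leD)
      then show ?thesis
      proof eventually_elim
        case (elim n)
        then have "A * d n \<le> real n * d n" using dpos[of n] by (simp add: mult_right_mono)
        with A[of n] show ?case by linarith
      qed
    qed
    show "\<forall>\<^sub>F n in \<omega>. r x y n + r z w n
        \<le> max (r x z n + r y w n) (r y z n + r x w n) + e n / d n"
      using bd[OF xyzw(1)] bd[OF xyzw(2)] bd[OF xyzw(3)] bd[OF xyzw(4)]
    proof eventually_elim
      case (elim n)
      then have "D (x n) (y n) + D (z n) (w n)
          \<le> max (D (x n) (z n) + D (y n) (w n)) (D (y n) (z n) + D (x n) (w n)) + e n"
        using Qc xyzw by (intro hyp) auto
      then have "(D (x n) (y n) + D (z n) (w n)) / d n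
          \<le> (max (D (x n) (z n) + D (y n) (w n)) (D (y n) (z n) + D (x n) (w n)) + e n) / d n"
        using dpos[of n] by (simp add: divide_right_mono)
      moreover have "max a b / d n = max (a / d n) (b / d n)" for a b
        using dpos[of n] by (simp add: max_divide_distrib_right)
      ultimately show ?case unfolding r_def by (simp add: add_divide_distrib)
    qed
  qed
  define R where "R = cone_rel G S \<omega> d"
  have Riff: "(g, h) \<in> R \<longleftrightarrow> g \<in> Q \<and> h \<in> Q \<and> L g h = 0" for g h
  proof -
    have "(g, h) \<in> R \<longleftrightarrow> g \<in> Q \<and> h \<in> Q \<and> (r g h \<longlongrightarrow> 0) \<omega>"
      by (simp add: R_def cone_rel_def Q_def r_def[abs_def] D_def)
    then show ?thesis using lim Luniq by metis
  qed
  have equiv: "equiv Q R"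
  proof (rule equivI)
    show "R \<subseteq> Q \<times> Q" using Riff by auto
    show "refl_on Q R" using Riff Lrefl by (auto simp: refl_on_def)
    show "Relation.sym R" using Riff Lsym by (auto simp: sym_def)
    show "trans R"
    proof (rule transI)
      fix f g h assume "(f, g) \<in> R" "(g, h) \<in> R"
      then show "(f, h) \<in> R" using Ltri[of f g h] L0[of f h] by (auto simp: Riff)
    qed
  qed
  have Lcong: "L g h = L g' h'" if "(g, g') \<in> R" "(h, h') \<in> R" for g g' h h'
    using that Ltri[of g g' h] Ltri[of g' h' h] Ltri[of g' g h'] Ltri[of g h h'] Lsym[of g g'] Lsym[of h h']
    by (auto simp: Riff)
  have cone: "cone G S \<omega> d = Q // R" by (simp add: cone_def Q_def R_def)
  have dist: "cone_dist G S \<omega> d (R `` {g}) (R `` {h}) = L g h" if gh: "g \<in> Q" "h \<in> Q" for g h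
  proof -
    have self: "g \<in> R `` {g}" "h \<in> R `` {h}" using gh Lrefl by (auto simp: Riff)
    have "(THE l. \<forall>g'\<in>R `` {g}. \<forall>h'\<in>R `` {h}. (r g' h' \<longlongrightarrow> l) \<omega>) = L g h"
    proof (rule the_equality)
      show "\<forall>g'\<in>R `` {g}. \<forall>h'\<in>R `` {h}. (r g' h' \<longlongrightarrow> L g h) \<omega>"
      proof (intro ballI)
        fix g' h' assume a: "g' \<in> R `` {g}" "h' \<in> R `` {h}"
        then have "L g h = L g' h'" by (intro Lcong) auto
        then show "(r g' h' \<longlongrightarrow> L g h) \<omega>" using lim[of g' h'] a by (simp add: Riff)
      qed
    next
      fix l assume "\<forall>g'\<in>R `` {g}. \<forall>h'\<in>R `` {h}. (r g' h' \<longlongrightarrow> l) \<omega>"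
      then have "(r g h \<longlongrightarrow> l) \<omega>" using self by blast
      then show "l = L g h" using Luniq by simp
    qed
    then show ?thesis
      using gh by (simp add: cone_dist_def cone quotientI r_def[abs_def] D_def)
  qed
  have ex: "\<exists>g\<in>Q. A = R `` {g}" if "A \<in> Q // R" for A using that by (auto elim: quotientE)
  have eqc: "R `` {g} = R `` {h} \<longleftrightarrow> L g h = 0" if "g \<in> Q" "h \<in> Q" for g h
    using eq_equiv_class_iff[OF equiv that] Riff that by simp
  show ?thesis
    unfolding cone
  proof (rule real_tree_four_point)
    let ?d = "cone_dist G S \<omega> d"
    show "Metric_space (Q // R) ?d"
    proof
      fix A B
      have "0 \<le> ?d A B \<and> ?d A B = ?d B A"
      proof (cases "A \<in> Q // R \<and> B \<in> Q // R")
        case True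
        then obtain g h where "g \<in> Q" "h \<in> Q" "A = R `` {g}" "B = R `` {h}" using ex by blast
        then show ?thesis using dist L0 Lsym by metis
      qed (auto simp: cone_dist_def cone)
      then show "0 \<le> ?d A B" "?d A B = ?d B A" by auto
    next
      fix A B assume "A \<in> Q // R" "B \<in> Q // R"
      then obtain g h where "g \<in> Q" "h \<in> Q" "A = R `` {g}" "B = R `` {h}" using ex by blast
      then show "?d A B = 0 \<longleftrightarrow> A = B" using dist eqc by metis
    next
      fix A B C assume "A \<in> Q // R" "B \<in> Q // R" "C \<in> Q // R"
      then obtain f g h where "f \<in> Q" "g \<in> Q" "h \<in> Q" "A = R `` {f}" "B = R `` {g}" "C = R `` {h}"
        using ex by meson
      then show "?d A C \<le> ?d A B + ?d B C" using dist Ltri by metis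
    qed
  next
    fix A B C E assume "A \<in> Q // R" "B \<in> Q // R" "C \<in> Q // R" "E \<in> Q // R"
    then obtain x y z w where "x \<in> Q" "y \<in> Q" "z \<in> Q" "w \<in> Q"
      "A = R `` {x}" "B = R `` {y}" "C = R `` {z}" "E = R `` {w}"
      using ex by meson
    then show "cone_dist G S \<omega> d A B + cone_dist G S \<omega> d C E \<le>
       max (cone_dist G S \<omega> d A C + cone_dist G S \<omega> d B E) (cone_dist G S \<omega> d B C + cone_dist G S \<omega> d A E)"
      using dist L4[of x y z w] by simp
  next
    fix A B assume "A \<in> Q // R" "B \<in> Q // R"
    then obtain g h where g: "g \<in> Q" and h: "h \<in> Q" and AB: "A = R `` {g}" "B = R `` {h}"
      using ex by blast
    have "\<forall>n. \<exists>p N. p 0 = g n \<and> p N = h n \<and> (\<forall>i\<le>N. p i \<in> carrier G) \<and>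
        (\<forall>i\<le>N. \<forall>j\<le>N. D (p i) (p j) = \<bar>real i - real j\<bar>)"
      using geo Qc g h by blast
    then obtain p N where p0: "\<And>n. p n 0 = g n" and pN: "\<And>n. p n (N n) = h n"
      and pc: "\<And>n i. i \<le> N n \<Longrightarrow> p n i \<in> carrier G"
      and pD: "\<And>n i j. \<lbrakk>i \<le> N n; j \<le> N n\<rbrakk> \<Longrightarrow> D (p n i) (p n j) = \<bar>real i - real j\<bar>"
      by metis
    define l where "l = L g h"
    have l0: "0 \<le> l" using L0 g h by (simp add: l_def)
    have rN: "r g h n = real (N n) / d n" for n
      using pD[of 0 n "N n"] by (simp add: r_def p0 pN)
    have Nl: "((\<lambda>n. real (N n) / d n) \<longlongrightarrow> l) \<omega>"
      using lim[OF g h] by (simp add: rN[abs_def] l_def)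
    \<comment> \<open>The discrete geodesic is sampled at time \<open>s * d n\<close>. The minimum
      keeps the index on the path; after division by \<open>d n\<close> it tends to
      \<open>min s l\<close>, which is \<open>s\<close>.\<close>
    define k where "k s n = min (nat \<lfloor>s * d n\<rfloor>) (N n)" for s n
    define c where "c s n = p n (k s n)" for s n
    have kl: "((\<lambda>n. real (k s n) / d n) \<longlongrightarrow> s) \<omega>" if s: "s \<in> {0..l}" for s
    proof -
      have "((\<lambda>n. s - 1 / d n) \<longlongrightarrow> s - 0) sequentially"
        using dinf by (intro tendsto_diff tendsto_const real_tendsto_divide_at_top) auto
      then have lo: "((\<lambda>n. s - 1 / d n) \<longlongrightarrow> s) \<omega>"
        using seq by (auto intro: tendsto_mono)
      have fl: "((\<lambda>n. real (nat \<lfloor>s * d n\<rfloor>) / d n) \<longlongrightarrow> s) \<omega>"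
      proof (rule tendsto_sandwich[OF _ _ lo tendsto_const])
        have *: "s * d n - 1 \<le> real (nat \<lfloor>s * d n\<rfloor>)" "real (nat \<lfloor>s * d n\<rfloor>) \<le> s * d n" for n
        proof -
          have "0 \<le> s * d n" using s dpos[of n] by simp
          then show "s * d n - 1 \<le> real (nat \<lfloor>s * d n\<rfloor>)" "real (nat \<lfloor>s * d n\<rfloor>) \<le> s * d n"
            by linarith+
        qed
        show "\<forall>\<^sub>F n in \<omega>. s - 1 / d n \<le> real (nat \<lfloor>s * d n\<rfloor>) / d n"
        proof (rule always_eventually, rule allI)
          fix n
          have "s - 1 / d n = (s * d n - 1) / d n" using dpos[of n] by (simp add: diff_divide_distrib)
          then show "s - 1 / d n \<le> real (nat \<lfloor>s * d n\<rfloor>) / d n"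
            using *(1)[of n] dpos[of n] by (simp add: divide_right_mono)
        qed
        show "\<forall>\<^sub>F n in \<omega>. real (nat \<lfloor>s * d n\<rfloor>) / d n \<le> s"
          using *(2) dpos by (intro always_eventually allI) (simp add: pos_divide_le_eq)
      qed
      have "((\<lambda>n. min (real (nat \<lfloor>s * d n\<rfloor>) / d n) (real (N n) / d n)) \<longlongrightarrow> min s l) \<omega>"
        using fl Nl by (rule tendsto_min)
      moreover have "min (real (nat \<lfloor>s * d n\<rfloor>) / d n) (real (N n) / d n) = real (k s n) / d n" for n
        unfolding k_def of_nat_min using dpos[of n] by (simp add: min_divide_distrib_right)
      ultimately show ?thesis using s by simp
    qed
    have kN: "k s n \<le> N n" for s n by (simp add: k_def)
    have cc: "c s n \<in> carrier G" for s n unfolding c_def using pc kN by blast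
    have gc: "D (g n) (c s n) = real (k s n)" for s n
      using pD[of 0 n "k s n"] kN by (simp add: p0 c_def)
    have cQ: "c s \<in> Q" if "s \<in> {0..l}" for s
    proof -
      obtain C where C: "\<And>n. D \<one>\<^bsub>G\<^esub> (g n) \<le> C * d n" using Qb g by blast
      have "D \<one>\<^bsub>G\<^esub> (c s n) \<le> (C + s) * d n" for n
      proof -
        have "D \<one>\<^bsub>G\<^esub> (c s n) \<le> D \<one>\<^bsub>G\<^esub> (g n) + D (g n) (c s n)" using tri one Qc g cc by blast
        moreover have "real (k s n) \<le> s * d n"
        proof -
          have "0 \<le> s * d n" using that dpos[of n] by simp
          then have "real (nat \<lfloor>s * d n\<rfloor>) \<le> s * d n" by linarith
          then show ?thesis by (simp add: k_def)
        qed
        ultimately show ?thesis using C[of n] gc[of n s] by (simp add: algebra_simps)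
      qed
      then show ?thesis using cc by (intro QI) auto
    qed
    have Lc: "L (c s) (c t) = \<bar>s - t\<bar>" if "s \<in> {0..l}" "t \<in> {0..l}" for s t
    proof (rule Luniq)
      have "r (c s) (c t) n = \<bar>real (k s n) / d n - real (k t n) / d n\<bar>" for n
        using pD[OF kN kN, of n s t] dpos[of n]
        by (simp add: r_def c_def diff_divide_distrib[symmetric] abs_divide)
      then have "r (c s) (c t) = (\<lambda>n. \<bar>real (k s n) / d n - real (k t n) / d n\<bar>)" by (rule ext)
      moreover have "((\<lambda>n. \<bar>real (k s n) / d n - real (k t n) / d n\<bar>) \<longlongrightarrow> \<bar>s - t\<bar>) \<omega>"
        by (intro tendsto_rabs tendsto_diff kl that)
      ultimately show "(r (c s) (c t) \<longlongrightarrow> \<bar>s - t\<bar>) \<omega>" by simp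
    qed
    have c0: "R `` {c 0} = A"
    proof -
      have "c 0 = g" by (rule ext) (simp add: c_def k_def p0)
      then show ?thesis using AB by simp
    qed
    have cl: "R `` {c l} = B"
    proof -
      have "L (c l) h = 0"
      proof (rule Luniq)
        have "r (c l) h n = \<bar>real (k l n) / d n - real (N n) / d n\<bar>" for n
          using pD[OF kN order_refl, of n l] dpos[of n]
          by (simp add: r_def c_def pN diff_divide_distrib[symmetric] abs_divide)
        then have "r (c l) h = (\<lambda>n. \<bar>real (k l n) / d n - real (N n) / d n\<bar>)" by (rule ext)
        moreover have "((\<lambda>n. \<bar>real (k l n) / d n - real (N n) / d n\<bar>) \<longlongrightarrow> \<bar>l - l\<bar>) \<omega>"
          using l0 by (intro tendsto_rabs tendsto_diff kl Nl) auto
        ultimately show "(r (c l) h \<longlongrightarrow> 0) \<omega>" by simp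
      qed
      then show ?thesis using eqc[OF cQ h] l0 AB by simp
    qed
    show "\<exists>S'. geodesic_segment (Q // R) (cone_dist G S \<omega> d) A B S'"
    proof -
      let ?c = "\<lambda>s. R `` {c s}"
      have "?c ` {0..l} \<subseteq> Q // R" using cQ by (auto intro: quotientI)
      moreover have "\<forall>s\<in>{0..l}. \<forall>t\<in>{0..l}. cone_dist G S \<omega> d (?c s) (?c t) = \<bar>s - t\<bar>"
        using dist cQ Lc by simp
      ultimately have "geodesic_segment (Q // R) (cone_dist G S \<omega> d) A B (?c ` {0..l})"
        unfolding geodesic_segment_def using l0 c0 cl by (intro exI[of _ ?c] exI[of _ l]) simp
      then show ?thesis by blast
    qed
  qed
qed

section \<open>Finite \<open>p\<close>-groups\<close>

lemma (in group) p_groupI: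
  assumes p: "Factorial_Ring.prime p" and x: "\<And>x. x \<in> carrier G \<Longrightarrow> \<exists>k. x [^] (p ^ k) = \<one>"
  shows "p_group p G"
  unfolding p_group_def
proof (intro conjI ballI)
  fix x assume "x \<in> carrier G"
  then obtain k where "ord x dvd p ^ k" using x pow_eq_id by metis
  then show "\<exists>k. ord x = p ^ k" using divides_primepow_nat[OF p] by blast
qed (rule is_group)

lemma p_group_pow:
  assumes "p_group p G" "x \<in> carrier G"
  obtains k where "x [^]\<^bsub>G\<^esub> (p ^ k) = \<one>\<^bsub>G\<^esub>"
proof -
  interpret group G using assms(1) by (simp add: p_group_def)
  obtain k where "ord x = p ^ k" using assms by (auto simp: p_group_def)
  then have "x [^]\<^bsub>G\<^esub> (p ^ k) = \<one>\<^bsub>G\<^esub>" using assms(2) by (metis pow_ord_eq_1)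
  then show ?thesis by (rule that)
qed

text \<open>A Sylow subgroup for a prime \<open>q\<close> dividing the order contains an element
  other than 1, whose order is a power of \<open>p\<close> and also divides a power of
  \<open>q\<close>.\<close>

lemma p_group_order:
  assumes p: "Factorial_Ring.prime p" and G: "p_group p G" and fin: "finite (carrier G)"
  shows "\<exists>a. order G = p ^ a"
proof -
  interpret group G using G by (simp add: p_group_def)
  have o0: "order G \<noteq> 0" using order_gt_0_iff_finite fin by simp
  have "q = p" if q: "Factorial_Ring.prime q" "q dvd order G" for q
  proof -
    obtain m where m: "order G = q ^ multiplicity q (order G) * m"
      using multiplicity_dvd[of q "order G"] by (auto elim: dvdE)
    have mult: "multiplicity q (order G) > 0"
      using q o0 by (simp add: prime_multiplicity_gt_zero_iff)
    obtain H where H: "subgroup H G" "card H = q ^ multiplicity q (order G)"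
      using sylow_thm[OF q(1) is_group m fin] by blast
    have "1 < q ^ multiplicity q (order G)" using mult q(1) by (intro one_less_power prime_gt_1_nat)
    then have "card H \<noteq> card {\<one>\<^bsub>G\<^esub>}" unfolding H(2) by (metis card.empty card.insert empty_iff finite.emptyI less_irrefl One_nat_def)
    then have "H \<noteq> {\<one>\<^bsub>G\<^esub>}" by (rule contrapos_nn) (rule arg_cong)
    then obtain x where x: "x \<in> H" "x \<noteq> \<one>\<^bsub>G\<^esub>" using subgroup.one_closed[OF H(1)] by blast
    have xG: "x \<in> carrier G" by (rule subgroup.mem_carrier[OF H(1) x(1)])
    obtain k where k: "ord x = p ^ k" using G xG by (auto simp: p_group_def)
    interpret H: group "G\<lparr>carrier := H\<rparr>" using H(1) by (simp add: subgroup_imp_group)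
    have "x [^]\<^bsub>G\<^esub> card H = \<one>\<^bsub>G\<^esub>"
      using H.pow_order_eq_1[of x] x(1) by (simp add: order_def nat_pow_consistent[symmetric])
    then have dvd: "ord x dvd q ^ multiplicity q (order G)" using pow_eq_id[OF xG] H(2) by metis
    have "k \<noteq> 0" using k x(2) ord_eq_1[OF xG] by auto
    then have "p dvd ord x" unfolding k by (simp add: dvd_power)
    then have "p dvd q ^ multiplicity q (order G)" using dvd by (rule dvd_trans)
    then have "p dvd q" using p by (rule prime_dvd_power[rotated])
    then show ?thesis using primes_dvd_imp_eq[OF p q(1)] by simp
  qed
  then have "\<not> (\<exists>q\<in>prime_factors (order G). q \<noteq> p)" by blast
  then have "\<exists>k. normalize (order G) = p ^ k" using Ex_other_prime_factor[OF o0 _ p] by blast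
  then show ?thesis by simp
qed

text \<open>The class equation: if 1 were the only central element, every other conjugacy class
  would have size divisible by \<open>p\<close>, and \<open>p\<close> would divide 1.\<close>

lemma p_group_center_nontrivial:
  assumes p: "Factorial_Ring.prime p" and G: "p_group p G" and fin: "finite (carrier G)"
    and nt: "carrier G \<noteq> {\<one>\<^bsub>G\<^esub>}"
  shows "\<exists>x\<in>carrier G. x \<noteq> \<one>\<^bsub>G\<^esub> \<and> (\<forall>g\<in>carrier G. g \<otimes>\<^bsub>G\<^esub> x = x \<otimes>\<^bsub>G\<^esub> g)"
proof (rule ccontr)
  assume neg: "\<not> ?thesis"
  interpret group G using G by (simp add: p_group_def)
  let ?\<phi> = "\<lambda>g. \<lambda>h\<in>carrier G. g \<otimes>\<^bsub>G\<^esub> h \<otimes>\<^bsub>G\<^esub> inv\<^bsub>G\<^esub> g"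
  interpret C: group_action G "carrier G" ?\<phi> by (rule action_by_conjugation)
  obtain a where a: "order G = p ^ a" using p_group_order[OF p G fin] by blast
  have p1: "p > 1" using p by (rule prime_gt_1_nat)
  have "order G \<noteq> 1" using nt by (metis card_1_singletonE one_closed order_def singletonD)
  then have pdvd: "p dvd order G" using a by (cases a) auto
  let ?O = "orbits G (carrier G) ?\<phi>"
  have finO: "finite ?O" using fin by (simp add: orbits_def)
  have one: "orbit G ?\<phi> \<one>\<^bsub>G\<^esub> = {\<one>\<^bsub>G\<^esub>}" by (auto simp: orbit_def intro!: exI[of _ "\<one>\<^bsub>G\<^esub>"])
  have big: "p dvd card A" if A: "A \<in> ?O - {{\<one>\<^bsub>G\<^esub>}}" for A
  proof -
    obtain x where x: "x \<in> carrier G" "A = orbit G ?\<phi> x" using A by (auto simp: orbits_def)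
    then have "x \<noteq> \<one>\<^bsub>G\<^esub>" using A one by auto
    then obtain g where g: "g \<in> carrier G" "g \<otimes>\<^bsub>G\<^esub> x \<noteq> x \<otimes>\<^bsub>G\<^esub> g" using neg x by blast
    have "card A dvd order G"
      unfolding x(2) C.orbit_stabilizer_theorem[OF x(1), symmetric] by (rule dvd_triv_left)
    then have "card A dvd p ^ a" unfolding a .
    then obtain i where i: "card A = p ^ i" using divides_primepow_nat[OF p] by blast
    have "x \<in> A" using C.orbit_refl x by simp
    moreover have "g \<otimes>\<^bsub>G\<^esub> x \<otimes>\<^bsub>G\<^esub> inv\<^bsub>G\<^esub> g \<in> A" using x g(1) by (auto simp: orbit_def)
    moreover have "g \<otimes>\<^bsub>G\<^esub> x \<otimes>\<^bsub>G\<^esub> inv\<^bsub>G\<^esub> g \<noteq> x"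
      using g x(1) by (metis inv_closed inv_solve_right' m_closed)
    ultimately have "card A \<noteq> 1" by (metis card_1_singletonE singletonD)
    then show ?thesis using i by (cases i) auto
  qed
  have "order G = (\<Sum>A\<in>?O. card A)"
    using C.disjoint_sum[OF fin, of "\<lambda>_. 1::nat"] by (simp add: order_def)
  also have "\<dots> = card {\<one>\<^bsub>G\<^esub>} + (\<Sum>A\<in>?O - {{\<one>\<^bsub>G\<^esub>}}. card A)"
    using one by (intro sum.remove finO) (auto simp: orbits_def intro!: exI[of _ "\<one>\<^bsub>G\<^esub>"])
  finally have sum: "order G = 1 + (\<Sum>A\<in>?O - {{\<one>\<^bsub>G\<^esub>}}. card A)" by simp
  have "p dvd (\<Sum>A\<in>?O - {{\<one>\<^bsub>G\<^esub>}}. card A)" using big by (intro dvd_sum) auto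
  then have "p dvd 1" using pdvd unfolding sum by (rule dvd_add_left_iff[THEN iffD1])
  then show False using p1 by simp
qed

lemma p_group_FactGroup:
  assumes p: "Factorial_Ring.prime p" and N: "N \<lhd> G"
    and pow: "\<And>x. x \<in> carrier G \<Longrightarrow> \<exists>k. x [^]\<^bsub>G\<^esub> (p ^ k) \<in> N"
  shows "p_group p (G Mod N)"
proof -
  interpret normal N G by (rule N)
  interpret Q: group "G Mod N" by (rule factorgroup_is_group)
  show ?thesis
  proof (rule Q.p_groupI[OF p])
    fix A assume "A \<in> carrier (G Mod N)"
    then obtain x where x: "x \<in> carrier G" "A = N #>\<^bsub>G\<^esub> x" by (auto simp: carrier_FactGroup)
    obtain k where k: "x [^]\<^bsub>G\<^esub> (p ^ k) \<in> N" using pow x by blast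
    have "A [^]\<^bsub>G Mod N\<^esub> (p ^ k) = N #>\<^bsub>G\<^esub> (x [^]\<^bsub>G\<^esub> (p ^ k))"
      using FactGroup_pow x by simp
    also have "\<dots> = \<one>\<^bsub>G Mod N\<^esub>" using k by (simp add: rcos_const)
    finally show "\<exists>k. A [^]\<^bsub>G Mod N\<^esub> (p ^ k) = \<one>\<^bsub>G Mod N\<^esub>" by blast
  qed
qed

lemma (in group) center_subgroup:
  "subgroup {x \<in> carrier G. \<forall>g\<in>carrier G. g \<otimes> x = x \<otimes> g} G"
proof
  fix x y assume "x \<in> {x \<in> carrier G. \<forall>g\<in>carrier G. g \<otimes> x = x \<otimes> g}"
    "y \<in> {x \<in> carrier G. \<forall>g\<in>carrier G. g \<otimes> x = x \<otimes> g}"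
  then have c: "x \<in> carrier G" "y \<in> carrier G"
    "\<And>g. g \<in> carrier G \<Longrightarrow> g \<otimes> x = x \<otimes> g" "\<And>g. g \<in> carrier G \<Longrightarrow> g \<otimes> y = y \<otimes> g" by blast+
  have "g \<otimes> (x \<otimes> y) = (x \<otimes> y) \<otimes> g" if g: "g \<in> carrier G" for g
  proof -
    have "g \<otimes> (x \<otimes> y) = (x \<otimes> g) \<otimes> y" using c(1,2) g by (simp only: m_assoc[symmetric] c(3))
    also have "\<dots> = x \<otimes> (y \<otimes> g)" using c(1,2) g by (simp only: m_assoc c(4))
    finally show ?thesis using c(1,2) g by (simp add: m_assoc)
  qed
  then show "x \<otimes> y \<in> {x \<in> carrier G. \<forall>g\<in>carrier G. g \<otimes> x = x \<otimes> g}" using c(1,2) by blast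
next
  fix x assume "x \<in> {x \<in> carrier G. \<forall>g\<in>carrier G. g \<otimes> x = x \<otimes> g}"
  then have c: "x \<in> carrier G" "\<And>g. g \<in> carrier G \<Longrightarrow> g \<otimes> x = x \<otimes> g" by blast+
  have "g \<otimes> inv x = inv x \<otimes> g" if g: "g \<in> carrier G" for g
  proof -
    have "inv x \<otimes> (g \<otimes> x) \<otimes> inv x = inv x \<otimes> (x \<otimes> g) \<otimes> inv x" by (simp only: c(2)[OF g])
    moreover have "inv x \<otimes> (g \<otimes> x) \<otimes> inv x = inv x \<otimes> g" using c(1) g by (simp add: m_assoc)
    moreover have "inv x \<otimes> (x \<otimes> g) \<otimes> inv x = g \<otimes> inv x" using c(1) g by (simp add: m_assoc[symmetric])
    ultimately show ?thesis by argo
  qed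
  then show "inv x \<in> {x \<in> carrier G. \<forall>g\<in>carrier G. g \<otimes> x = x \<otimes> g}" using c(1) by blast
qed auto

text \<open>\<open>Z'\<close> is the preimage of the centre of the quotient by \<open>Z\<close>;
  that quotient is a nontrivial \<open>p\<close>-group, so its centre is nontrivial.\<close>

lemma p_group_central_step:
  assumes p: "Factorial_Ring.prime p" and G: "p_group p G" and fin: "finite (carrier G)"
    and Z: "Z \<lhd> G" and ne: "Z \<noteq> carrier G"
  shows "\<exists>Z'. Z' \<lhd> G \<and> Z \<subset> Z' \<and>
    (\<forall>g\<in>carrier G. \<forall>x\<in>Z'. g \<otimes>\<^bsub>G\<^esub> x \<otimes>\<^bsub>G\<^esub> inv\<^bsub>G\<^esub> g \<otimes>\<^bsub>G\<^esub> inv\<^bsub>G\<^esub> x \<in> Z)"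
proof -
  interpret normal Z G by (rule Z)
  interpret Q: group "G Mod Z" by (rule factorgroup_is_group)
  let ?\<pi> = "\<lambda>x. Z #>\<^bsub>G\<^esub> x"
  have pi: "?\<pi> x \<in> carrier (G Mod Z)" if "x \<in> carrier G" for x
    using that by (auto simp: carrier_FactGroup)
  have mult: "?\<pi> (x \<otimes>\<^bsub>G\<^esub> y) = ?\<pi> x \<otimes>\<^bsub>G Mod Z\<^esub> ?\<pi> y" if "x \<in> carrier G" "y \<in> carrier G" for x y
    using that by (simp add: rcos_sum)
  have inv: "?\<pi> (inv\<^bsub>G\<^esub> x) = inv\<^bsub>G Mod Z\<^esub> ?\<pi> x" if "x \<in> carrier G" for x
    using that by (metis inv_FactGroup pi rcos_inv)
  have pi1: "?\<pi> x = \<one>\<^bsub>G Mod Z\<^esub> \<longleftrightarrow> x \<in> Z" if "x \<in> carrier G" for x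
    using that by (metis coset_join1 coset_join2 one_FactGroup subgroup_axioms subset)
  define C where "C = {a \<in> carrier (G Mod Z). \<forall>b\<in>carrier (G Mod Z). b \<otimes>\<^bsub>G Mod Z\<^esub> a = a \<otimes>\<^bsub>G Mod Z\<^esub> b}"
  have C: "subgroup C (G Mod Z)" unfolding C_def by (rule Q.center_subgroup)
  define Z' where "Z' = {x \<in> carrier G. ?\<pi> x \<in> C}"
  have comm: "?\<pi> g \<otimes>\<^bsub>G Mod Z\<^esub> ?\<pi> x = ?\<pi> x \<otimes>\<^bsub>G Mod Z\<^esub> ?\<pi> g" if "g \<in> carrier G" "x \<in> Z'" for g x
    using that pi unfolding Z'_def C_def by blast
  have pi_one: "?\<pi> \<one>\<^bsub>G\<^esub> = \<one>\<^bsub>G Mod Z\<^esub>" using pi1[OF one_closed] subgroup.one_closed[OF subgroup_axioms] by blast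
  have sub: "subgroup Z' G"
  proof
    show "Z' \<subseteq> carrier G" unfolding Z'_def by blast
    show "x \<otimes>\<^bsub>G\<^esub> y \<in> Z'" if "x \<in> Z'" "y \<in> Z'" for x y
    proof -
      have x: "x \<in> carrier G" "?\<pi> x \<in> C" "y \<in> carrier G" "?\<pi> y \<in> C" using that unfolding Z'_def by blast+
      then have "?\<pi> (x \<otimes>\<^bsub>G\<^esub> y) \<in> C" unfolding mult[OF x(1,3)] by (intro subgroup.m_closed[OF C])
      then show ?thesis unfolding Z'_def using x by blast
    qed
    have "?\<pi> \<one>\<^bsub>G\<^esub> \<in> C" unfolding pi_one by (rule subgroup.one_closed[OF C])
    then show "\<one>\<^bsub>G\<^esub> \<in> Z'" unfolding Z'_def by blast
    show "inv\<^bsub>G\<^esub> x \<in> Z'" if "x \<in> Z'" for x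
    proof -
      have x: "x \<in> carrier G" "?\<pi> x \<in> C" using that unfolding Z'_def by blast+
      then have "?\<pi> (inv\<^bsub>G\<^esub> x) \<in> C" unfolding inv[OF x(1)] by (intro subgroup.m_inv_closed[OF C])
      then show ?thesis unfolding Z'_def using x by blast
    qed
  qed
  have "Z' \<lhd> G"
  proof (rule normal_invI[OF sub])
    fix x h assume x: "x \<in> carrier G" and h: "h \<in> Z'"
    then have hc: "h \<in> carrier G" "?\<pi> h \<in> C" unfolding Z'_def by blast+
    have "?\<pi> (x \<otimes>\<^bsub>G\<^esub> h \<otimes>\<^bsub>G\<^esub> inv\<^bsub>G\<^esub> x) = (?\<pi> x \<otimes>\<^bsub>G Mod Z\<^esub> ?\<pi> h) \<otimes>\<^bsub>G Mod Z\<^esub> ?\<pi> (inv\<^bsub>G\<^esub> x)"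
      using x hc(1) mult by (metis inv_closed m_closed)
    also have "\<dots> = ?\<pi> h \<otimes>\<^bsub>G Mod Z\<^esub> (?\<pi> x \<otimes>\<^bsub>G Mod Z\<^esub> ?\<pi> (inv\<^bsub>G\<^esub> x))"
      unfolding comm[OF x h] by (intro Q.m_assoc pi x hc inv_closed)
    also have "\<dots> = ?\<pi> h"
      unfolding mult[OF x inv_closed[OF x], symmetric] r_inv[OF x] pi_one by (intro Q.r_one pi hc)
    finally show "x \<otimes>\<^bsub>G\<^esub> h \<otimes>\<^bsub>G\<^esub> inv\<^bsub>G\<^esub> x \<in> Z'" using x hc by (simp add: Z'_def)
  qed
  moreover have "Z \<subset> Z'"
  proof -
    have "Z \<subseteq> Z'"
    proof
      fix x assume x: "x \<in> Z"
      then have xc: "x \<in> carrier G" using subset by blast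
      have "?\<pi> x = \<one>\<^bsub>G Mod Z\<^esub>" using pi1[OF xc] x by blast
      then have "?\<pi> x \<in> C" using subgroup.one_closed[OF C] by argo
      then show "x \<in> Z'" unfolding Z'_def using xc by blast
    qed
    moreover have "Z' \<noteq> Z"
    proof -
      have "p_group p (G Mod Z)"
      proof (rule p_group_FactGroup[OF p Z])
        fix x assume x: "x \<in> carrier G"
        obtain k where "x [^]\<^bsub>G\<^esub> (p ^ k) = \<one>\<^bsub>G\<^esub>" by (rule p_group_pow[OF G x])
        then have "x [^]\<^bsub>G\<^esub> (p ^ k) \<in> Z" using subgroup.one_closed[OF subgroup_axioms] by simp
        then show "\<exists>k. x [^]\<^bsub>G\<^esub> (p ^ k) \<in> Z" by (rule exI)
      qed
      moreover have "finite (carrier (G Mod Z))" using fin by (simp add: carrier_FactGroup)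
      moreover have "carrier (G Mod Z) \<noteq> {\<one>\<^bsub>G Mod Z\<^esub>}"
      proof -
        obtain x where x: "x \<in> carrier G" "x \<notin> Z" using ne subset by blast
        then show ?thesis using pi[OF x(1)] pi1[OF x(1)] by (metis singletonD)
      qed
      ultimately obtain A where A: "A \<in> carrier (G Mod Z)" "A \<noteq> \<one>\<^bsub>G Mod Z\<^esub>"
        "\<forall>B\<in>carrier (G Mod Z). B \<otimes>\<^bsub>G Mod Z\<^esub> A = A \<otimes>\<^bsub>G Mod Z\<^esub> B"
        using p_group_center_nontrivial[OF p] by blast
      obtain x where x: "x \<in> carrier G" "A = ?\<pi> x" using A(1) by (auto simp: carrier_FactGroup)
      have "A \<in> C" unfolding C_def using A by blast
      then have "x \<in> Z'" unfolding Z'_def using x by blast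
      moreover have "x \<notin> Z" using pi1[OF x(1)] x(2) A(2) by blast
      ultimately show ?thesis by blast
    qed
    ultimately show ?thesis by blast
  qed
  moreover have "g \<otimes>\<^bsub>G\<^esub> x \<otimes>\<^bsub>G\<^esub> inv\<^bsub>G\<^esub> g \<otimes>\<^bsub>G\<^esub> inv\<^bsub>G\<^esub> x \<in> Z" if g: "g \<in> carrier G" and x: "x \<in> Z'" for g x
  proof -
    have xc: "x \<in> carrier G" using x by (simp add: Z'_def)
    note cl = g xc inv_closed[OF g] inv_closed[OF xc]
    note pc = pi[OF g] pi[OF xc]
    have "?\<pi> (g \<otimes>\<^bsub>G\<^esub> x \<otimes>\<^bsub>G\<^esub> inv\<^bsub>G\<^esub> g \<otimes>\<^bsub>G\<^esub> inv\<^bsub>G\<^esub> x)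
      = ?\<pi> g \<otimes>\<^bsub>G Mod Z\<^esub> ?\<pi> x \<otimes>\<^bsub>G Mod Z\<^esub> inv\<^bsub>G Mod Z\<^esub> ?\<pi> g \<otimes>\<^bsub>G Mod Z\<^esub> inv\<^bsub>G Mod Z\<^esub> ?\<pi> x"
      using cl mult inv by (metis m_closed)
    also have "\<dots> = ?\<pi> x \<otimes>\<^bsub>G Mod Z\<^esub> (?\<pi> g \<otimes>\<^bsub>G Mod Z\<^esub> inv\<^bsub>G Mod Z\<^esub> ?\<pi> g) \<otimes>\<^bsub>G Mod Z\<^esub> inv\<^bsub>G Mod Z\<^esub> ?\<pi> x"
      unfolding comm[OF g x] using Q.m_assoc[OF pc(2,1) Q.inv_closed[OF pc(1)]] by argo
    also have "\<dots> = \<one>\<^bsub>G Mod Z\<^esub>"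
      using pc by (metis Q.r_inv Q.r_one)
    finally show ?thesis using pi1 cl by (metis m_closed)
  qed
  ultimately show ?thesis by blast
qed

lemma finite_p_group_nilpotent:
  assumes p: "Factorial_Ring.prime p" and G: "p_group p G" and fin: "finite (carrier G)"
  shows "nilpotent_group G"
proof -
  interpret group G using G by (simp add: p_group_def)
  have low: "lower_central G n \<subseteq> carrier G \<and> \<one>\<^bsub>G\<^esub> \<in> lower_central G n" for n
  proof (induction n)
    case (Suc n)
    then have "{g \<otimes>\<^bsub>G\<^esub> h \<otimes>\<^bsub>G\<^esub> inv\<^bsub>G\<^esub> g \<otimes>\<^bsub>G\<^esub> inv\<^bsub>G\<^esub> h | g h. g \<in> carrier G \<and> h \<in> lower_central G n} \<subseteq> carrier G"
      by auto
    then show ?case using generate_incl generate.one by simp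
  qed simp
  \<comment> \<open>A central series is climbed from the bottom. The premise on \<open>Z\<close>
    says that it is enough for the lower central series to reach \<open>Z\<close>; it is inherited
    by \<open>Z'\<close>, because commutators with \<open>Z'\<close> lie in \<open>Z\<close>. At the
    top the zeroth term does.\<close>
  have climb: "\<exists>n. lower_central G n \<subseteq> {\<one>\<^bsub>G\<^esub>}"
    if "Z \<lhd> G" "\<And>m. lower_central G m \<subseteq> Z \<Longrightarrow> \<exists>n. lower_central G n \<subseteq> {\<one>\<^bsub>G\<^esub>}" for Z
    using that
  proof (induction "card (carrier G - Z)" arbitrary: Z rule: less_induct)
    case less
    show ?case
    proof (cases "Z = carrier G")
      case True
      then show ?thesis using less.prems(2)[of 0] by simp
    next
      case False
      obtain Z' where Z': "Z' \<lhd> G" "Z \<subset> Z'"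
        and com: "\<And>g x. \<lbrakk>g \<in> carrier G; x \<in> Z'\<rbrakk> \<Longrightarrow>
          g \<otimes>\<^bsub>G\<^esub> x \<otimes>\<^bsub>G\<^esub> inv\<^bsub>G\<^esub> g \<otimes>\<^bsub>G\<^esub> inv\<^bsub>G\<^esub> x \<in> Z"
        using p_group_central_step[OF p G fin less.prems(1) False] by blast
      have "Z' \<subseteq> carrier G" using Z'(1) by (simp add: normal_imp_subgroup subgroup.subset)
      then have "card (carrier G - Z') < card (carrier G - Z)"
        using Z'(2) fin by (intro psubset_card_mono) auto
      moreover have "\<exists>n. lower_central G n \<subseteq> {\<one>\<^bsub>G\<^esub>}" if "lower_central G m \<subseteq> Z'" for m
      proof (rule less.prems(2))
        show "lower_central G (Suc m) \<subseteq> Z"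
          unfolding lower_central.simps
          using that com by (intro generate_subgroup_incl normal_imp_subgroup less.prems(1)) blast
      qed
      ultimately show ?thesis using less.hyps Z'(1) by blast
    qed
  qed
  have "\<exists>n. lower_central G n \<subseteq> {\<one>\<^bsub>G\<^esub>}" using climb[OF one_is_normal] by blast
  then show ?thesis unfolding nilpotent_group_def using low by blast
qed

section \<open>Groups of words\<close>

datatype letter = La | Lt | Li

instance letter :: countable by countable_datatype

fun linv :: "letter \<Rightarrow> letter" where
  "linv La = La" | "linv Lt = Li" | "linv Li = Lt"

definition winv :: "letter list \<Rightarrow> letter list" where
  "winv w = rev (map linv w)"

lemma linv_linv [simp]: "linv (linv l) = l" by (cases l) auto
lemma winv_winv [simp]: "winv (winv w) = w" by (simp add: winv_def rev_map o_def)
lemma winv_append [simp]: "winv (u @ v) = winv v @ winv u" by (simp add: winv_def)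
lemma winv_Nil [simp]: "winv [] = []" by (simp add: winv_def)
lemma winv_Cons: "winv (l # w) = winv w @ [linv l]" by (simp add: winv_def)
lemma winv_sing [simp]: "winv [l] = [linv l]" by (simp add: winv_def)
lemma length_winv [simp]: "length (winv w) = length w" by (simp add: winv_def)

definition wpow :: "letter list \<Rightarrow> nat \<Rightarrow> letter list" where
  "wpow w n = concat (replicate n w)"

lemma wpow_0 [simp]: "wpow w 0 = []" by (simp add: wpow_def)
lemma wpow_Suc [simp]: "wpow w (Suc n) = w @ wpow w n" by (simp add: wpow_def)
lemma wpow_add: "wpow w (m + n) = wpow w m @ wpow w n" by (simp add: wpow_def replicate_add)
lemma wpow_mult: "wpow w (m * n) = wpow (wpow w m) n"
  by (induction n) (simp_all add: wpow_add)

text \<open>The letters stand for \<open>a, t, t\<inverse>\<close>, and \<open>K\<close> for the words that are trivial in a quotient of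
  \<open>\<langle>a, t | a\<^sup>2\<rangle>\<close>; the relation \<open>a\<^sup>2 = 1\<close> is \<open>cancel_in\<close> for \<open>l = La\<close>.\<close>

locale trivial_words =
  fixes K :: "letter list set"
  assumes Nil_in: "[] \<in> K"
    and insert_iff: "w \<in> K \<Longrightarrow> u @ w @ v \<in> K \<longleftrightarrow> u @ v \<in> K"
    and cancel_in: "[l, linv l] \<in> K"

text \<open>The syntactic congruence of \<open>K\<close>. In this form it is a congruence for every
  set \<open>K\<close>; inside \<open>trivial_words\<close> it becomes
  \<open>winv u @ v \<in> K\<close> (\<open>weq_iff\<close>).\<close>

definition weq :: "letter list set \<Rightarrow> letter list \<Rightarrow> letter list \<Rightarrow> bool" where
  "weq K u v \<longleftrightarrow> (\<forall>x y. x @ u @ y \<in> K \<longleftrightarrow> x @ v @ y \<in> K)"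

lemma weq_refl [simp]: "weq K u u" by (simp add: weq_def)
lemma weq_sym: "weq K u v \<Longrightarrow> weq K v u" by (simp add: weq_def)
lemma weq_trans [trans]: "weq K u v \<Longrightarrow> weq K v w \<Longrightarrow> weq K u w" by (simp add: weq_def)
lemma weq_append: "weq K u u' \<Longrightarrow> weq K v v' \<Longrightarrow> weq K (u @ v) (u' @ v')"
  unfolding weq_def by (metis append.assoc)
lemma weq_in: "weq K u v \<Longrightarrow> u \<in> K \<longleftrightarrow> v \<in> K"
  unfolding weq_def by (metis append_Nil append_Nil2)

context trivial_words
begin

lemma weq_Nil_iff: "weq K w [] \<longleftrightarrow> w \<in> K"
  using weq_in[of K w "[]"] Nil_in insert_iff by (auto simp: weq_def)

lemma winv_right: "weq K (w @ winv w) []"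
proof (induction w)
  case (Cons l w)
  have "weq K ([l] @ (w @ winv w) @ [linv l]) ([l] @ [] @ [linv l])"
    by (intro weq_append weq_refl Cons)
  also have "weq K ([l] @ [] @ [linv l]) []" using cancel_in by (simp add: weq_Nil_iff)
  finally show ?case by (simp add: winv_Cons)
qed simp

lemma winv_left: "weq K (winv w @ w) []"
  using winv_right[of "winv w"] by simp

lemma weq_cancel: "weq K (x @ winv w @ w @ y) (x @ y)" "weq K (x @ w @ winv w @ y) (x @ y)"
  using weq_append[OF weq_refl weq_append[OF winv_left weq_refl], of x w y]
    weq_append[OF weq_refl weq_append[OF winv_right weq_refl], of x w y] by simp_all

lemma weq_iff: "weq K u v \<longleftrightarrow> winv u @ v \<in> K"
proof
  assume "weq K u v"
  then have "weq K (winv u @ v) (winv u @ u)" by (intro weq_append weq_refl) (rule weq_sym)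
  also have "weq K (winv u @ u) []" by (rule winv_left)
  finally show "winv u @ v \<in> K" by (simp add: weq_Nil_iff)
next
  assume "winv u @ v \<in> K"
  then have "weq K (u @ winv u @ v) (u @ [])" by (intro weq_append weq_refl) (simp add: weq_Nil_iff)
  then have "weq K u (u @ winv u @ v)" by (simp add: weq_sym)
  also have "weq K (u @ winv u @ v) v" using weq_cancel(2)[of "[]" u v] by simp
  finally show "weq K u v" .
qed

lemma weq_winv: "weq K u v \<Longrightarrow> weq K (winv u) (winv v)"
proof -
  assume uv: "weq K u v"
  have "weq K (winv u) (winv u @ v @ winv v)" using weq_cancel(2)[of "winv u" v "[]"] by (simp add: weq_sym)
  also have "weq K (winv u @ v @ winv v) (winv u @ u @ winv v)" by (intro weq_append weq_refl weq_sym[OF uv])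
  also have "weq K (winv u @ u @ winv v) (winv v)" using weq_cancel(1)[of "[]" u "winv v"] by simp
  finally show ?thesis .
qed

lemma weq_solve_left: "weq K (u @ v) w \<longleftrightarrow> weq K v (winv u @ w)"
  unfolding weq_iff by simp

lemma weq_solve_right: "weq K (u @ v) w \<longleftrightarrow> weq K u (w @ winv v)"
proof
  assume "weq K (u @ v) w"
  then have "weq K ((u @ v) @ winv v) (w @ winv v)" by (intro weq_append weq_refl)
  with weq_cancel(2)[of u v "[]", THEN weq_sym] show "weq K u (w @ winv v)"
    by simp (rule weq_trans)
next
  assume "weq K u (w @ winv v)"
  then have "weq K (u @ v) ((w @ winv v) @ v)" by (intro weq_append weq_refl)
  from weq_trans[OF this] show "weq K (u @ v) w" using weq_cancel(1)[of w v "[]"] by simp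
qed


lemma append_in: "u \<in> K \<Longrightarrow> v \<in> K \<Longrightarrow> u @ v \<in> K"
  using insert_iff[of v u "[]"] by simp



lemma wpow_in: "w \<in> K \<Longrightarrow> wpow w n \<in> K"
  by (induction n) (auto simp: Nil_in append_in)

end

section \<open>The group of words modulo trivial words\<close>

text \<open>The least code of an equivalent word represents its class. Elements are thus natural
  numbers in the group and in its quotients alike, as the rules of
  \<open>elementary_amenable\<close> require a single type.\<close>

definition wcode :: "letter list set \<Rightarrow> letter list \<Rightarrow> nat" where
  "wcode K w = (LEAST n. weq K (from_nat n) w)"

definition wgroup :: "letter list set \<Rightarrow> nat monoid" where
  "wgroup K = \<lparr>carrier = range (wcode K),
     monoid.mult = (\<lambda>m n. wcode K (from_nat m @ from_nat n)), one = wcode K []\<rparr>"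

lemma weq_wcode: "weq K (from_nat (wcode K w)) w"
proof -
  have "weq K (from_nat (to_nat w)) w" by simp
  then show ?thesis unfolding wcode_def by (rule LeastI)
qed

lemma wcode_eq_iff: "wcode K u = wcode K v \<longleftrightarrow> weq K u v"
proof
  assume "wcode K u = wcode K v"
  then show "weq K u v" using weq_wcode[of K u] weq_wcode[of K v] by (metis weq_sym weq_trans)
next
  assume "weq K u v"
  then have "weq K (from_nat n) u \<longleftrightarrow> weq K (from_nat n) v" for n using weq_sym weq_trans by blast
  then show "wcode K u = wcode K v" by (simp add: wcode_def)
qed

lemma carrier_wgroup: "carrier (wgroup K) = range (wcode K)"
  and one_wgroup [simp]: "\<one>\<^bsub>wgroup K\<^esub> = wcode K []"
  by (simp_all add: wgroup_def)

lemma wcode_carrier [simp]: "wcode K w \<in> carrier (wgroup K)"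
  by (simp add: carrier_wgroup)

lemma wgroup_cases:
  assumes "x \<in> carrier (wgroup K)" obtains w where "x = wcode K w"
  using assms by (auto simp: carrier_wgroup)

lemma mult_wgroup [simp]: "wcode K u \<otimes>\<^bsub>wgroup K\<^esub> wcode K v = wcode K (u @ v)"
  by (simp add: wgroup_def wcode_eq_iff weq_append weq_wcode)

context trivial_words
begin

lemma group_wgroup: "group (wgroup K)"
proof (rule groupI)
  fix x assume "x \<in> carrier (wgroup K)"
  then obtain w where w: "x = wcode K w" by (rule wgroup_cases)
  have "wcode K (winv w) \<otimes>\<^bsub>wgroup K\<^esub> x = \<one>\<^bsub>wgroup K\<^esub>"
    by (simp add: w wcode_eq_iff winv_left)
  then show "\<exists>y\<in>carrier (wgroup K). y \<otimes>\<^bsub>wgroup K\<^esub> x = \<one>\<^bsub>wgroup K\<^esub>" by auto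
qed (auto elim!: wgroup_cases)

sublocale wg: group "wgroup K" by (rule group_wgroup)

lemma inv_wgroup [simp]: "inv\<^bsub>wgroup K\<^esub> (wcode K w) = wcode K (winv w)"
  by (rule wg.inv_equality) (auto simp: wcode_eq_iff winv_left)

lemma pow_wgroup [simp]: "wcode K w [^]\<^bsub>wgroup K\<^esub> (n::nat) = wcode K (wpow w n)"
proof (induction n)
  case (Suc n)
  have "wpow w n @ w = w @ wpow w n" using wpow_add[of w n 1] wpow_add[of w 1 n] by simp
  then show ?case using Suc by simp
qed simp

lemma subgroup_words:
  assumes "[] \<in> W" "\<And>u v. u \<in> W \<Longrightarrow> v \<in> W \<Longrightarrow> u @ v \<in> W" "\<And>u. u \<in> W \<Longrightarrow> winv u \<in> W"
  shows "subgroup (wcode K ` W) (wgroup K)"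
proof
  show "wcode K ` W \<subseteq> carrier (wgroup K)" by auto
  show "x \<otimes>\<^bsub>wgroup K\<^esub> y \<in> wcode K ` W" if "x \<in> wcode K ` W" "y \<in> wcode K ` W" for x y
    using that assms(2) by auto
  show "\<one>\<^bsub>wgroup K\<^esub> \<in> wcode K ` W" using assms(1) by simp
  show "inv\<^bsub>wgroup K\<^esub> x \<in> wcode K ` W" if "x \<in> wcode K ` W" for x
    using that assms(3) by auto
qed

lemma generate_wgroup: "generate (wgroup K) {wcode K [La], wcode K [Lt]} = carrier (wgroup K)"
proof
  let ?S = "{wcode K [La], wcode K [Lt]}"
  show "generate (wgroup K) ?S \<subseteq> carrier (wgroup K)" by (rule wg.generate_incl) auto
  have l: "wcode K [l] \<in> generate (wgroup K) ?S" for l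
    using generate.inv[of "wcode K [Lt]" ?S "wgroup K"]
    by (cases l) (auto intro: generate.incl)
  have "wcode K w \<in> generate (wgroup K) ?S" for w
  proof (induction w)
    case Nil
    then show ?case using generate.one[of "wgroup K" ?S] by simp
  next
    case (Cons x w)
    then show ?case using generate.eng[OF l Cons, of x] by simp
  qed
  then show "carrier (wgroup K) \<subseteq> generate (wgroup K) ?S" by (auto simp: carrier_wgroup)
qed

end

lemma weq_mono:
  assumes "trivial_words K" "trivial_words L" "K \<subseteq> L" "weq K u v"
  shows "weq L u v"
  using assms trivial_words.weq_iff by blast

text \<open>Declaring more words trivial is passing to a quotient. This replaces groups of cosets by
  groups on natural numbers.\<close>

lemma wgroup_quotient:
  assumes K: "trivial_words K" and L: "trivial_words L" and KL: "K \<subseteq> L"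
  shows "wcode K ` L \<lhd> wgroup K" "wgroup K Mod (wcode K ` L) \<cong> wgroup L"
proof -
  interpret K: trivial_words K by (rule K)
  interpret L: trivial_words L by (rule L)
  define h where "h n = wcode L (from_nat n)" for n
  have h: "h (wcode K w) = wcode L w" for w
    unfolding h_def wcode_eq_iff using weq_mono[OF K L KL weq_wcode] .
  interpret h: group_hom "wgroup K" "wgroup L" h
    by unfold_locales (auto simp: hom_def h elim!: wgroup_cases)
  have ker: "kernel (wgroup K) (wgroup L) h = wcode K ` L"
  proof (intro equalityI subsetI)
    fix x assume "x \<in> kernel (wgroup K) (wgroup L) h"
    then obtain w where "x = wcode K w" "h x = \<one>\<^bsub>wgroup L\<^esub>" by (auto simp: kernel_def elim: wgroup_cases)
    then show "x \<in> wcode K ` L" by (auto simp: h wcode_eq_iff L.weq_Nil_iff)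
  next
    fix x assume "x \<in> wcode K ` L"
    then show "x \<in> kernel (wgroup K) (wgroup L) h" by (auto simp: kernel_def h wcode_eq_iff L.weq_Nil_iff)
  qed
  have "h ` carrier (wgroup K) = carrier (wgroup L)" by (auto simp: carrier_wgroup h image_image)
  then show "wgroup K Mod (wcode K ` L) \<cong> wgroup L" using h.FactGroup_iso ker by simp
  show "wcode K ` L \<lhd> wgroup K" using h.normal_kernel ker by simp
qed

section \<open>Unitriangular involutions\<close>

text \<open>\<open>stp \<sigma> e\<close> is the matrix \<open>1 + (\<Sum>j | \<sigma>!j = e. E\<^bsub>j, j+1\<^esub>)\<close> over the field of two elements, acting on
  row vectors that are represented by their supports. If consecutive entries of \<open>\<sigma>\<close> differ,
  these matrices are involutions, so \<open>act \<sigma>\<close> is a representation of the free product of groups of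
  order two indexed by the letters \<open>e\<close>.\<close>

definition stp :: "'e list \<Rightarrow> 'e \<Rightarrow> nat set \<Rightarrow> nat set" where
  "stp \<sigma> e v = {i. (i \<in> v) \<noteq> (\<exists>j. i = Suc j \<and> j \<in> v \<and> j < length \<sigma> \<and> \<sigma> ! j = e)}"

definition act :: "'e list \<Rightarrow> 'e list \<Rightarrow> nat set \<Rightarrow> nat set" where
  "act \<sigma> es = fold (stp \<sigma>) es"

lemma act_Nil [simp]: "act \<sigma> [] v = v"
  and act_Cons [simp]: "act \<sigma> (e # es) v = act \<sigma> es (stp \<sigma> e v)"
  and act_append [simp]: "act \<sigma> (es @ fs) v = act \<sigma> fs (act \<sigma> es v)"
  by (simp_all add: act_def)

lemma zero_in_stp: "0 \<in> stp \<sigma> e v \<longleftrightarrow> 0 \<in> v"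
  and Suc_in_stp: "Suc j \<in> stp \<sigma> e v \<longleftrightarrow> (Suc j \<in> v) \<noteq> (j \<in> v \<and> j < length \<sigma> \<and> \<sigma> ! j = e)"
  by (auto simp: stp_def)

text \<open>In characteristic two the square of 1 + E is 1 + E^2, and E^2 = 0 because no two
  consecutive entries of \<open>\<sigma>\<close> equal \<open>e\<close>.\<close>

lemma stp_stp:
  assumes "distinct_adj \<sigma>"
  shows "stp \<sigma> e (stp \<sigma> e v) = v"
proof (rule Set.set_eqI)
  fix i
  show "i \<in> stp \<sigma> e (stp \<sigma> e v) \<longleftrightarrow> i \<in> v"
  proof (cases i)
    case (Suc j)
    have "j \<in> stp \<sigma> e v \<longleftrightarrow> j \<in> v" if "j < length \<sigma>" "\<sigma> ! j = e"
    proof (cases j)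
      case (Suc k)
      then have "\<sigma> ! k \<noteq> e" using assms that by (auto simp: distinct_adj_conv_nth)
      then show ?thesis by (simp add: Suc Suc_in_stp)
    qed (simp add: zero_in_stp)
    then show ?thesis unfolding Suc Suc_in_stp by blast
  qed (simp add: zero_in_stp)
qed

lemma act_bounded: "v \<subseteq> {..c} \<Longrightarrow> length \<sigma> \<le> c \<Longrightarrow> act \<sigma> es v \<subseteq> {..c}"
proof (induction es arbitrary: v)
  case (Cons e es)
  have "stp \<sigma> e v \<subseteq> {..c}"
  proof
    fix i assume "i \<in> stp \<sigma> e v"
    then show "i \<in> {..c}" using Cons.prems by (cases i) (auto simp: Suc_in_stp)
  qed
  then show ?case using Cons by simp
qed simp

text \<open>Each matrix moves the support at most one place to the right. Place \<open>k\<close> is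
  reached from 0 in at most \<open>k\<close> steps only if every step moves, that is, if the letters
  read are the first \<open>k\<close> entries of \<open>\<sigma>\<close>.\<close>

lemma act_detect:
  "length es \<le> k \<Longrightarrow> k \<in> act \<sigma> es {0} \<longleftrightarrow> k = length es \<and> k \<le> length \<sigma> \<and> es = take k \<sigma>"
proof (induction es arbitrary: k rule: rev_induct)
  case Nil
  then show ?case by auto
next
  case (snoc e es)
  then obtain j where k: "k = Suc j" "length es \<le> j" by (cases k) auto
  have "k \<notin> act \<sigma> es {0}" using snoc.IH[of k] k by simp
  then have "k \<in> act \<sigma> (es @ [e]) {0} \<longleftrightarrow> j \<in> act \<sigma> es {0} \<and> j < length \<sigma> \<and> \<sigma> ! j = e"
    by (auto simp: k Suc_in_stp)
  also have "\<dots> \<longleftrightarrow> k = length (es @ [e]) \<and> k \<le> length \<sigma> \<and> es @ [e] = take k \<sigma>"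
    using snoc.IH[of j] k by (auto simp: take_Suc_conv_app_nth)
  finally show ?case .
qed

text \<open>The change of coordinate \<open>i\<close> depends only on the coordinates below
  \<open>i\<close>. Phrased in this way, unitriangularity makes no mention of linearity or matrix
  entries.\<close>

definition unitriangular :: "(nat set \<Rightarrow> nat set) \<Rightarrow> bool" where
  "unitriangular g \<longleftrightarrow> (\<forall>i v v'. (\<forall>j<i. j \<in> v \<longleftrightarrow> j \<in> v') \<longrightarrow>
     ((i \<in> g v \<longleftrightarrow> i \<in> v) \<longleftrightarrow> (i \<in> g v' \<longleftrightarrow> i \<in> v')))"

lemma unitriangular_comp:
  assumes g: "unitriangular g" and h: "unitriangular h"
  shows "unitriangular (g \<circ> h)"
  unfolding unitriangular_def
proof (intro allI impI)
  fix i :: nat and v v' :: "nat set" assume a: "\<forall>j<i. j \<in> v \<longleftrightarrow> j \<in> v'"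
  have hk: "(k \<in> h v \<longleftrightarrow> k \<in> v) \<longleftrightarrow> (k \<in> h v' \<longleftrightarrow> k \<in> v')" if "k \<le> i" for k
    using h[unfolded unitriangular_def, rule_format, of k v v'] a that by simp
  have "j \<in> h v \<longleftrightarrow> j \<in> h v'" if "j < i" for j
    using hk[of j] a that by auto
  then have "(i \<in> g (h v) \<longleftrightarrow> i \<in> h v) \<longleftrightarrow> (i \<in> g (h v') \<longleftrightarrow> i \<in> h v')"
    using g[unfolded unitriangular_def, rule_format, of i "h v" "h v'"] by simp
  then show "(i \<in> (g \<circ> h) v \<longleftrightarrow> i \<in> v) \<longleftrightarrow> (i \<in> (g \<circ> h) v' \<longleftrightarrow> i \<in> v')"
    using hk[of i] by auto
qed

lemma unitriangular_act: "unitriangular (act \<sigma> es)"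
proof (induction es rule: rev_induct)
  case Nil
  then show ?case by (simp add: unitriangular_def)
next
  case (snoc e es)
  have "(i \<in> stp \<sigma> e v \<longleftrightarrow> i \<in> v) \<longleftrightarrow> (i \<in> stp \<sigma> e v' \<longleftrightarrow> i \<in> v')"
    if "\<forall>j<i. j \<in> v \<longleftrightarrow> j \<in> v'" for i v v'
    using that by (cases i) (auto simp: zero_in_stp Suc_in_stp)
  then have "unitriangular (stp \<sigma> e)" unfolding unitriangular_def by blast
  moreover have "act \<sigma> (es @ [e]) = stp \<sigma> e \<circ> act \<sigma> es" by (simp add: fun_eq_iff)
  ultimately show ?case using unitriangular_comp[OF _ snoc] by metis
qed

lemma unitriangular_funpow: "unitriangular g \<Longrightarrow> unitriangular (g ^^ n)"
proof (induction n)
  case 0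
  then show ?case by (simp add: unitriangular_def)
next
  case (Suc n)
  then show ?case using unitriangular_comp[of g "g ^^ n"] by (simp only: funpow.simps)
qed

text \<open>By induction \<open>g ^^ (2 ^ m)\<close> fixes the coordinates below \<open>m\<close>,
  so it changes coordinate \<open>m\<close> by the same amount when applied a second time. Two equal
  changes cancel modulo 2.\<close>

lemma unitriangular_pow2:
  assumes "unitriangular g" "i < m"
  shows "i \<in> (g ^^ (2 ^ m)) v \<longleftrightarrow> i \<in> v"
  using assms(2)
proof (induction m arbitrary: i v)
  case (Suc m)
  let ?h = "g ^^ (2 ^ m)"
  have hh: "(g ^^ (2 ^ Suc m)) v = ?h (?h v)" by (simp add: funpow_add mult_2)
  show ?case
  proof (cases "i < m")
    case True
    then show ?thesis unfolding hh using Suc.IH by simp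
  next
    case False
    then have "\<forall>j<i. j \<in> ?h v \<longleftrightarrow> j \<in> v" using Suc by simp
    then show ?thesis unfolding hh
      using unitriangular_funpow[OF assms(1), of "2 ^ m", unfolded unitriangular_def, rule_format, of i "?h v" v]
      by blast
  qed
qed simp

text \<open>The last letter of a reduced word is kept at the head of the list.\<close>

fun psh :: "'e list \<Rightarrow> 'e \<Rightarrow> 'e list" where
  "psh [] e = [e]"
| "psh (x # s) e = (if x = e then s else e # x # s)"

definition red :: "'e list \<Rightarrow> 'e list" where
  "red es = foldl psh [] es"

lemma red_snoc: "red (es @ [e]) = psh (red es) e" and red_Nil [simp]: "red [] = []"
  by (simp_all add: red_def)

lemma distinct_adj_red: "distinct_adj (red es)"
proof (induction es rule: rev_induct)
  case (snoc e es)
  then show ?case unfolding red_snoc by (cases "red es") (auto dest: distinct_adj_ConsD)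
qed simp

lemma length_red: "length (red es) \<le> length es"
proof (induction es rule: rev_induct)
  case (snoc e es)
  then show ?case unfolding red_snoc by (cases "red es") auto
qed simp

lemma set_red: "set (red es) \<subseteq> set es"
proof (induction es rule: rev_induct)
  case (snoc e es)
  then show ?case unfolding red_snoc by (cases "red es") auto
qed simp

lemma act_red:
  assumes "distinct_adj \<sigma>"
  shows "act \<sigma> (rev (red es)) v = act \<sigma> es v"
proof (induction es rule: rev_induct)
  case (snoc e es)
  show ?case
  proof (cases "red es")
    case Nil
    then show ?thesis using snoc by (simp add: red_snoc)
  next
    case (Cons x s)
    have "act \<sigma> es v = stp \<sigma> x (act \<sigma> (rev s) v)" using snoc Cons by simp
    then show ?thesis using Cons by (simp add: red_snoc stp_stp[OF assms])
  qed
qed simp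

text \<open>The longer of the two reduced words, taken as \<open>\<sigma>\<close>, recognizes itself
  by \<open>act_detect\<close>. Its length is at most \<open>c\<close>, so paths of length at most
  \<open>c\<close> suffice to separate such words.\<close>

lemma red_eq_if_act_eq:
  assumes act: "\<And>\<sigma>. \<lbrakk>distinct_adj \<sigma>; length \<sigma> \<le> c; set \<sigma> \<subseteq> A\<rbrakk> \<Longrightarrow> act \<sigma> es {0} = act \<sigma> fs {0}"
    and es: "length es \<le> c" "set es \<subseteq> A" and fs: "length fs \<le> c" "set fs \<subseteq> A"
  shows "red es = red fs"
proof -
  have *: "red es = red fs"
    if len: "length (red fs) \<le> length (red es)" and es: "length es \<le> c" "set es \<subseteq> A"
      and act: "\<And>\<sigma>. \<lbrakk>distinct_adj \<sigma>; length \<sigma> \<le> c; set \<sigma> \<subseteq> A\<rbrakk> \<Longrightarrow> act \<sigma> es {0} = act \<sigma> fs {0}"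
    for es fs
  proof -
    let ?\<sigma> = "rev (red es)"
    have d: "distinct_adj ?\<sigma>" by (simp add: distinct_adj_red)
    have "act ?\<sigma> es {0} = act ?\<sigma> fs {0}"
      using d length_red[of es] set_red[of es] es by (intro act) auto
    then have "act ?\<sigma> (rev (red es)) {0} = act ?\<sigma> (rev (red fs)) {0}"
      by (simp only: act_red[OF d])
    moreover have "length ?\<sigma> \<in> act ?\<sigma> (rev (red es)) {0}"
      by (subst act_detect) auto
    ultimately have "length ?\<sigma> \<in> act ?\<sigma> (rev (red fs)) {0}" by simp
    moreover have "length (rev (red fs)) \<le> length ?\<sigma>" using len by simp
    ultimately have "rev (red fs) = take (length ?\<sigma>) ?\<sigma>"
      using act_detect by blast
    also have "\<dots> = ?\<sigma>" by (rule take_all) (rule order_refl)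
    finally show ?thesis by simp
  qed
  show ?thesis
  proof (cases "length (red fs) \<le> length (red es)")
    case True
    then show ?thesis by (rule *[OF _ es act])
  next
    case False
    then have "length (red es) \<le> length (red fs)" by simp
    then show ?thesis by (rule *[OF _ fs act[symmetric], symmetric])
  qed
qed

section \<open>The words \<open>t\<^sup>i a t\<inverse>\<^sup>i\<close>\<close>

fun lexpo :: "letter \<Rightarrow> int" where
  "lexpo La = 0" | "lexpo Lt = 1" | "lexpo Li = - 1"

definition expo :: "letter list \<Rightarrow> int" where
  "expo w = sum_list (map lexpo w)"

lemma expo_Nil [simp]: "expo [] = 0"
  and expo_Cons [simp]: "expo (l # w) = lexpo l + expo w"
  and expo_append [simp]: "expo (u @ v) = expo u + expo v"
  by (simp_all add: expo_def)

lemma lexpo_linv [simp]: "lexpo (linv l) = - lexpo l" by (cases l) auto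

lemma expo_winv [simp]: "expo (winv w) = - expo w"
  by (induction w) (auto simp: winv_Cons)

lemma expo_wpow: "expo (wpow w n) = int n * expo w"
  by (induction n) (auto simp: algebra_simps)

definition aw :: "nat \<Rightarrow> letter list" where
  "aw i = replicate i Lt @ [La] @ replicate i Li"

lemma aw_0: "aw 0 = [La]" and aw_Suc: "aw (Suc i) = [Lt] @ aw i @ [Li]"
  by (simp_all add: aw_def replicate_append_same)

lemma expo_aw [simp]: "expo (aw i) = 0"
  by (induction i) (auto simp: aw_0 aw_Suc)

lemma count_La_aw: "count_list (aw i) La = 1"
  by (induction i) (auto simp: aw_0 aw_Suc)

lemma winv_aw [simp]: "winv (aw i) = aw i"
proof (induction i)
  case (Suc i)
  have "winv (aw (Suc i)) = [Lt] @ winv (aw i) @ [Li]" by (simp add: aw_Suc winv_Cons)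
  then show ?case using Suc by (simp add: aw_Suc)
qed (simp add: aw_0 winv_def)

text \<open>Modulo \<open>K\<close> these words form the subgroup generated by the
  \<open>aw i\<close>: they are closed under \<open>winv\<close>, because each \<open>aw i\<close>
  is its own formal inverse.\<close>

definition aprods :: "nat set \<Rightarrow> letter list set" where
  "aprods I = {concat (map aw is) | is. set is \<subseteq> I}"

lemma aprods_Nil [simp]: "[] \<in> aprods I"
  unfolding aprods_def by (auto intro: exI[of _ "[]"])

lemma aprods_append: "u \<in> aprods I \<Longrightarrow> v \<in> aprods I \<Longrightarrow> u @ v \<in> aprods I"
proof -
  assume "u \<in> aprods I" "v \<in> aprods I"
  then obtain xs ys where "u = concat (map aw xs)" "v = concat (map aw ys)" "set (xs @ ys) \<subseteq> I"
    unfolding aprods_def by auto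
  then have "u @ v = concat (map aw (xs @ ys))" "set (xs @ ys) \<subseteq> I" by auto
  then show ?thesis unfolding aprods_def by blast
qed

lemma aw_aprods: "i \<in> I \<Longrightarrow> aw i \<in> aprods I"
  unfolding aprods_def by (auto intro: exI[of _ "[i]"])

lemma aprods_mono: "I \<subseteq> J \<Longrightarrow> aprods I \<subseteq> aprods J"
  unfolding aprods_def by blast

lemma aprods_induct [consumes 1, case_names Nil append]:
  assumes "q \<in> aprods I" "P []"
    "\<And>i q. \<lbrakk>i \<in> I; q \<in> aprods I; P q\<rbrakk> \<Longrightarrow> P (aw i @ q)"
  shows "P q"
proof -
  obtain xs where q: "q = concat (map aw xs)" "set xs \<subseteq> I" using assms(1) by (auto simp: aprods_def)
  have "set xs \<subseteq> I \<Longrightarrow> P (concat (map aw xs))"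
  proof (induction xs)
    case (Cons i xs)
    then have "concat (map aw xs) \<in> aprods I" by (auto simp: aprods_def)
    then show ?case using Cons assms(3) by auto
  qed (simp add: assms(2))
  then show ?thesis using q by simp
qed

lemma aprods_winv: "q \<in> aprods I \<Longrightarrow> winv q \<in> aprods I"
  by (induction rule: aprods_induct) (auto intro: aprods_append aw_aprods)

lemma expo_aprods: "q \<in> aprods I \<Longrightarrow> expo q = 0"
  by (induction rule: aprods_induct) auto

lemma aprods_wpow: "q \<in> aprods I \<Longrightarrow> wpow q n \<in> aprods I"
  by (induction n) (auto intro: aprods_append)

context trivial_words
begin

lemma aprods_shift_up: "q \<in> aprods I \<Longrightarrow> \<exists>q'\<in>aprods (Suc ` I). weq K ([Lt] @ q @ [Li]) q'"
proof (induction rule: aprods_induct)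
  case Nil
  show ?case using cancel_in[of Lt] by (intro bexI[of _ "[]"]) (auto simp: weq_Nil_iff)
next
  case (append i q)
  then obtain q' where q': "q' \<in> aprods (Suc ` I)" "weq K ([Lt] @ q @ [Li]) q'" by blast
  have "weq K (([Lt] @ aw i) @ (winv [Lt] @ [Lt]) @ (q @ [Li])) (([Lt] @ aw i) @ [] @ (q @ [Li]))"
    by (intro weq_append weq_refl winv_left)
  then have "weq K ([Lt] @ (aw i @ q) @ [Li]) (aw (Suc i) @ ([Lt] @ q @ [Li]))"
    by (simp add: aw_Suc weq_sym)
  also have "weq K (aw (Suc i) @ ([Lt] @ q @ [Li])) (aw (Suc i) @ q')"
    by (intro weq_append weq_refl q')
  finally show ?case using append(1) q'(1) by (blast intro: aprods_append aw_aprods)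
qed

lemma aprods_shift_down: "q \<in> aprods (Suc ` I) \<Longrightarrow> \<exists>q'\<in>aprods I. weq K ([Li] @ q @ [Lt]) q'"
proof (induction rule: aprods_induct)
  case Nil
  show ?case using cancel_in[of Li] by (intro bexI[of _ "[]"]) (auto simp: weq_Nil_iff)
next
  case (append j q)
  then obtain q' where q': "q' \<in> aprods I" "weq K ([Li] @ q @ [Lt]) q'" by blast
  obtain i where i: "i \<in> I" "j = Suc i" using append(1) by blast
  have "weq K ((winv [Lt] @ [Lt]) @ (aw i @ [Li] @ q @ [Lt])) ([] @ (aw i @ [Li] @ q @ [Lt]))"
    by (intro weq_append weq_refl winv_left)
  then have "weq K ([Li] @ (aw j @ q) @ [Lt]) (aw i @ ([Li] @ q @ [Lt]))"
    by (simp add: aw_Suc i)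
  also have "weq K (aw i @ ([Li] @ q @ [Lt])) (aw i @ q')"
    by (intro weq_append weq_refl q')
  finally show ?case using i(1) q'(1) by (blast intro: aprods_append aw_aprods)
qed

end

section \<open>One step of the tower\<close>

text \<open>\<open>edge K n u\<close> is the coset of \<open>u\<close> modulo the subgroup generated by the
  \<open>t\<^sup>i a t\<inverse>\<^sup>i\<close> with \<open>1 \<le> i \<le> n\<close>. It labels the \<open>t\<close>-edge of the Cayley graph that starts at \<open>u\<close>;
  \<open>crs K n u w\<close> lists the labels of the edges crossed by the path \<open>w\<close> from \<open>u\<close>.\<close>

definition edge_stab :: "letter list set \<Rightarrow> nat \<Rightarrow> letter list set" where
  "edge_stab K n = {w. \<exists>q\<in>aprods {1..n}. weq K w q}"

definition edge :: "letter list set \<Rightarrow> nat \<Rightarrow> letter list \<Rightarrow> letter list set" where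
  "edge K n u = {v. winv u @ v \<in> edge_stab K n}"

fun crs :: "letter list set \<Rightarrow> nat \<Rightarrow> letter list \<Rightarrow> letter list \<Rightarrow> letter list set list" where
  "crs K n u [] = []"
| "crs K n u (La # w) = crs K n (u @ [La]) w"
| "crs K n u (Lt # w) = edge K n u # crs K n (u @ [Lt]) w"
| "crs K n u (Li # w) = edge K n (u @ [Li]) # crs K n (u @ [Li]) w"

lemma crs_append: "crs K n u (v @ w) = crs K n u v @ crs K n (u @ v) w"
proof (induction v arbitrary: u)
  case (Cons l v)
  then show ?case by (cases l) simp_all
qed simp

lemma length_crs: "length (crs K n u w) \<le> length w"
proof (induction w arbitrary: u)
  case (Cons l w)
  then show ?case by (cases l) (simp_all add: le_SucI)
qed simp

lemma set_crs: "set (crs K n u w) \<subseteq> range (edge K n)"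
proof (induction w arbitrary: u)
  case (Cons l w)
  then show ?case by (cases l) auto
qed simp

definition edge_paths :: "letter list set \<Rightarrow> nat \<Rightarrow> nat \<Rightarrow> letter list set list set" where
  "edge_paths K n c = {\<sigma>. distinct_adj \<sigma> \<and> length \<sigma> \<le> c \<and> set \<sigma> \<subseteq> range (edge K n)}"

text \<open>The kernel of the map from words to the finite quotient of the semidirect product. The
  starting points \<open>u\<close> account for the translates of the F-coordinate under Q, and F
  acts by unitriangular matrices of size \<open>c + 1\<close>, one representation for each path
  \<open>\<sigma>\<close>.\<close>

definition nxt :: "letter list set \<Rightarrow> nat \<Rightarrow> nat \<Rightarrow> letter list set" where
  "nxt K n c = {w \<in> K. \<forall>u. \<forall>\<sigma>\<in>edge_paths K n c. \<forall>v. v \<subseteq> {..c} \<longrightarrow> act \<sigma> (crs K n u w) v = v}"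

context trivial_words
begin

lemma edge_stab_weq: "weq K u v \<Longrightarrow> v \<in> edge_stab K n \<Longrightarrow> u \<in> edge_stab K n"
  unfolding edge_stab_def using weq_trans by blast

lemma edge_stab_append: "u \<in> edge_stab K n \<Longrightarrow> v \<in> edge_stab K n \<Longrightarrow> u @ v \<in> edge_stab K n"
  unfolding edge_stab_def by (blast intro: aprods_append weq_append)

lemma edge_stab_winv: "u \<in> edge_stab K n \<Longrightarrow> winv u \<in> edge_stab K n"
  unfolding edge_stab_def using aprods_winv weq_winv by blast

lemma edge_stab_trivial: "w \<in> K \<Longrightarrow> w \<in> edge_stab K n"
  unfolding edge_stab_def using weq_Nil_iff aprods_Nil by blast

lemma aprods_edge_stab: "q \<in> aprods {1..n} \<Longrightarrow> q \<in> edge_stab K n"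
  unfolding edge_stab_def using weq_refl by blast

lemma edge_eq_iff: "edge K n u = edge K n u' \<longleftrightarrow> winv u @ u' \<in> edge_stab K n"
proof
  have "winv u' @ u' \<in> edge_stab K n" using edge_stab_trivial winv_left weq_Nil_iff by blast
  then have "u' \<in> edge K n u'" by (simp add: edge_def)
  moreover assume "edge K n u = edge K n u'"
  ultimately have "u' \<in> edge K n u" by simp
  then show "winv u @ u' \<in> edge_stab K n" by (simp add: edge_def)
next
  have sub: "edge K n u \<subseteq> edge K n u'" if uu': "winv u @ u' \<in> edge_stab K n" for u u'
  proof
    fix v assume "v \<in> edge K n u"
    then have "winv u @ v \<in> edge_stab K n" by (simp add: edge_def)
    then have "winv (winv u @ u') @ (winv u @ v) \<in> edge_stab K n"
      by (rule edge_stab_append[OF edge_stab_winv[OF uu']])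
    moreover have "weq K (winv u' @ v) (winv (winv u @ u') @ (winv u @ v))"
      using weq_sym[OF weq_cancel(2)[of "winv u'" u v]] by simp
    ultimately have "winv u' @ v \<in> edge_stab K n" using edge_stab_weq by blast
    then show "v \<in> edge K n u'" by (simp add: edge_def)
  qed
  assume a: "winv u @ u' \<in> edge_stab K n"
  then have "winv (winv u @ u') \<in> edge_stab K n" by (rule edge_stab_winv)
  then have "winv u' @ u \<in> edge_stab K n" by simp
  then show "edge K n u = edge K n u'" using sub a by blast
qed

lemma edge_cong: "weq K u u' \<Longrightarrow> edge K n u = edge K n u'"
  unfolding edge_eq_iff weq_iff by (rule edge_stab_trivial)

lemma crs_cong: "weq K u u' \<Longrightarrow> crs K n u w = crs K n u' w"
proof (induction w arbitrary: u u')
  case (Cons l w)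
  have "weq K (u @ [l]) (u' @ [l])" by (intro weq_append weq_refl Cons.prems)
  then have "crs K n (u @ [l]) w = crs K n (u' @ [l]) w" "edge K n (u @ [l]) = edge K n (u' @ [l])"
    using Cons.IH edge_cong by blast+
  then show ?case using edge_cong[OF Cons.prems] by (cases l) simp_all
qed simp

lemma crs_insert:
  assumes "w \<in> K"
  shows "crs K n x (u @ w @ y) = crs K n x u @ crs K n (x @ u) w @ crs K n (x @ u) y"
proof -
  have "weq K ((x @ u) @ w) ((x @ u) @ [])" using assms by (intro weq_append weq_refl) (simp add: weq_Nil_iff)
  then have "crs K n (x @ u @ w) y = crs K n (x @ u) y" using crs_cong[of "(x @ u) @ w" "x @ u"] by simp
  then show ?thesis by (simp add: crs_append)
qed

end

locale tower_step = trivial_words K for K +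
  fixes n c :: nat
begin

abbreviation "K' \<equiv> nxt K n c"
abbreviation "paths \<equiv> edge_paths K n c"

lemma nxt_subset: "K' \<subseteq> K" by (auto simp: nxt_def)

lemma nxt_act: "w \<in> K' \<Longrightarrow> \<sigma> \<in> paths \<Longrightarrow> v \<subseteq> {..c} \<Longrightarrow> act \<sigma> (crs K n u w) v = v"
  by (simp add: nxt_def)

lemma paths_act_bounded: "\<sigma> \<in> paths \<Longrightarrow> v \<subseteq> {..c} \<Longrightarrow> act \<sigma> es v \<subseteq> {..c}"
  by (rule act_bounded) (auto simp: edge_paths_def)

lemma act_insert:
  assumes "w \<in> K'" "\<sigma> \<in> paths" "v \<subseteq> {..c}"
  shows "act \<sigma> (crs K n x (u @ w @ y)) v = act \<sigma> (crs K n x (u @ y)) v"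
proof -
  have "w \<in> K" using assms nxt_subset by blast
  then show ?thesis using nxt_act[OF assms(1,2) paths_act_bounded[OF assms(2,3)]]
    by (simp add: crs_insert) (simp add: crs_append)
qed

lemma nxt_trivial_words: "trivial_words K'"
proof
  show "[] \<in> K'" by (simp add: nxt_def Nil_in)
  show "u @ w @ v \<in> K' \<longleftrightarrow> u @ v \<in> K'" if w: "w \<in> K'" for u w v
  proof -
    have "u @ w @ v \<in> K \<longleftrightarrow> u @ v \<in> K" using insert_iff nxt_subset w by blast
    then show ?thesis unfolding nxt_def using act_insert[OF w] by auto
  qed
  show "[l, linv l] \<in> K'" for l
  proof -
    have "act \<sigma> (crs K n u [l, linv l]) v = v" if "\<sigma> \<in> paths" for u \<sigma> v
    proof -
      have d: "distinct_adj \<sigma>" using that by (simp add: edge_paths_def)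
      show ?thesis
      proof (cases l)
        case Lt
        have "edge K n (u @ [Lt, Li]) = edge K n u"
          using weq_cancel(2)[of u "[Lt]" "[]"] by (intro edge_cong) simp
        then show ?thesis using Lt by (simp add: stp_stp[OF d])
      qed (simp_all add: stp_stp[OF d])
    qed
    then show ?thesis using cancel_in by (simp add: nxt_def)
  qed
qed

sublocale nx: trivial_words K' by (rule nxt_trivial_words)

lemma nxt_act_cong:
  assumes "weq K' w w'" "\<sigma> \<in> paths" "v \<subseteq> {..c}"
  shows "act \<sigma> (crs K n x w) v = act \<sigma> (crs K n x w') v"
proof -
  have "winv w @ w' \<in> K'" using assms(1) nx.weq_iff by blast
  then have "act \<sigma> (crs K n x (w @ (winv w @ w') @ [])) v = act \<sigma> (crs K n x (w @ [])) v"
    using assms by (intro act_insert)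
  moreover have "w @ winv w \<in> K'" using nx.winv_right nx.weq_Nil_iff by blast
  then have "act \<sigma> (crs K n x ([] @ (w @ winv w) @ w')) v = act \<sigma> (crs K n x ([] @ w')) v"
    using assms by (intro act_insert)
  ultimately show ?thesis by simp
qed

lemma weq_nxtI:
  assumes ww': "weq K w w'"
    and act: "\<And>x \<sigma> v. \<sigma> \<in> paths \<Longrightarrow> v \<subseteq> {..c} \<Longrightarrow> act \<sigma> (crs K n x w) v = act \<sigma> (crs K n x w') v"
  shows "weq K' w w'"
proof -
  have null: "act \<sigma> (crs K n u (winv w @ w')) v = v" if s: "\<sigma> \<in> paths" "v \<subseteq> {..c}" for u \<sigma> v
  proof -
    have "act \<sigma> (crs K n u (winv w @ w')) v = act \<sigma> (crs K n u (winv w @ w)) v"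
      using act[OF s(1) paths_act_bounded[OF s]] by (simp add: crs_append)
    also have "\<dots> = v" using nxt_act[OF _ s] nx.winv_left nx.weq_Nil_iff by blast
    finally show ?thesis .
  qed
  have "winv w @ w' \<in> K" using ww' weq_iff by blast
  then have "winv w @ w' \<in> K'" using null by (simp add: nxt_def)
  then show ?thesis by (simp add: nx.weq_iff)
qed

lemma finite_paths:
  assumes "finite (range (wcode K))"
  shows "finite paths"
proof -
  have "edge K n u = edge K n (from_nat (wcode K u))" for u
    by (rule edge_cong) (rule weq_sym[OF weq_wcode])
  then have "range (edge K n) \<subseteq> (\<lambda>m. edge K n (from_nat m)) ` range (wcode K)" by blast
  then have "finite (range (edge K n))" using assms finite_subset by blast
  then have "finite {\<sigma>. set \<sigma> \<subseteq> range (edge K n) \<and> length \<sigma> \<le> c}" by (rule finite_lists_length_le)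
  then show ?thesis by (rule finite_subset[rotated]) (auto simp: edge_paths_def)
qed

text \<open>A class modulo \<open>K'\<close> is determined by the class modulo \<open>K\<close> and
  by the actions of the word from finitely many starting points along finitely many paths.
  \<open>\<Phi>\<close> collects these data.\<close>

lemma finite_nxt:
  assumes fin: "finite (range (wcode K))"
  shows "finite (range (wcode K'))"
proof -
  define D where "D = range (wcode K) \<times> paths \<times> Pow {..c}"
  define \<Phi> where "\<Phi> w = (wcode K w, restrict (\<lambda>(m, \<sigma>, v). act \<sigma> (crs K n (from_nat m) w) v) D)" for w
  have "finite D" unfolding D_def using fin finite_paths[OF fin] by simp
  then have "finite (range (wcode K) \<times> (D \<rightarrow>\<^sub>E Pow {..c}))" using fin by (intro finite_cartesian_product finite_PiE) auto
  moreover have "range \<Phi> \<subseteq> range (wcode K) \<times> (D \<rightarrow>\<^sub>E Pow {..c})"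
  proof (rule image_subsetI)
    fix w
    have "restrict (\<lambda>(m, \<sigma>, v). act \<sigma> (crs K n (from_nat m) w) v) D \<in> D \<rightarrow>\<^sub>E Pow {..c}"
      using paths_act_bounded by (intro restrict_PiE_iff[THEN iffD2]) (auto simp: D_def)
    then show "\<Phi> w \<in> range (wcode K) \<times> (D \<rightarrow>\<^sub>E Pow {..c})" by (simp add: \<Phi>_def)
  qed
  ultimately have finr: "finite (range \<Phi>)" using finite_subset by blast
  have fac: "wcode K' w = wcode K' w'" if eq: "\<Phi> w = \<Phi> w'" for w w'
  proof -
    have "weq K' w w'"
    proof (rule weq_nxtI)
      show "weq K w w'" using eq by (simp add: \<Phi>_def wcode_eq_iff)
      fix x \<sigma> v assume s: "\<sigma> \<in> paths" "v \<subseteq> {..c}"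
      have "restrict (\<lambda>(m, \<sigma>, v). act \<sigma> (crs K n (from_nat m) w) v) D (wcode K x, \<sigma>, v)
        = restrict (\<lambda>(m, \<sigma>, v). act \<sigma> (crs K n (from_nat m) w') v) D (wcode K x, \<sigma>, v)"
        using eq by (simp add: \<Phi>_def)
      then have "act \<sigma> (crs K n (from_nat (wcode K x)) w) v = act \<sigma> (crs K n (from_nat (wcode K x)) w') v"
        using s by (simp add: D_def)
      then show "act \<sigma> (crs K n x w) v = act \<sigma> (crs K n x w') v"
        using crs_cong[OF weq_wcode[of K x]] by simp
    qed
    then show ?thesis by (simp add: wcode_eq_iff)
  qed
  have "wcode K' w = wcode K' (inv_into UNIV \<Phi> (\<Phi> w))" for w
    by (rule fac, rule sym, rule f_inv_into_f) blast
  then have "range (wcode K') \<subseteq> (\<lambda>y. wcode K' (inv_into UNIV \<Phi> y)) ` range \<Phi>" by blast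
  then show ?thesis using finr finite_subset by blast
qed

lemma crs_wpow: "x \<in> K \<Longrightarrow> act \<sigma> (crs K n u (wpow x m)) v = (act \<sigma> (crs K n u x) ^^ m) v"
proof (induction m arbitrary: v)
  case (Suc m)
  have "crs K n u (wpow x (Suc m)) = crs K n u x @ crs K n u (wpow x m)"
    using crs_insert[OF Suc.prems, of n u "[]" "wpow x m"] by simp
  then show ?case using Suc by (simp add: funpow_swap1)
qed simp

text \<open>A word in \<open>K\<close> is a closed path in the Cayley graph, so its powers act by
  the powers of one unitriangular map. On \<open>c + 1\<close> coordinates the power
  \<open>2 ^ Suc c\<close> of that map is the identity.\<close>

lemma exponent_nxt:
  assumes "\<And>w. wpow w (2 ^ k) \<in> K"
  shows "wpow w (2 ^ (k + Suc c)) \<in> K'"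
proof -
  define x where "x = wpow w (2 ^ k)"
  have x: "x \<in> K" using assms by (simp add: x_def)
  have "wpow x (2 ^ Suc c) \<in> K'"
    unfolding nxt_def
  proof (intro CollectI conjI allI ballI impI)
    show "wpow x (2 ^ Suc c) \<in> K" by (rule wpow_in[OF x])
    fix u \<sigma> v assume s: "\<sigma> \<in> paths" "v \<subseteq> {..c}"
    let ?v = "act \<sigma> (crs K n u (wpow x (2 ^ Suc c))) v"
    have "?v = (act \<sigma> (crs K n u x) ^^ (2 ^ Suc c)) v" by (rule crs_wpow[OF x])
    then have "i \<in> ?v \<longleftrightarrow> i \<in> v" if "i < Suc c" for i
      using unitriangular_pow2[OF unitriangular_act that] by metis
    moreover have "?v \<subseteq> {..c}" by (rule paths_act_bounded[OF s])
    ultimately show "?v = v" using s(2) by (intro Set.set_eqI) (metis atMost_iff less_Suc_eq_le subsetD)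
  qed
  then show ?thesis unfolding power_add wpow_mult x_def .
qed

text \<open>Induction peels off the outermost pair of crossings. Both cross the same edge, because
  \<open>aw (Suc i)\<close> with \<open>Suc i \<le> n\<close> lies in the edge stabilizer, and the
  involution of that edge cancels itself.\<close>

lemma aw_null:
  assumes "distinct_adj \<sigma>" "i \<le> n"
  shows "act \<sigma> (crs K n u (aw i)) v = v"
  using assms(2)
proof (induction i arbitrary: u v)
  case 0
  then show ?case by (simp add: aw_0)
next
  case (Suc i)
  have "aw (Suc i) \<in> edge_stab K n" using Suc.prems by (intro aprods_edge_stab aw_aprods) auto
  then have "winv u @ (u @ aw (Suc i)) \<in> edge_stab K n"
    using edge_stab_weq[OF weq_cancel(1)[of "[]" u "aw (Suc i)"]] by simp
  then have e: "edge K n (u @ aw (Suc i)) = edge K n u" using edge_eq_iff by metis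
  then have "crs K n u (aw (Suc i)) = edge K n u # crs K n (u @ [Lt]) (aw i) @ [edge K n u]"
    by (simp add: aw_Suc crs_append)
  then show ?case using Suc stp_stp[OF assms(1)] by simp
qed

lemma aprods_null:
  assumes "distinct_adj \<sigma>" "q \<in> aprods {0..n}"
  shows "act \<sigma> (crs K n u q) v = v"
  using assms(2)
proof (induction arbitrary: u rule: aprods_induct)
  case (append i q)
  then show ?case using aw_null[OF assms(1)] by (simp add: crs_append)
qed simp

text \<open>Index 0 is allowed here although it is missing from \<open>edge_stab\<close>, since the
  letter \<open>a\<close> crosses no edge.\<close>

lemma aprods_nxt: "q \<in> aprods {0..n} \<Longrightarrow> q \<in> K \<Longrightarrow> q \<in> K'"
  using aprods_null by (simp add: nxt_def edge_paths_def)

end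

section \<open>The tower and its limit\<close>

text \<open>The quotient is the Klein four-group. The parity of the exponent distinguishes the two
  directions of an edge (\<open>label_eq\<close>), and the parity of the number of letters
  \<open>a\<close> starts the induction in \<open>aw_notin_edge_stab\<close>.\<close>

definition K0 :: "letter list set" where
  "K0 = {w. even (expo w) \<and> even (count_list w La)}"

lemma K0_trivial_words: "trivial_words K0"
proof
  show "[l, linv l] \<in> K0" for l by (cases l) (auto simp: K0_def)
qed (auto simp: K0_def)

lemma count_list_winv: "count_list (winv w) La = count_list w La"
proof (induction w)
  case (Cons l w)
  then show ?case by (cases l) (auto simp: winv_Cons)
qed simp

lemma finite_K0: "finite (range (wcode K0))"
proof -
  interpret trivial_words K0 by (rule K0_trivial_words)
  have parity: "weq K0 u v" if "even (expo u) \<longleftrightarrow> even (expo v)"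
    "even (count_list u La) \<longleftrightarrow> even (count_list v La)" for u v
    using that unfolding weq_iff by (simp add: K0_def count_list_winv)
  have "wcode K0 w \<in> (\<lambda>(x, y). wcode K0 ((if x then [Lt] else []) @ (if y then [La] else []))) ` UNIV" for w
  proof (rule image_eqI)
    show "wcode K0 w = (\<lambda>(x, y). wcode K0 ((if x then [Lt] else []) @ (if y then [La] else [])))
        (odd (expo w), odd (count_list w La))"
      unfolding split_conv wcode_eq_iff by (rule parity) auto
  qed simp
  then have "range (wcode K0) \<subseteq> (\<lambda>(x, y). wcode K0 ((if x then [Lt] else []) @ (if y then [La] else []))) ` UNIV"
    by blast
  then show ?thesis by (rule finite_subset) simp
qed

primrec tower :: "(nat \<Rightarrow> nat) \<Rightarrow> nat \<Rightarrow> letter list set" where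
  "tower c 0 = K0"
| "tower c (Suc n) = nxt (tower c n) n (c n)"

text \<open>The condition on the exponent makes the quotient by the conjugates of \<open>a\<close> infinite cyclic.\<close>

definition tower_limit :: "(nat \<Rightarrow> nat) \<Rightarrow> letter list set" where
  "tower_limit c = {w. expo w = 0 \<and> (\<forall>n. w \<in> tower c n)}"

text \<open>A diameter of the finite subgroup that does not involve the later stages. The
  representatives \<open>q'\<close> are again products, because for products equality at stage
  \<open>n\<close> survives in the limit (\<open>aprods_weq_KL\<close>).\<close>

definition diam :: "letter list set \<Rightarrow> nat \<Rightarrow> nat" where
  "diam K n = (LEAST D. \<forall>q\<in>aprods {0..n}. \<exists>q'\<in>aprods {0..n}. length q' \<le> D \<and> weq K q q')"

locale positive_tower =
  fixes c :: "nat \<Rightarrow> nat"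
  assumes c_pos: "c n > 0"
begin

abbreviation "KK \<equiv> tower c"
abbreviation "KL \<equiv> tower_limit c"

lemma tower_step_KK: "tower_step (KK n)"
proof (induction n)
  case 0
  then show ?case using K0_trivial_words by (simp add: tower_step_def)
next
  case (Suc n)
  then show ?case using tower_step.nxt_trivial_words by (simp add: tower_step_def)
qed

sublocale st: tower_step "KK n" n "c n" for n
  by (rule tower_step_KK)

lemma KK_Suc_subset: "KK (Suc n) \<subseteq> KK n"
  using st.nxt_subset by simp

lemma KK_antimono: "m \<le> n \<Longrightarrow> KK n \<subseteq> KK m"
  by (rule lift_Suc_antimono_le[of KK]) (rule KK_Suc_subset)

lemma KK_even: "w \<in> KK n \<Longrightarrow> even (expo w)"
  using KK_antimono[of 0 n] by (auto simp: K0_def)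

lemma KK_count_even: "w \<in> KK n \<Longrightarrow> even (count_list w La)"
  using KK_antimono[of 0 n] by (auto simp: K0_def)

lemma finite_KK: "finite (range (wcode (KK n)))"
proof (induction n)
  case (Suc n)
  then show ?case using st.finite_nxt by simp
qed (simp add: finite_K0)

lemma exponent_KK: "\<exists>k. \<forall>w. wpow w (2 ^ k) \<in> KK n"
proof (induction n)
  case 0
  have "wpow w (2 ^ 1) = w @ w" for w by (simp add: numeral_2_eq_2)
  then have "wpow w (2 ^ 1) \<in> KK 0" for w by (simp add: K0_def)
  then show ?case by blast
next
  case (Suc n)
  then obtain k where "\<And>w. wpow w (2 ^ k) \<in> KK n" by blast
  then have "wpow w (2 ^ (k + Suc (c n))) \<in> KK (Suc n)" for w
    using st.exponent_nxt by simp
  then show ?case by blast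
qed

lemma KL_trivial_words: "trivial_words KL"
proof
  show "[] \<in> KL" by (simp add: tower_limit_def st.Nil_in)
  show "u @ w @ v \<in> KL \<longleftrightarrow> u @ v \<in> KL" if "w \<in> KL" for u w v
    using that st.insert_iff by (auto simp: tower_limit_def)
  show "[l, linv l] \<in> KL" for l by (simp add: tower_limit_def st.cancel_in)
qed

sublocale L: trivial_words KL by (rule KL_trivial_words)

lemma KL_subset: "KL \<subseteq> KK n" by (auto simp: tower_limit_def)

lemma weq_KK: "weq KL u v \<Longrightarrow> weq (KK n) u v"
  by (rule weq_mono[OF KL_trivial_words st.trivial_words_axioms KL_subset])

text \<open>The finite subgroup generated by \<open>t\<^sup>i a t\<inverse>\<^sup>i\<close> with \<open>i \<le> n\<close> does not change after stage \<open>n\<close>.\<close>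

lemma aprods_KL:
  assumes q: "q \<in> aprods {0..n}" "q \<in> KK n"
  shows "q \<in> KL"
proof -
  have "q \<in> KK m" for m
  proof (cases "m \<le> n")
    case True
    then show ?thesis using KK_antimono q(2) by blast
  next
    case False
    then have "n \<le> m" by simp
    then show ?thesis
    proof (induction rule: dec_induct)
      case (step k)
      have "q \<in> aprods {0..k}" using q(1) aprods_mono[of "{0..n}" "{0..k}"] step(1) by auto
      then show ?case using st.aprods_nxt[of q k] step by simp
    qed (rule q)
  qed
  then show ?thesis using q expo_aprods by (simp add: tower_limit_def)
qed

lemma aprods_weq_KL:
  assumes "q \<in> aprods {0..n}" "q' \<in> aprods {0..n}" "weq (KK n) q q'"
  shows "weq KL q q'"
proof -
  have "winv q @ q' \<in> KK n" using assms(3) by (simp add: st.weq_iff)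
  moreover have "winv q @ q' \<in> aprods {0..n}" using assms by (intro aprods_append aprods_winv)
  ultimately show ?thesis by (simp add: L.weq_iff aprods_KL)
qed

lemma edge_stab_even: "w \<in> edge_stab (KK n) n \<Longrightarrow> even (expo w)"
proof -
  assume "w \<in> edge_stab (KK n) n"
  then obtain q where q: "q \<in> aprods {1..n}" "weq (KK n) w q" by (auto simp: edge_stab_def)
  then have "winv w @ q \<in> KK n" by (simp add: st.weq_iff)
  then have "even (expo (winv w @ q))" by (rule KK_even)
  then show ?thesis using expo_aprods[OF q(1)] by simp
qed

text \<open>Indices from 1 to \<open>n\<close> stay within 0 to \<open>n\<close> when lowered by
  one; this is why \<open>edge_stab\<close> omits the index 0.\<close>

lemma edge_stab_down:
  assumes p: "p \<in> aprods {0..n}" "p \<in> edge_stab (KK n) n"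
  shows "\<exists>q\<in>aprods {0..n}. weq KL ([Li] @ p @ [Lt]) q"
proof -
  obtain q where q: "q \<in> aprods {1..n}" "weq (KK n) p q" using p(2) by (auto simp: edge_stab_def)
  have "q \<in> aprods {0..n}" using q(1) aprods_mono[of "{1..n}" "{0..n}"] by auto
  then have "weq KL p q" by (rule aprods_weq_KL[OF p(1) _ q(2)])
  then have "weq KL ([Li] @ p @ [Lt]) ([Li] @ q @ [Lt])" by (intro weq_append weq_refl)
  moreover have "{1..n} \<subseteq> Suc ` {0..n}" by (auto simp: image_iff intro: Suc_pred[symmetric] bexI[of _ "_ - 1"])
  then have "q \<in> aprods (Suc ` {0..n})" using q(1) aprods_mono by blast
  then obtain q' where "q' \<in> aprods {0..n}" "weq KL ([Li] @ q @ [Lt]) q'"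
    using L.aprods_shift_down by blast
  ultimately show ?thesis using weq_trans by blast
qed

text \<open>The word \<open>t p t^-1\<close> is not given as a product, so nothing known at stage
  \<open>n\<close> transfers to it directly. The comparison is made after lowering the indices of
  \<open>q\<close>: there \<open>p\<close> and \<open>q'\<close> are both products, and their
  equality passes to the limit.\<close>

lemma edge_stab_up:
  assumes p: "p \<in> aprods {0..n}" "[Lt] @ p @ [Li] \<in> edge_stab (KK n) n"
  shows "\<exists>q\<in>aprods {0..n}. weq KL ([Lt] @ p @ [Li]) q"
proof -
  obtain q where q: "q \<in> aprods {1..n}" "weq (KK n) ([Lt] @ p @ [Li]) q" using p(2) by (auto simp: edge_stab_def)
  have q0: "q \<in> aprods {0..n}" using q(1) aprods_mono[of "{1..n}" "{0..n}"] by auto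
  have "{1..n} \<subseteq> Suc ` {0..n}" by (auto simp: image_iff intro: Suc_pred[symmetric] bexI[of _ "_ - 1"])
  then have "q \<in> aprods (Suc ` {0..n})" using q(1) aprods_mono by blast
  then obtain q' where q': "q' \<in> aprods {0..n}" "weq KL ([Li] @ q @ [Lt]) q'"
    using L.aprods_shift_down by blast
  have "weq (KK n) (p @ [Li]) ([Li] @ q)" using q(2) st.weq_solve_left[of n "[Lt]" "p @ [Li]" q] by simp
  then have "weq (KK n) p ([Li] @ q @ [Lt])" using st.weq_solve_right[of n p "[Li]" "[Li] @ q"] by simp
  then have "weq (KK n) p q'" using weq_KK[OF q'(2)] weq_trans by blast
  then have "weq KL p q'" by (rule aprods_weq_KL[OF p(1) q'(1)])
  then have "weq KL p ([Li] @ q @ [Lt])" using q'(2) weq_sym weq_trans by blast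
  then have "weq KL (p @ [Li]) ([Li] @ q)" using L.weq_solve_right[of p "[Li]" "[Li] @ q"] by simp
  then have "weq KL ([Lt] @ p @ [Li]) q" using L.weq_solve_left[of "[Lt]" "p @ [Li]" q] by simp
  then show ?thesis using q0 by blast
qed

section \<open>Stacks of edges\<close>

abbreviation "label n u l \<equiv> edge (KK n) n (if l = Lt then u else u @ [Li])"

text \<open>The normal form of the element represented by a word whose reduced edge path is the given
  stack.\<close>

fun nform :: "nat \<Rightarrow> letter list set list \<Rightarrow> letter list \<Rightarrow> bool" where
  "nform n [] w \<longleftrightarrow> (\<exists>q\<in>aprods {0..n}. weq KL w q)"
| "nform n (e # s) w \<longleftrightarrow> (\<exists>u l q. nform n s u \<and> l \<noteq> La \<and> e = label n u l \<and>
     q \<in> aprods {0..n} \<and> weq KL w (u @ [l] @ q))"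

lemma nform_append:
  assumes "nform n s w" "q \<in> aprods {0..n}" "weq KL w' (w @ q)"
  shows "nform n s w'"
proof (cases s)
  case Nil
  then obtain p where p: "p \<in> aprods {0..n}" "weq KL w p" using assms(1) by auto
  have "weq KL (w @ q) (p @ q)" by (intro weq_append weq_refl p)
  then have "weq KL w' (p @ q)" using assms(3) weq_trans by blast
  then show ?thesis using Nil p assms(2) aprods_append by auto
next
  case (Cons e r)
  then obtain u l p where u: "nform n r u" "l \<noteq> La" "e = label n u l" "p \<in> aprods {0..n}"
    "weq KL w (u @ [l] @ p)"
    using assms(1) by auto
  have "weq KL (w @ q) ((u @ [l] @ p) @ q)" by (intro weq_append weq_refl u)
  from weq_trans[OF assms(3) this] have "weq KL w' (u @ [l] @ (p @ q))" by simp
  moreover have "p @ q \<in> aprods {0..n}" using u(4) assms(2) by (rule aprods_append)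
  ultimately show ?thesis unfolding Cons nform.simps using u(1-3) by blast
qed

lemma edge_prefix: "edge (KK n) n (u @ x) = edge (KK n) n (u @ y) \<longleftrightarrow> winv x @ y \<in> edge_stab (KK n) n"
proof -
  have "weq (KK n) (winv x @ winv u @ u @ y) (winv x @ y)" by (rule st.weq_cancel(1))
  then have "winv (u @ x) @ (u @ y) \<in> edge_stab (KK n) n \<longleftrightarrow> winv x @ y \<in> edge_stab (KK n) n"
    using st.edge_stab_weq weq_sym by (simp) blast
  then show ?thesis unfolding st.edge_eq_iff .
qed

lemma label_cong:
  assumes "weq (KK n) u u'" shows "label n u l = label n u' l"
proof -
  have "weq (KK n) (u @ [Li]) (u' @ [Li])" by (intro weq_append weq_refl assms)
  then show ?thesis using assms st.edge_cong by simp
qed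

text \<open>A label does not show the direction of a crossing. Equal labels with opposite directions
  would put a word of odd exponent into the edge stabilizer, contrary to
  \<open>edge_stab_even\<close>.\<close>

lemma label_eq:
  assumes l: "l \<noteq> La" "m \<noteq> La" and eq: "label n u l = label n (u @ p) m" and even: "even (expo p)"
  shows "l = m" "l = Lt \<Longrightarrow> p \<in> edge_stab (KK n) n" "l = Li \<Longrightarrow> [Lt] @ p @ [Li] \<in> edge_stab (KK n) n"
proof -
  consider "l = Lt" "m = Lt" | "l = Lt" "m = Li" | "l = Li" "m = Lt" | "l = Li" "m = Li"
    using l by (cases l; cases m) auto
  then have "l = m \<and> (l = Lt \<longrightarrow> p \<in> edge_stab (KK n) n) \<and> (l = Li \<longrightarrow> [Lt] @ p @ [Li] \<in> edge_stab (KK n) n)"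
  proof cases
    case 1
    then show ?thesis using eq edge_prefix[of n u "[]" p] by simp
  next
    case 2
    then have "p @ [Li] \<in> edge_stab (KK n) n" using eq edge_prefix[of n u "[]" "p @ [Li]"] by simp
    then show ?thesis using edge_stab_even even by fastforce
  next
    case 3
    then have "[Lt] @ p \<in> edge_stab (KK n) n" using eq edge_prefix[of n u "[Li]" p] by simp
    then show ?thesis using edge_stab_even even by fastforce
  next
    case 4
    then show ?thesis using eq edge_prefix[of n u "[Li]" "p @ [Li]"] by simp
  qed
  then show "l = m" "l = Lt \<Longrightarrow> p \<in> edge_stab (KK n) n" "l = Li \<Longrightarrow> [Lt] @ p @ [Li] \<in> edge_stab (KK n) n"
    by blast+
qed

text \<open>The counterpart of Britton's lemma: a crossing is undone only by a pinch, and the pinch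
  \<open>[l] @ q @ [m]\<close> collapses into the finite subgroup. Parity excludes
  \<open>l = m\<close>.\<close>

lemma label_pop:
  assumes l: "l \<noteq> La" "m \<noteq> La" and eq: "label n u l = label n (u @ [l] @ q) m" and q: "q \<in> aprods {0..n}"
  shows "\<exists>q'\<in>aprods {0..n}. weq KL ([l] @ q @ [m]) q'"
proof -
  have q0: "expo q = 0" by (rule expo_aprods[OF q])
  consider "l = Lt" "m = Lt" | "l = Lt" "m = Li" | "l = Li" "m = Lt" | "l = Li" "m = Li"
    using l by (cases l; cases m) auto
  then show ?thesis
  proof cases
    case 1
    then have "[Lt] @ q \<in> edge_stab (KK n) n" using eq edge_prefix[of n u "[]" "[Lt] @ q"] by simp
    then show ?thesis using edge_stab_even q0 by fastforce
  next
    case 2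
    then have "[Lt] @ q @ [Li] \<in> edge_stab (KK n) n"
      using eq edge_prefix[of n u "[]" "[Lt] @ q @ [Li]"] by simp
    then show ?thesis using edge_stab_up[OF q] 2 by simp
  next
    case 3
    then have "[Lt] @ [Li] @ q \<in> edge_stab (KK n) n"
      using eq edge_prefix[of n u "[Li]" "[Li] @ q"] by simp
    then have "q \<in> edge_stab (KK n) n"
      using st.edge_stab_weq[OF weq_sym[OF st.weq_cancel(2)[of n "[]" "[Lt]" q]]] by simp
    then show ?thesis using edge_stab_down[OF q] 3 by simp
  next
    case 4
    then have *: "[Lt] @ [Li] @ q @ [Li] \<in> edge_stab (KK n) n"
      using eq edge_prefix[of n u "[Li]" "[Li] @ q @ [Li]"] by simp
    then show ?thesis using edge_stab_even[OF *] q0 by simp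
  qed
qed

text \<open>The letter \<open>a\<close> is absorbed by the finite subgroup. A letter
  \<open>t\<close> or \<open>t^-1\<close> pushes its label, unless this label is on top of the
  stack; then \<open>label_pop\<close> removes the pinch.\<close>

lemma nform_red: "nform n (red (crs (KK n) n [] w)) w"
proof (induction w rule: rev_induct)
  case Nil
  show ?case by (auto intro!: bexI[of _ "[]"])
next
  case (snoc m w)
  show ?case
  proof (cases "m = La")
    case True
    then have "crs (KK n) n [] (w @ [m]) = crs (KK n) n [] w" by (simp add: crs_append)
    moreover have "[m] \<in> aprods {0..n}" using aw_aprods[of 0 "{0..n}"] True by (simp add: aw_0)
    ultimately show ?thesis using nform_append[OF snoc _ weq_refl] by simp
  next
    case False
    let ?s = "red (crs (KK n) n [] w)"
    have c: "crs (KK n) n [] (w @ [m]) = crs (KK n) n [] w @ [label n w m]"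
      using False by (cases m) (simp_all add: crs_append)
    have push: "nform n (label n w m # ?s) (w @ [m])"
      unfolding nform.simps using snoc False aprods_Nil weq_refl by (metis append.right_neutral)
    show ?thesis
    proof (cases ?s)
      case Nil
      then show ?thesis using push by (simp add: c red_snoc)
    next
      case (Cons e r)
      show ?thesis
      proof (cases "e = label n w m")
        case False
        then show ?thesis using push Cons by (simp add: c red_snoc)
      next
        case True
        obtain u l q where u: "nform n r u" "l \<noteq> La" "e = label n u l" "q \<in> aprods {0..n}"
          "weq KL w (u @ [l] @ q)"
          using snoc Cons by auto
        have "weq (KK n) w (u @ [l] @ q)" by (rule weq_KK[OF u(5)])
        then have "label n w m = label n (u @ [l] @ q) m"
          by (rule label_cong)
        then have "label n u l = label n (u @ [l] @ q) m" using True u(3) by simp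
        then obtain q' where q': "q' \<in> aprods {0..n}" "weq KL ([l] @ q @ [m]) q'"
          using label_pop[OF u(2) False _ u(4)] by blast
        have "weq KL (w @ [m]) ((u @ [l] @ q) @ [m])" by (intro weq_append weq_refl u)
        also have "weq KL ((u @ [l] @ q) @ [m]) (u @ q')" using weq_append[OF weq_refl q'(2), of u] by simp
        finally have "nform n r (w @ [m])" by (rule nform_append[OF u(1) q'(1)])
        then show ?thesis using Cons True by (simp add: c red_snoc)
      qed
    qed
  qed
qed

text \<open>Below the top edge the two elements differ by some \<open>p\<close> in the finite
  subgroup, which the crossing \<open>l\<close> conjugates. Equal top labels force \<open>p\<close>,
  or \<open>t p t^-1\<close> if \<open>l = Li\<close>, into the edge stabilizer, so the conjugate is
  again a product.\<close>

lemma nform_fibre: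
  "nform n s w \<Longrightarrow> nform n s w' \<Longrightarrow> \<exists>q\<in>aprods {0..n}. weq KL w' (w @ q)"
proof (induction s arbitrary: w w')
  case Nil
  then obtain p p' where p: "p \<in> aprods {0..n}" "weq KL w p" "p' \<in> aprods {0..n}" "weq KL w' p'" by auto
  have "weq KL p' (p @ winv p @ p')" using L.weq_cancel(2)[of "[]" p p'] weq_sym by simp
  also have "weq KL (p @ winv p @ p') (w @ winv p @ p')" by (intro weq_append weq_refl weq_sym[OF p(2)])
  finally have "weq KL w' (w @ winv p @ p')" using p(4) weq_trans by blast
  then show ?case using p aprods_append aprods_winv by blast
next
  case (Cons e s)
  obtain u l q where u: "nform n s u" "l \<noteq> La" "e = label n u l" "q \<in> aprods {0..n}"
    "weq KL w (u @ [l] @ q)" using Cons.prems(1) by auto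
  obtain u' l' q' where u': "nform n s u'" "l' \<noteq> La" "e = label n u' l'" "q' \<in> aprods {0..n}"
    "weq KL w' (u' @ [l'] @ q')" using Cons.prems(2) by auto
  obtain p where p: "p \<in> aprods {0..n}" "weq KL u' (u @ p)" using Cons.IH[OF u(1) u'(1)] by blast
  have "weq (KK n) u' (u @ p)" by (rule weq_KK[OF p(2)])
  then have "label n u' l' = label n (u @ p) l'" by (rule label_cong)
  then have eq: "label n u l = label n (u @ p) l'" using u(3) u'(3) by simp
  have ep: "even (expo p)" using expo_aprods[OF p(1)] by simp
  note le = label_eq[OF u(2) u'(2) eq ep]
  have "\<exists>r\<in>aprods {0..n}. weq KL ([linv l] @ p @ [l]) r"
  proof (cases l)
    case Lt
    then show ?thesis using edge_stab_down[OF p(1)] le by simp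
  next
    case Li
    then show ?thesis using edge_stab_up[OF p(1)] le by simp
  qed (use u in simp)
  then obtain r where r: "r \<in> aprods {0..n}" "weq KL ([linv l] @ p @ [l]) r" by blast
  have w: "weq KL u (w @ winv q @ [linv l])"
    using L.weq_solve_right[of u "[l] @ q" w] weq_sym[OF u(5)] by (simp add: winv_Cons)
  have "weq KL w' (u' @ [l] @ q')" using u'(5) le(1) by simp
  also have "weq KL (u' @ [l] @ q') ((u @ p) @ [l] @ q')" by (intro weq_append weq_refl p)
  also have "weq KL ((u @ p) @ [l] @ q') ((w @ winv q @ [linv l]) @ p @ [l] @ q')"
    unfolding append_assoc[of u] by (intro weq_append weq_refl w)
  also have "weq KL ((w @ winv q @ [linv l]) @ p @ [l] @ q') ((w @ winv q) @ ([linv l] @ p @ [l]) @ q')" by simp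
  also have "weq KL ((w @ winv q) @ ([linv l] @ p @ [l]) @ q') ((w @ winv q) @ r @ q')"
    by (intro weq_append weq_refl r)
  finally have "weq KL w' (w @ (winv q @ r @ q'))" by simp
  then show ?case using u(4) u'(4) r(1) aprods_append aprods_winv by blast
qed

text \<open>Up to length \<open>c n\<close> the matrices used for stage \<open>n + 1\<close>
  separate all reduced words, so on this ball the finite stage knows the point of the tree
  exactly.\<close>

lemma red_crs_cong:
  assumes "weq (KK (Suc n)) w w'" "length w \<le> c n" "length w' \<le> c n"
  shows "red (crs (KK n) n [] w) = red (crs (KK n) n [] w')"
proof (rule red_eq_if_act_eq)
  show "length (crs (KK n) n [] w) \<le> c n" "length (crs (KK n) n [] w') \<le> c n"
    using assms length_crs order_trans by blast+
  show "set (crs (KK n) n [] w) \<subseteq> range (edge (KK n) n)" "set (crs (KK n) n [] w') \<subseteq> range (edge (KK n) n)"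
    using set_crs by blast+
  fix \<sigma> assume "distinct_adj \<sigma>" "length \<sigma> \<le> c n" "set \<sigma> \<subseteq> range (edge (KK n) n)"
  then have "\<sigma> \<in> edge_paths (KK n) n (c n)" by (simp add: edge_paths_def)
  then show "act \<sigma> (crs (KK n) n [] w) {0} = act \<sigma> (crs (KK n) n [] w') {0}"
    using assms(1) st.nxt_act_cong by simp
qed

lemma diam_bound:
  assumes "q \<in> aprods {0..n}"
  shows "\<exists>q'. length q' \<le> diam (KK n) n \<and> weq KL q q'"
proof -
  let ?P = "\<lambda>D. \<forall>q\<in>aprods {0..n}. \<exists>q'\<in>aprods {0..n}. length q' \<le> D \<and> weq (KK n) q q'"
  let ?A = "wcode (KK n) ` aprods {0..n}"
  have finA: "finite ?A" using finite_KK finite_subset by (metis image_mono top_greatest)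
  have "\<forall>x\<in>?A. \<exists>q\<in>aprods {0..n}. x = wcode (KK n) q" by blast
  then obtain f where f: "\<And>x. x \<in> ?A \<Longrightarrow> f x \<in> aprods {0..n} \<and> x = wcode (KK n) (f x)" by metis
  have "?P (Max ((length \<circ> f) ` ?A))"
  proof
    fix q assume q: "q \<in> aprods {0..n}"
    let ?x = "wcode (KK n) q"
    have "?x \<in> ?A" using q by blast
    then have "f ?x \<in> aprods {0..n}" "weq (KK n) q (f ?x)" using f wcode_eq_iff by blast+
    moreover have "(length \<circ> f) ?x \<le> Max ((length \<circ> f) ` ?A)"
      by (intro Max_ge finite_imageI finA imageI \<open>?x \<in> ?A\<close>)
    then have "length (f ?x) \<le> Max ((length \<circ> f) ` ?A)" by simp
    ultimately show "\<exists>q'\<in>aprods {0..n}. length q' \<le> Max ((length \<circ> f) ` ?A) \<and> weq (KK n) q q'" by blast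
  qed
  then have "?P (diam (KK n) n)" unfolding diam_def by (rule LeastI)
  then show ?thesis using assms aprods_weq_KL by blast
qed

section \<open>Independence of the words \<open>t\<^sup>i a t\<inverse>\<^sup>i\<close>\<close>

lemma one_in_act_sing: "1 \<in> act [e] es {0} \<longleftrightarrow> odd (count_list es e)"
proof (induction es rule: rev_induct)
  case (snoc x es)
  have "0 \<in> act [e] es {0}"
    by (induction es rule: rev_induct) (auto simp: zero_in_stp)
  then show ?case using snoc Suc_in_stp[of 0 "[e]" x "act [e] es {0}"] by auto
qed simp

text \<open>The number of crossings of the edge labelled by \<open>t\<close> has odd parity along \<open>t\<^sup>n\<^sup>+\<^sup>2 a t\<inverse>\<^sup>n\<^sup>-\<^sup>2\<close>,
  but even parity along products of words \<open>t\<^sup>i a t\<inverse>\<^sup>i\<close> with smaller \<open>i > 0\<close>.\<close>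

lemma aw_notin_edge_stab: "aw (Suc n) \<notin> edge_stab (KK n) n"
proof (induction n)
  case 0
  show ?case
  proof
    assume "aw (Suc 0) \<in> edge_stab (KK 0) 0"
    then obtain q where q: "q \<in> aprods {}" "weq (KK 0) (aw (Suc 0)) q" by (auto simp: edge_stab_def)
    have "q = []" using q(1) by (auto simp: aprods_def)
    then have "aw (Suc 0) \<in> KK 0" using q(2) st.weq_Nil_iff by blast
    then show False using KK_count_even count_La_aw[of "Suc 0"] by fastforce
  qed
next
  case (Suc n)
  define \<tau> where "\<tau> = edge (KK n) n [Lt]"
  define N where "N u w \<longleftrightarrow> odd (count_list (crs (KK n) n u w) \<tau>)" for u w
  have N_append: "N u (v @ w) \<longleftrightarrow> N u v \<noteq> N (u @ v) w" for u v w
    by (auto simp: N_def crs_append)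
  have small: "\<not> N u (aw i)" if "i \<le> n" for u i
    using st.aw_null[of "[\<tau>]" i n u "{0}"] that one_in_act_sing[of \<tau> "crs (KK n) n u (aw i)"]
    by (simp add: N_def)
  have even_edge: "edge (KK n) n u \<noteq> \<tau>" if "even (expo u)" for u
  proof
    assume "edge (KK n) n u = \<tau>"
    then have "winv u @ [Lt] \<in> edge_stab (KK n) n" by (simp add: \<tau>_def st.edge_eq_iff)
    then show False using edge_stab_even that by fastforce
  qed
  \<comment> \<open>The crossings inside the outermost pair contribute an even number, by
    \<open>small\<close>, so only that pair counts.\<close>
  have big: "N u (aw (Suc n)) \<longleftrightarrow> (edge (KK n) n u = \<tau>) \<noteq> (edge (KK n) n (u @ aw (Suc n)) = \<tau>)" for u
    using small[of n "u @ [Lt]"] by (auto simp: N_def aw_Suc crs_append)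
  have prods: "\<not> N u q" if "q \<in> aprods {1..Suc n}" "even (expo u)" for q u
    using that
  proof (induction arbitrary: u rule: aprods_induct)
    case (append i q)
    have "\<not> N u (aw i)"
    proof (cases "i \<le> n")
      case False
      then have "i = Suc n" using append(1) by simp
      then show ?thesis using big[of u] even_edge append(4) by simp
    qed (rule small)
    then show ?case using append N_append by simp
  qed (simp add: N_def)
  show ?case
  proof
    assume "aw (Suc (Suc n)) \<in> edge_stab (KK (Suc n)) (Suc n)"
    then obtain q where q: "q \<in> aprods {1..Suc n}" "weq (KK (Suc n)) (aw (Suc (Suc n))) q"
      by (auto simp: edge_stab_def)
    have "[\<tau>] \<in> edge_paths (KK n) n (c n)" using c_pos[of n] by (simp add: edge_paths_def \<tau>_def)
    then have "act [\<tau>] (crs (KK n) n [] (aw (Suc (Suc n)))) {0} = act [\<tau>] (crs (KK n) n [] q) {0}"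
      using q(2) by (intro st.nxt_act_cong) auto
    then have "N [] (aw (Suc (Suc n))) \<longleftrightarrow> N [] q" using one_in_act_sing unfolding N_def by metis
    moreover have "\<not> N [] q" using prods[OF q(1)] by simp
    moreover have "N [] (aw (Suc (Suc n)))"
    proof -
      \<comment> \<open>The walk \<open>aw (Suc n)\<close> from \<open>t\<close> first crosses
        \<open>\<tau>\<close> itself. By the induction hypothesis the edge of its last crossing is
        different, which leaves an odd count.\<close>
      have "edge (KK n) n ([Lt] @ aw (Suc n)) \<noteq> \<tau>"
        using edge_prefix[of n "[Lt]" "aw (Suc n)" "[]"] Suc.IH by (simp add: \<tau>_def)
      then have "N [Lt] (aw (Suc n))" using big[of "[Lt]"] by (simp add: \<tau>_def)
      moreover have "\<not> N [] [Lt]" using even_edge[of "[]"] by (simp add: N_def)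
      moreover have "\<not> N ([Lt] @ aw (Suc n)) [Li]"
        using even_edge[of "[Lt] @ aw (Suc n) @ [Li]"] by (simp add: N_def)
      ultimately show ?thesis
        unfolding aw_Suc[of "Suc n"] by (simp only: N_append append_Nil) simp
    qed
    ultimately show False by blast
  qed
qed

lemma inj_aw: "inj_on (\<lambda>i. wcode KL (aw i)) {1..}"
proof (rule linorder_inj_onI')
  fix i j :: nat assume ij: "i \<in> {1..}" "j \<in> {1..}" "i < j"
  obtain n where j: "j = Suc n" using ij by (cases j) auto
  show "wcode KL (aw i) \<noteq> wcode KL (aw j)"
  proof
    assume "wcode KL (aw i) = wcode KL (aw j)"
    then have "weq (KK n) (aw j) (aw i)" using weq_KK weq_sym wcode_eq_iff by blast
    moreover have "aw i \<in> aprods {1..n}" using ij j by (intro aw_aprods) auto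
    ultimately have "aw j \<in> edge_stab (KK n) n" by (auto simp: edge_stab_def)
    then show False using aw_notin_edge_stab j by simp
  qed
qed

end

section \<open>Word length and the four-point inequality\<close>

definition wlen :: "letter list set \<Rightarrow> letter list \<Rightarrow> nat" where
  "wlen K w = (LEAST n. \<exists>v. length v = n \<and> weq K v w)"

lemma wlen_geodesic: obtains v where "weq K v w" "length v = wlen K w"
proof -
  have "\<exists>n. \<exists>v. length v = n \<and> weq K v w" using weq_refl by blast
  from LeastI_ex[OF this] show ?thesis using that unfolding wlen_def by blast
qed

lemma wlen_le: "weq K v w \<Longrightarrow> wlen K w \<le> length v"
  unfolding wlen_def by (rule Least_le) blast

lemma wlen_cong: "weq K v w \<Longrightarrow> wlen K v = wlen K w"
proof -
  have "wlen K w \<le> wlen K v" if vw: "weq K v w" for v w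
  proof -
    obtain u where "weq K u v" "length u = wlen K v" by (rule wlen_geodesic)
    then show ?thesis using wlen_le[OF weq_trans[OF _ vw]] by metis
  qed
  then show "weq K v w \<Longrightarrow> wlen K v = wlen K w" using weq_sym by (metis antisym)
qed

lemma (in trivial_words) wlen_winv: "wlen K (winv w) = wlen K w"
proof -
  have "wlen K (winv w) \<le> wlen K w" for w
  proof -
    obtain v where v: "weq K v w" "length v = wlen K w" by (rule wlen_geodesic)
    then show ?thesis using wlen_le[OF weq_winv[OF v(1)]] by simp
  qed
  from this[of w] this[of "winv w"] show ?thesis by simp
qed

lemma wlen_append: "wlen K (u @ v) \<le> wlen K u + wlen K v"
proof -
  obtain u' v' where "weq K u' u" "length u' = wlen K u" "weq K v' v" "length v' = wlen K v"
    using wlen_geodesic by metis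
  then show ?thesis using wlen_le[OF weq_append[of K u' u v' v]] by simp
qed

text \<open>\<open>M\<close> is the branch point of two paths from the root: stacks carry their
  latest edge at the head, so the suffixes of a stack are the vertices on its path.\<close>

lemma ex_longest_common_suffix:
  "\<exists>M. suffix M s \<and> suffix M s' \<and> (M = s \<or> (\<exists>e. suffix (e # M) s \<and> \<not> suffix (e # M) s'))"
proof (induction s)
  case (Cons e s)
  then show ?case by (metis suffix_Cons suffix_order.refl)
qed simp

context positive_tower
begin

abbreviation "stack n w \<equiv> red (crs (KK n) n [] w)"

text \<open>One letter moves the stack along at most one edge of the tree. The stacks with suffix
  \<open>e # M\<close> form a branch attached at \<open>M\<close>, which can be entered or left only
  through \<open>M\<close>.\<close>

lemma stack_crossing:
  assumes "suffix (e # M) (stack n w) \<noteq> suffix (e # M) (stack n (w @ v))"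
  shows "\<exists>v1 v2. v = v1 @ v2 \<and> stack n (w @ v1) = M"
  using assms
proof (induction v rule: rev_induct)
  case (snoc l v)
  show ?case
  proof (cases "suffix (e # M) (stack n w) = suffix (e # M) (stack n (w @ v))")
    case False
    then obtain v1 v2 where "v = v1 @ v2" "stack n (w @ v1) = M" using snoc.IH by blast
    then show ?thesis by (intro exI[of _ v1] exI[of _ "v2 @ [l]"]) simp
  next
    case True
    let ?s = "stack n (w @ v)" and ?s' = "stack n (w @ v @ [l])"
    have ne: "suffix (e # M) ?s \<noteq> suffix (e # M) ?s'" using True snoc.prems by simp
    have "l \<noteq> La" using ne crs_append[of "KK n" n "[]" "w @ v" "[l]"] by (cases l) auto
    then obtain x where "?s' = psh ?s x"
      using crs_append[of "KK n" n "[]" "w @ v" "[l]"] by (cases l) (auto simp: red_snoc)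
    then consider "?s' = x # ?s" | y where "?s = y # ?s'"
      by (cases ?s) (auto split: if_splits)
    then show ?thesis
    proof cases
      case 1
      then have "M = ?s" using ne by (auto simp: suffix_Cons)
      then show ?thesis by (intro exI[of _ v] exI[of _ "[l]"]) simp
    next
      case 2
      then have "M = ?s'" using ne by (auto simp: suffix_Cons)
      then show ?thesis by (intro exI[of _ "v @ [l]"] exI[of _ "[]"]) simp
    qed
  qed
qed simp

text \<open>A geodesic from \<open>x\<close> to \<open>z\<close> and a geodesic from 1 to
  \<open>y\<close> both visit the fibre over \<open>M\<close>, at points whose distance is at most
  the diameter. Exchanging their tails there gives paths from \<open>x\<close> to \<open>y\<close>
  and from 1 to \<open>z\<close>, each at the cost of one diameter.\<close>

lemma four_point_aux:
  assumes M: "suffix M (stack n y)" "M = stack n x \<or> (\<exists>e. suffix (e # M) (stack n x) \<and> \<not> suffix (e # M) (stack n z))"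
    and v: "weq KL (x @ v) z" "length v = wlen KL (winv x @ z)" "length (x @ v) \<le> c n" "length z \<le> c n"
    and y: "length y = wlen KL y"
  shows "wlen KL (winv x @ y) + wlen KL z \<le> wlen KL (winv x @ z) + wlen KL y + 2 * diam (KK n) n"
proof -
  have "weq (KK (Suc n)) (x @ v) z" by (rule weq_KK[OF v(1)])
  then have stz: "stack n (x @ v) = stack n z" using v(3,4) by (rule red_crs_cong)
  obtain v1 v2 where v12: "v = v1 @ v2" "stack n (x @ v1) = M"
  proof (cases "M = stack n x")
    case True
    then show ?thesis using that[of "[]" v] by simp
  next
    case False
    then show ?thesis using M(2) stack_crossing[of _ M n x v] that stz by metis
  qed
  obtain y1 y2 where y12: "y = y1 @ y2" "stack n y1 = M"
  proof (cases "M = stack n y")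
    case True
    then show ?thesis using that[of y "[]"] by simp
  next
    case False
    then obtain p e where "stack n y = (p @ [e]) @ M"
      using M(1) by (metis append_Nil rev_exhaust suffixE)
    then have "suffix (e # M) (stack n y)" by (simp add: suffix_def)
    then show ?thesis using stack_crossing[of e M n "[]" y] that by auto
  qed
  have "nform n M (x @ v1)" "nform n M y1" using nform_red[of n] v12(2) y12(2) by metis+
  then obtain q0 where q0: "q0 \<in> aprods {0..n}" "weq KL y1 ((x @ v1) @ q0)" using nform_fibre by blast
  obtain q where q: "length q \<le> diam (KK n) n" "weq KL q0 q" using diam_bound[OF q0(1)] by blast
  have "weq KL ((x @ v1) @ q0) ((x @ v1) @ q)" by (intro weq_append weq_refl q)
  with q0(2) have y1: "weq KL y1 ((x @ v1) @ q)" by (rule weq_trans)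
  have "weq KL (y1 @ y2) (((x @ v1) @ q) @ y2)" by (intro weq_append weq_refl y1)
  then have "weq KL (x @ v1 @ q @ y2) y" using weq_sym y12(1) by simp
  then have "weq KL (v1 @ q @ y2) (winv x @ y)" by (simp only: L.weq_solve_left)
  from wlen_le[OF this] have 1: "wlen KL (winv x @ y) \<le> length v1 + diam (KK n) n + length y2"
    using q(1) by simp
  have "weq KL (x @ v1) (y1 @ winv q)" using weq_sym[OF y1] by (simp only: L.weq_solve_right)
  from weq_append[OF this weq_refl[of KL v2]]
  have "weq KL ((x @ v1) @ v2) ((y1 @ winv q) @ v2)" .
  then have "weq KL (y1 @ winv q @ v2) (x @ v)" using weq_sym v12(1) by simp
  from wlen_le[OF weq_trans[OF this v(1)]] have 2: "wlen KL z \<le> length y1 + diam (KK n) n + length v2"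
    using q(1) by simp
  have "length v1 + length v2 = wlen KL (winv x @ z)" "length y1 + length y2 = wlen KL y"
    using v(2) v12 y y12 by auto
  with 1 2 show ?thesis by linarith
qed

text \<open>The fourth point is 1. The branch points of \<open>x, z\<close> and of
  \<open>y, z\<close> both lie on the path to \<open>z\<close>, so one is a suffix of the other; the
  shorter one also lies on the path to the remaining point. The factor 3 covers a word of length
  \<open>r\<close> followed by a geodesic of length at most \<open>2 * r\<close>.\<close>

lemma four_point:
  assumes r: "wlen KL x \<le> r" "wlen KL y \<le> r" "wlen KL z \<le> r" and c: "3 * r \<le> c n"
  shows "wlen KL (winv x @ y) + wlen KL z \<le>
    max (wlen KL (winv x @ z) + wlen KL y) (wlen KL (winv y @ z) + wlen KL x) + 2 * diam (KK n) n"
proof -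
  obtain x' where x': "weq KL x' x" "length x' = wlen KL x" by (rule wlen_geodesic)
  obtain y' where y': "weq KL y' y" "length y' = wlen KL y" by (rule wlen_geodesic)
  obtain z' where z': "weq KL z' z" "length z' = wlen KL z" by (rule wlen_geodesic)
  have path: "\<exists>v. weq KL (u @ v) z' \<and> length v = wlen KL (winv u @ z') \<and> length (u @ v) \<le> c n"
    if "length u \<le> r" for u
  proof -
    obtain v where v: "weq KL v (winv u @ z')" "length v = wlen KL (winv u @ z')" by (rule wlen_geodesic)
    then have "weq KL (u @ v) z'" by (simp add: L.weq_solve_left)
    moreover have "length v \<le> length (winv u @ z')" unfolding v(2) by (rule wlen_le) (rule weq_refl)
    ultimately show ?thesis using v that z'(2) r(3) c by (intro exI[of _ v]) simp
  qed
  obtain M1 where M1: "suffix M1 (stack n x')" "suffix M1 (stack n z')"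
    "M1 = stack n x' \<or> (\<exists>e. suffix (e # M1) (stack n x') \<and> \<not> suffix (e # M1) (stack n z'))"
    using ex_longest_common_suffix by blast
  obtain M2 where M2: "suffix M2 (stack n y')" "suffix M2 (stack n z')"
    "M2 = stack n y' \<or> (\<exists>e. suffix (e # M2) (stack n y') \<and> \<not> suffix (e # M2) (stack n z'))"
    using ex_longest_common_suffix by blast
  have lz: "length z' \<le> c n" using z' r c by simp
  have len: "wlen KL x' = wlen KL x" "wlen KL y' = wlen KL y" "wlen KL z' = wlen KL z"
    using wlen_cong x'(1) y'(1) z'(1) by blast+
  have dist: "wlen KL (winv x' @ y') = wlen KL (winv x @ y)" "wlen KL (winv y' @ x') = wlen KL (winv x @ y)"
    "wlen KL (winv x' @ z') = wlen KL (winv x @ z)" "wlen KL (winv y' @ z') = wlen KL (winv y @ z)"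
  proof -
    show xy: "wlen KL (winv x' @ y') = wlen KL (winv x @ y)"
      by (intro wlen_cong weq_append L.weq_winv x' y')
    show "wlen KL (winv y' @ x') = wlen KL (winv x @ y)"
      unfolding xy[symmetric] using L.wlen_winv[of "winv x' @ y'"] by simp
  qed (intro wlen_cong weq_append L.weq_winv x' y' z')+
  from M1(2) M2(2) consider "suffix M1 M2" | "suffix M2 M1" using suffix_same_cases by blast
  then show ?thesis
  proof cases
    case 1
    then have sfx: "suffix M1 (stack n y')" using M2(1) suffix_order.trans by blast
    obtain v where v: "weq KL (x' @ v) z'" "length v = wlen KL (winv x' @ z')" "length (x' @ v) \<le> c n"
      using path[of x'] x' r by auto
    have "length y' = wlen KL y'" using y'(2) len by simp
    then have "wlen KL (winv x' @ y') + wlen KL z' \<le> wlen KL (winv x' @ z') + wlen KL y' + 2 * diam (KK n) n"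
      by (rule four_point_aux[OF sfx M1(3) v lz])
    then show ?thesis unfolding len dist by linarith
  next
    case 2
    then have sfx: "suffix M2 (stack n x')" using M1(1) suffix_order.trans by blast
    obtain v where v: "weq KL (y' @ v) z'" "length v = wlen KL (winv y' @ z')" "length (y' @ v) \<le> c n"
      using path[of y'] y' r by auto
    have "length x' = wlen KL x'" using x'(2) len by simp
    then have "wlen KL (winv y' @ x') + wlen KL z' \<le> wlen KL (winv y' @ z') + wlen KL x' + 2 * diam (KK n) n"
      by (rule four_point_aux[OF sfx M2(3) v lz])
    then show ?thesis unfolding len dist by linarith
  qed
qed

end

section \<open>The word metric\<close>

context trivial_words
begin

abbreviation "gens \<equiv> {wcode K [La], wcode K [Lt]}"

lemma word_length_wgroup: "word_length (wgroup K) gens (wcode K w) = wlen K w"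
proof -
  have S: "gens \<union> m_inv (wgroup K) ` gens = range (\<lambda>l. wcode K [l])"
  proof (intro equalityI subsetI)
    fix x assume "x \<in> range (\<lambda>l. wcode K [l])"
    then obtain l where l: "x = wcode K [l]" by blast
    show "x \<in> gens \<union> m_inv (wgroup K) ` gens"
      by (cases l) (auto simp: l)
  qed auto
  have fold: "foldr (\<otimes>\<^bsub>wgroup K\<^esub>) (map (\<lambda>l. wcode K [l]) v) \<one>\<^bsub>wgroup K\<^esub> = wcode K v" for v
    by (induction v) auto
  have "(\<exists>xs. length xs = n \<and> set xs \<subseteq> range (\<lambda>l. wcode K [l]) \<and>
      foldr (\<otimes>\<^bsub>wgroup K\<^esub>) xs \<one>\<^bsub>wgroup K\<^esub> = wcode K w) \<longleftrightarrow> (\<exists>v. length v = n \<and> weq K v w)" for n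
  proof
    assume "\<exists>xs. length xs = n \<and> set xs \<subseteq> range (\<lambda>l. wcode K [l]) \<and>
      foldr (\<otimes>\<^bsub>wgroup K\<^esub>) xs \<one>\<^bsub>wgroup K\<^esub> = wcode K w"
    then obtain xs where xs: "length xs = n" "set xs \<subseteq> range (\<lambda>l. wcode K [l])"
      "foldr (\<otimes>\<^bsub>wgroup K\<^esub>) xs \<one>\<^bsub>wgroup K\<^esub> = wcode K w" by blast
    obtain v where v: "xs = map (\<lambda>l. wcode K [l]) v"
      using xs(2) ex_map_conv[of xs "\<lambda>l. wcode K [l]"] by blast
    then have "weq K v w" using xs(3) fold wcode_eq_iff by metis
    then show "\<exists>v. length v = n \<and> weq K v w" using v xs(1) by auto
  next
    assume "\<exists>v. length v = n \<and> weq K v w"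
    then obtain v where v: "length v = n" "weq K v w" by blast
    then have "foldr (\<otimes>\<^bsub>wgroup K\<^esub>) (map (\<lambda>l. wcode K [l]) v) \<one>\<^bsub>wgroup K\<^esub> = wcode K w"
      unfolding fold wcode_eq_iff by simp
    then show "\<exists>xs. length xs = n \<and> set xs \<subseteq> range (\<lambda>l. wcode K [l]) \<and>
      foldr (\<otimes>\<^bsub>wgroup K\<^esub>) xs \<one>\<^bsub>wgroup K\<^esub> = wcode K w"
      using v(1) by (intro exI[of _ "map (\<lambda>l. wcode K [l]) v"]) auto
  qed
  then show ?thesis unfolding word_length_def S wlen_def by simp
qed

lemma word_dist_wgroup: "word_dist (wgroup K) gens (wcode K u) (wcode K v) = real (wlen K (winv u @ v))"
  by (simp add: word_dist_def word_length_wgroup)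

lemma wlen_Nil: "w \<in> K \<Longrightarrow> wlen K w = 0"
  using wlen_le[of K "[]" w] weq_sym weq_Nil_iff by fastforce

lemma wlen_triangle: "wlen K (winv u @ w) \<le> wlen K (winv u @ v) + wlen K (winv v @ w)"
proof -
  have "weq K ((winv u @ v) @ (winv v @ w)) (winv u @ w)"
    using weq_cancel(2)[of "winv u" v w] by simp
  from wlen_cong[OF this] show ?thesis using wlen_append[of K "winv u @ v" "winv v @ w"] by simp
qed

lemma wlen_commute: "wlen K (winv u @ v) = wlen K (winv v @ u)"
  using wlen_winv[of "winv u @ v"] by simp

lemma wlen_take:
  assumes v: "length v = wlen K v" and ij: "i \<le> j" "j \<le> length v"
  shows "wlen K (winv (take i v) @ take j v) = j - i"
proof -
  let ?m = "drop i (take j v)"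
  have "take i (take j v) @ ?m = take j v" by (rule append_take_drop_id)
  moreover have "take i (take j v) = take i v" using ij by (simp add: min_def)
  ultimately have tj: "take j v = take i v @ ?m" by simp
  have "weq K (winv (take i v) @ take i v @ ?m) ?m" using weq_cancel(1)[of "[]" "take i v" ?m] by simp
  then have e: "wlen K (winv (take i v) @ take j v) = wlen K ?m" using wlen_cong tj by metis
  have "wlen K ?m \<le> length ?m" by (rule wlen_le) (rule weq_refl)
  moreover have "length v \<le> i + wlen K ?m + (length v - j)"
  proof -
    have "v = (take i v @ ?m) @ drop j v" using tj append_take_drop_id[of j v] by metis
    then have "wlen K v \<le> wlen K (take i v) + wlen K ?m + wlen K (drop j v)"
      using wlen_append[of K "take i v @ ?m" "drop j v"] wlen_append[of K "take i v" ?m] by simp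
    moreover have "wlen K (take i v) \<le> length (take i v)" "wlen K (drop j v) \<le> length (drop j v)"
      by (rule wlen_le, rule weq_refl)+
    ultimately show ?thesis using v ij by simp
  qed
  ultimately show ?thesis using e ij by simp
qed

end

text \<open>The diameter at stage \<open>n\<close> depends only on the earlier values of
  \<open>c\<close>, so the recursion carries the pair of \<open>tower c n\<close> and
  \<open>d n\<close>. The factor \<open>n + 1\<close> makes the diameter small against
  \<open>d n\<close>. In \<open>c n\<close>, 6 is 3 from \<open>four_point\<close> times 2 for a
  change of base point, \<open>n * d n\<close> is the radius from \<open>real_tree_cone\<close>, and
  the summand 1 gives positivity.\<close>

lemma ex_scales:
  "\<exists>c d. (\<forall>n. c n = 6 * n * d n + 1) \<and> mono d \<and> (\<forall>n. (n + 1) * (diam (tower c n) n + 1) \<le> d n)"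
proof -
  define s where "s = rec_nat (K0, diam K0 0 + 1) (\<lambda>n (K, d).
    let K' = nxt K n (6 * n * d + 1) in (K', d + (n + 2) * (diam K' (Suc n) + 1)))"
  define d where "d n = snd (s n)" for n
  define c where "c n = 6 * n * d n + 1" for n
  have s_Suc: "s (Suc n) = (nxt (fst (s n)) n (c n), d n + (n + 2) * (diam (fst (s (Suc n))) (Suc n) + 1))" for n
    by (simp add: s_def d_def c_def case_prod_beta Let_def)
  have tow: "tower c n = fst (s n)" for n
  proof (induction n)
    case (Suc n)
    then show ?case by (subst s_Suc) simp
  qed (simp add: s_def)
  have d_Suc: "d (Suc n) = d n + (n + 2) * (diam (tower c (Suc n)) (Suc n) + 1)" for n
    unfolding tow d_def by (subst s_Suc) (simp add: d_def)
  have "mono d" by (rule incseq_SucI) (simp add: d_Suc)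
  moreover have "(n + 1) * (diam (tower c n) n + 1) \<le> d n" for n
  proof (cases n)
    case 0
    then show ?thesis by (simp add: tow d_def s_def)
  next
    case (Suc m)
    then show ?thesis using d_Suc[of m] by simp
  qed
  ultimately show ?thesis using c_def by blast
qed

context positive_tower
begin

abbreviation "G \<equiv> wgroup KL"

lemma lacunary_hyperbolic_wgroup:
  assumes cd: "\<And>n. c n = 6 * n * d n + 1" and mono: "mono d"
    and diam: "\<And>n. (n + 1) * (diam (KK n) n + 1) \<le> d n"
  shows "lacunary_hyperbolic G"
proof -
  obtain \<omega> where \<omega>: "nonprincipal_ultrafilter \<omega>" using ex_nonprincipal_ultrafilter by blast
  have dn: "n + 1 \<le> d n" for n using diam[of n] by (metis add_leE mult_Suc_right Suc_eq_plus1)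
  have sc: "scaling_sequence (\<lambda>n. real (d n))"
    unfolding scaling_sequence_def
  proof (intro conjI allI notI)
    show "real (d n) > 0" for n using dn[of n] by simp
    show "mono (\<lambda>n. real (d n))" using mono by (simp add: mono_def)
    assume "bdd_above (range (\<lambda>n. real (d n)))"
    then obtain B where B: "\<And>n. real (d n) \<le> B" unfolding bdd_above_def by blast
    obtain n where "B < real n" using reals_Archimedean2 by blast
    then show False using B[of n] dn[of n] by linarith
  qed
  let ?S = "{wcode KL [La], wcode KL [Lt]}"
  have "real_tree (cone G ?S \<omega> (\<lambda>n. real (d n))) (cone_dist G ?S \<omega> (\<lambda>n. real (d n)))"
  proof (rule real_tree_cone[OF \<omega> sc, where e = "\<lambda>n. real (2 * diam (KK n) n)"])
    show "\<one>\<^bsub>G\<^esub> \<in> carrier G" by simp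
  next
    fix x assume "x \<in> carrier G"
    then obtain a where a: "x = wcode KL a" by (rule wgroup_cases)
    have "winv a @ a \<in> KL" using L.winv_left L.weq_Nil_iff by blast
    then show "word_dist G ?S x x = 0" unfolding a L.word_dist_wgroup by (simp add: L.wlen_Nil)
  next
    fix x y assume "x \<in> carrier G" "y \<in> carrier G"
    then obtain a b where "x = wcode KL a" "y = wcode KL b" by (auto elim!: wgroup_cases)
    then show "word_dist G ?S x y = word_dist G ?S y x"
      using L.wlen_commute[of a b] by (simp add: L.word_dist_wgroup)
  next
    fix x y z assume "x \<in> carrier G" "y \<in> carrier G" "z \<in> carrier G"
    then obtain a b e where "x = wcode KL a" "y = wcode KL b" "z = wcode KL e" by (auto elim!: wgroup_cases)
    then show "word_dist G ?S x z \<le> word_dist G ?S x y + word_dist G ?S y z"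
      using L.wlen_triangle[of a e b] by (simp add: L.word_dist_wgroup)
  next
    fix x y assume "x \<in> carrier G" "y \<in> carrier G"
    then obtain a b where xy: "x = wcode KL a" "y = wcode KL b" by (auto elim!: wgroup_cases)
    obtain v where v: "weq KL v (winv a @ b)" "length v = wlen KL (winv a @ b)" by (rule wlen_geodesic)
    have lv: "length v = wlen KL v" using v wlen_cong by metis
    have D: "word_dist G ?S (wcode KL (a @ take i v)) (wcode KL (a @ take j v)) = \<bar>real i - real j\<bar>"
      if "i \<le> length v" "j \<le> length v" for i j
    proof -
      have "weq KL (winv (a @ take i v) @ a @ take j v) (winv (take i v) @ take j v)"
        using L.weq_cancel(1)[of "winv (take i v)" a "take j v"] by simp
      then have e: "wlen KL (winv (a @ take i v) @ a @ take j v) = wlen KL (winv (take i v) @ take j v)"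
        by (rule wlen_cong)
      show ?thesis
      proof (cases "i \<le> j")
        case True
        then show ?thesis using e L.wlen_take[OF lv True that(2)] by (simp add: L.word_dist_wgroup)
      next
        case False
        then have "j \<le> i" by simp
        then show ?thesis using e L.wlen_take[OF lv _ that(1), of j] L.wlen_commute[of "take i v" "take j v"]
          by (simp add: L.word_dist_wgroup)
      qed
    qed
    have "wcode KL (a @ take (length v) v) = y"
      using v(1) by (simp add: xy wcode_eq_iff L.weq_solve_left)
    then show "\<exists>p N. p 0 = x \<and> p N = y \<and> (\<forall>i\<le>N. p i \<in> carrier G) \<and>
        (\<forall>i\<le>N. \<forall>j\<le>N. word_dist G ?S (p i) (p j) = \<bar>real i - real j\<bar>)"
      using D by (intro exI[of _ "\<lambda>i. wcode KL (a @ take i v)"] exI[of _ "length v"]) (auto simp: xy)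
  next
    fix n x y z w
    assume car: "x \<in> carrier G" "y \<in> carrier G" "z \<in> carrier G" "w \<in> carrier G"
      and near: "\<forall>v\<in>{x, y, z, w}. word_dist G ?S \<one>\<^bsub>G\<^esub> v \<le> real n * real (d n)"
    obtain p q r s where words: "x = wcode KL p" "y = wcode KL q" "z = wcode KL r" "w = wcode KL s"
      using car by (auto elim!: wgroup_cases)
    have norm: "wlen KL u \<le> n * d n" if "wcode KL u \<in> {x, y, z, w}" for u
    proof -
      have "word_dist G ?S (wcode KL []) (wcode KL u) \<le> real (n * d n)" using near that by auto
      then show ?thesis unfolding L.word_dist_wgroup of_nat_le_iff by simp
    qed
    \<comment> \<open>Left translation by the inverse of \<open>w\<close> turns the fourth point
      into 1, as \<open>four_point\<close> requires, and at most doubles the radius.\<close>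
    have near_s: "wlen KL (winv s @ u) \<le> 2 * n * d n" if "wcode KL u \<in> {x, y, z, w}" for u
      using wlen_append[of KL "winv s" u] norm[OF that] norm[of s] words L.wlen_winv[of s] by simp
    have sub: "wlen KL (winv (winv s @ u) @ (winv s @ v)) = wlen KL (winv u @ v)" for u v
      using L.weq_cancel(2)[of "winv u" s v] by (intro wlen_cong) simp
    have "wlen KL (winv (winv s @ p) @ (winv s @ q)) + wlen KL (winv s @ r) \<le>
      max (wlen KL (winv (winv s @ p) @ (winv s @ r)) + wlen KL (winv s @ q))
        (wlen KL (winv (winv s @ q) @ (winv s @ r)) + wlen KL (winv s @ p)) + 2 * diam (KK n) n"
    proof (rule four_point)
      show "3 * (2 * n * d n) \<le> c n" by (simp add: cd)
    qed (rule near_s; simp add: words)+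
    then have ineq: "wlen KL (winv p @ q) + wlen KL (winv s @ r) \<le>
      max (wlen KL (winv p @ r) + wlen KL (winv s @ q)) (wlen KL (winv q @ r) + wlen KL (winv s @ p))
        + 2 * diam (KK n) n"
      by (simp only: sub)
    show "word_dist G ?S x y + word_dist G ?S z w \<le>
      max (word_dist G ?S x z + word_dist G ?S y w) (word_dist G ?S y z + word_dist G ?S x w)
        + real (2 * diam (KK n) n)"
      using ineq L.wlen_commute[of s r] L.wlen_commute[of s q] L.wlen_commute[of s p]
      unfolding words L.word_dist_wgroup by linarith
  next
    have lim: "(\<lambda>n. 2 / (real n + 1)) \<longlonglongrightarrow> 0" by real_asymp
    have bound: "real (2 * diam (KK n) n) / real (d n) \<le> 2 / (real n + 1)" for n
    proof -
      have "(n + 1) * diam (KK n) n \<le> d n" using diam[of n] by (simp add: algebra_simps)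
      then have "real ((n + 1) * diam (KK n) n) \<le> real (d n)" by (simp only: of_nat_le_iff)
      then show ?thesis using dn[of n] by (simp add: field_simps)
    qed
    show "(\<lambda>n. real (2 * diam (KK n) n) / real (d n)) \<longlonglongrightarrow> 0"
    proof (rule tendsto_sandwich[OF _ _ tendsto_const lim])
      show "\<forall>\<^sub>F n in sequentially. 0 \<le> real (2 * diam (KK n) n) / real (d n)" by simp
      show "\<forall>\<^sub>F n in sequentially. real (2 * diam (KK n) n) / real (d n) \<le> 2 / (real n + 1)"
        by (rule always_eventually) (rule allI, rule bound)
    qed
  qed
  then show ?thesis
    unfolding lacunary_hyperbolic_def
    using L.group_wgroup L.generate_wgroup \<omega> sc
    by (intro conjI exI[of _ ?S] exI[of _ \<omega>] exI[of _ "\<lambda>n. real (d n)"]) auto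
qed

end

section \<open>Words of exponent zero\<close>

text \<open>The case \<open>m = 0\<close> gives the infinite cyclic quotient, powers of two give the
  finite cyclic quotients for residual finiteness.\<close>

lemma KE_trivial_words: "trivial_words {w. m dvd expo w}"
proof
  show "u @ w @ v \<in> {w. m dvd expo w} \<longleftrightarrow> u @ v \<in> {w. m dvd expo w}" if "w \<in> {w. m dvd expo w}" for u w v
  proof -
    have "expo (u @ w @ v) = expo w + expo (u @ v)" by simp
    then show ?thesis using that by (metis dvd_add_right_iff mem_Collect_eq)
  qed
  show "[l, linv l] \<in> {w. m dvd expo w}" for l by simp
qed simp

abbreviation "KZ \<equiv> {w. expo w = 0}"

lemma KZ_trivial_words: "trivial_words KZ"
  using KE_trivial_words[of 0] by simp

lemma weq_KZ: "weq KZ u v \<longleftrightarrow> expo u = expo v"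
proof -
  interpret trivial_words KZ by (rule KZ_trivial_words)
  show ?thesis unfolding weq_iff by auto
qed

lemma wgroup_KZ: "comm_group (wgroup KZ)" "wgroup KZ \<cong> integer_group"
proof -
  interpret trivial_words KZ by (rule KZ_trivial_words)
  show "comm_group (wgroup KZ)"
    by (rule wg.group_comm_groupI) (auto simp: wcode_eq_iff weq_KZ elim!: wgroup_cases)
  define h where "h n = expo (from_nat n)" for n :: nat
  have h: "h (wcode KZ w) = expo w" for w using weq_wcode[of KZ w] by (simp add: h_def weq_KZ)
  have "h \<in> hom (wgroup KZ) integer_group" by (auto simp: hom_def h elim!: wgroup_cases)
  moreover have "bij_betw h (carrier (wgroup KZ)) (carrier integer_group)"
  proof (rule bij_betw_imageI)
    show "inj_on h (carrier (wgroup KZ))"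
      by (auto simp: inj_on_def h wcode_eq_iff weq_KZ carrier_wgroup)
    have "\<exists>w. expo w = i" for i
    proof (cases i)
      case (nonneg n)
      then show ?thesis using expo_wpow[of "[Lt]" n] by (intro exI[of _ "wpow [Lt] n"]) simp
    next
      case (neg n)
      then show ?thesis using expo_wpow[of "[Li]" "Suc n"] by (intro exI[of _ "wpow [Li] (Suc n)"]) simp
    qed
    then show "h ` carrier (wgroup KZ) = carrier integer_group"
      by (auto simp: carrier_wgroup image_image h) (metis rangeI)
  qed
  ultimately show "wgroup KZ \<cong> integer_group" unfolding is_iso_def iso_def by blast
qed

abbreviation tconj :: "nat \<Rightarrow> letter list \<Rightarrow> letter list" where
  "tconj m w \<equiv> replicate m Lt @ w @ replicate m Li"

text \<open>The subgroup generated by t^i a t^-i with -m \<le> i \<le> m. Conjugation by t^m makes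
  all indices natural numbers, as in \<open>aw\<close>.\<close>

definition window :: "letter list set \<Rightarrow> nat \<Rightarrow> letter list set" where
  "window K m = {w. \<exists>q\<in>aprods {0..2 * m}. weq K (tconj m w) q}"

lemma winv_replicate: "winv (replicate m Lt) = replicate m Li"
  by (simp add: winv_def)

context trivial_words
begin

lemma tconj_append: "weq K (tconj m (u @ v)) (tconj m u @ tconj m v)"
  using weq_sym[OF weq_cancel(1)[of "replicate m Lt @ u" "replicate m Lt" "v @ replicate m Li"]]
  by (simp add: winv_replicate)


lemma weq_tconjD: "weq K (tconj m u) v \<Longrightarrow> weq K u (replicate m Li @ v @ replicate m Lt)"
  using weq_solve_left[of "replicate m Lt" "u @ replicate m Li" v]
    weq_solve_right[of u "replicate m Li" "replicate m Li @ v"]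
  by (simp add: winv_replicate) (simp add: winv_def)

lemma window_Nil: "[] \<in> window K m"
proof -
  have "weq K (tconj m []) []" using winv_right[of "replicate m Lt"] by (simp add: winv_replicate)
  then show ?thesis using aprods_Nil by (auto simp: window_def)
qed

lemma window_append: "u \<in> window K m \<Longrightarrow> v \<in> window K m \<Longrightarrow> u @ v \<in> window K m"
proof -
  assume "u \<in> window K m" "v \<in> window K m"
  then obtain p q where pq: "p \<in> aprods {0..2 * m}" "weq K (tconj m u) p"
    "q \<in> aprods {0..2 * m}" "weq K (tconj m v) q" by (auto simp: window_def)
  have "weq K (tconj m (u @ v)) (p @ q)"
    by (rule weq_trans[OF tconj_append]) (intro weq_append[OF pq(2,4)])
  then show ?thesis using aprods_append[OF pq(1,3)] unfolding window_def by blast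
qed

lemma window_winv: "u \<in> window K m \<Longrightarrow> winv u \<in> window K m"
proof -
  assume "u \<in> window K m"
  then obtain p where p: "p \<in> aprods {0..2 * m}" "weq K (tconj m u) p" by (auto simp: window_def)
  have "weq K (winv (tconj m u)) (winv p)" by (rule weq_winv[OF p(2)])
  then have "weq K (tconj m (winv u)) (winv p)" by (simp add: winv_def)
  then show ?thesis using aprods_winv[OF p(1)] unfolding window_def by blast
qed

lemma window_mono: "m \<le> m' \<Longrightarrow> window K m \<subseteq> window K m'"
proof (rule lift_Suc_mono_le[of "window K"])
  fix m show "window K m \<subseteq> window K (Suc m)"
  proof
    fix w assume "w \<in> window K m"
    then obtain q where q: "q \<in> aprods {0..2 * m}" "weq K (tconj m w) q" by (auto simp: window_def)
    obtain q' where q': "q' \<in> aprods (Suc ` {0..2 * m})" "weq K ([Lt] @ q @ [Li]) q'"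
      using aprods_shift_up[OF q(1)] by blast
    have "weq K ([Lt] @ tconj m w @ [Li]) ([Lt] @ q @ [Li])" by (intro weq_append weq_refl q)
    from weq_trans[OF this q'(2)] have "weq K (tconj (Suc m) w) q'" by (simp add: replicate_append_same)
    moreover have "q' \<in> aprods {0..2 * Suc m}"
      using q'(1) aprods_mono[of "Suc ` {0..2 * m}" "{0..2 * Suc m}"] by auto
    ultimately show "w \<in> window K (Suc m)" by (auto simp: window_def)
  qed
qed

lemma subgroup_window: "subgroup (wcode K ` window K m) (wgroup K)"
  using window_Nil window_append window_winv by (rule subgroup_words)

text \<open>All letters \<open>t\<close> are moved to the right: after t^m and a prefix
  \<open>v\<close>, a letter \<open>a\<close> becomes the factor \<open>aw k\<close> with
  \<open>k = m + expo v\<close>. For \<open>m = length w\<close> this height stays between 0 and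
  \<open>2 * m\<close>.\<close>

lemma expo_zero_window:
  assumes "expo w = 0"
  shows "w \<in> window K (length w)"
proof -
  let ?m = "length w"
  have "\<bar>expo v\<bar> \<le> int (length v) \<and>
      (\<exists>q\<in>aprods {0..2 * ?m}. weq K (replicate ?m Lt @ v) (q @ replicate (nat (int ?m + expo v)) Lt))"
    if "length v \<le> ?m" for v
    using that
  proof (induction v rule: rev_induct)
    case Nil
    show ?case using aprods_Nil weq_refl by (intro conjI bexI[of _ "[]"]) auto
  next
    case (snoc l v)
    define k where "k = nat (int ?m + expo v)"
    have bd: "\<bar>expo v\<bar> \<le> int (length v)" using snoc by simp
    obtain q where q: "q \<in> aprods {0..2 * ?m}" "weq K (replicate ?m Lt @ v) (q @ replicate k Lt)"
      using snoc unfolding k_def by auto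
    have k: "int k = int ?m + expo v" "k \<le> 2 * ?m" using bd snoc.prems by (auto simp: k_def)
    have "weq K ((replicate ?m Lt @ v) @ [l]) ((q @ replicate k Lt) @ [l])"
      by (intro weq_append weq_refl q)
    then have step: "weq K (replicate ?m Lt @ v @ [l]) (q @ replicate k Lt @ [l])" by simp
    show ?case
    proof (cases l)
      case La
      have "weq K ((q @ replicate k Lt @ [La]) @ winv (replicate k Lt) @ replicate k Lt) ((q @ replicate k Lt @ [La]) @ [])"
        by (intro weq_append weq_refl winv_left)
      then have "weq K (q @ replicate k Lt @ [La]) ((q @ aw k) @ replicate k Lt)"
        using weq_sym by (simp add: aw_def winv_replicate)
      then have "weq K (replicate ?m Lt @ v @ [l]) ((q @ aw k) @ replicate k Lt)"
        using step La weq_trans by blast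
      moreover have "q @ aw k \<in> aprods {0..2 * ?m}" using q(1) k(2) by (intro aprods_append aw_aprods) auto
      moreover have "nat (int ?m + expo (v @ [l])) = k" using La by (simp add: k_def)
      moreover have "\<bar>expo (v @ [l])\<bar> \<le> int (length (v @ [l]))" using La bd by simp
      ultimately show ?thesis by metis
    next
      case Lt
      have "nat (int ?m + expo (v @ [l])) = Suc k" using k Lt by simp
      moreover have "weq K (replicate ?m Lt @ v @ [l]) (q @ replicate (Suc k) Lt)"
        using step Lt by (simp add: replicate_append_same)
      moreover have "\<bar>expo (v @ [l])\<bar> \<le> int (length (v @ [l]))" using Lt bd by simp
      ultimately show ?thesis using q(1) by metis
    next
      case Li
      have "int k > 0" using k(1) bd snoc.prems by simp
      then obtain j where j: "k = Suc j" by (cases k) auto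
      then have nat: "nat (int ?m + expo (v @ [l])) = j" using k Li by simp
      have "q @ replicate k Lt @ [l] = (q @ replicate j Lt) @ [Lt] @ [Li]"
        using j Li by (simp add: replicate_append_same[symmetric])
      moreover have "weq K ((q @ replicate j Lt) @ [Lt] @ [Li]) (q @ replicate j Lt)"
        using weq_cancel(2)[of "q @ replicate j Lt" "[Lt]" "[]"] by simp
      ultimately have "weq K (replicate ?m Lt @ v @ [l]) (q @ replicate j Lt)"
        using weq_trans[OF step] by simp
      moreover have "\<bar>expo (v @ [l])\<bar> \<le> int (length (v @ [l]))" using Li bd by simp
      ultimately show ?thesis using q(1) nat by metis
    qed
  qed
  from this[of w] obtain q where q: "q \<in> aprods {0..2 * ?m}" "weq K (replicate ?m Lt @ w) (q @ replicate ?m Lt)"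
    using assms by auto
  have "weq K ((replicate ?m Lt @ w) @ replicate ?m Li) ((q @ replicate ?m Lt) @ replicate ?m Li)"
    by (intro weq_append weq_refl q)
  also have "weq K ((q @ replicate ?m Lt) @ replicate ?m Li) q"
    using weq_cancel(2)[of q "replicate ?m Lt" "[]"] by (simp add: winv_replicate)
  finally show ?thesis using q(1) by (auto simp: window_def)
qed

end

lemma p_group_subgroupI:
  assumes p: "Factorial_Ring.prime p" and G: "group G" and H: "subgroup H G"
    and pow: "\<And>x. x \<in> H \<Longrightarrow> \<exists>k. x [^]\<^bsub>G\<^esub> (p ^ k) = \<one>\<^bsub>G\<^esub>"
  shows "p_group p (G\<lparr>carrier := H\<rparr>)"
proof -
  interpret group G by (rule G)
  interpret H: group "G\<lparr>carrier := H\<rparr>" by (rule subgroup_imp_group[OF H])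
  show ?thesis
    by (rule H.p_groupI[OF p]) (use pow nat_pow_consistent in auto)
qed

context positive_tower
begin

lemma expo_KL: "weq KL u v \<Longrightarrow> expo u = expo v"
proof -
  assume "weq KL u v"
  then have "winv u @ v \<in> KL" by (simp add: L.weq_iff)
  then show ?thesis by (simp add: tower_limit_def)
qed

lemma window_KL_expo: "w \<in> window KL m \<Longrightarrow> expo w = 0"
proof -
  assume "w \<in> window KL m"
  then obtain q where q: "q \<in> aprods {0..2 * m}" "weq KL (tconj m w) q" by (auto simp: window_def)
  have "expo (tconj m w) = expo w" using expo_winv[of "replicate m Lt"] by (simp add: winv_replicate)
  then show ?thesis using expo_KL[OF q(2)] expo_aprods[OF q(1)] by simp
qed

lemma Union_window: "(\<Union>m. window KL m) = KZ"
  using window_KL_expo L.expo_zero_window by auto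

text \<open>On these products the map to stage \<open>n\<close> is injective by
  \<open>aprods_weq_KL\<close>, and stage \<open>n\<close> is finite.\<close>

lemma finite_aprods_KL: "finite (wcode KL ` aprods {0..n})"
proof -
  define h where "h x = wcode (KK n) (from_nat x)" for x
  have h: "h (wcode KL w) = wcode (KK n) w" for w
    unfolding h_def wcode_eq_iff by (rule weq_KK[OF weq_wcode])
  have "h ` wcode KL ` aprods {0..n} \<subseteq> range (wcode (KK n))" by (auto simp: h)
  then have "finite (h ` wcode KL ` aprods {0..n})" using finite_KK finite_subset by blast
  moreover have "inj_on h (wcode KL ` aprods {0..n})"
    using aprods_weq_KL by (auto simp: inj_on_def h wcode_eq_iff)
  ultimately show ?thesis by (rule finite_imageD)
qed

lemma finite_window: "finite (wcode KL ` window KL m)"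
proof -
  let ?f = "\<lambda>x. wcode KL (replicate m Li @ from_nat x @ replicate m Lt)"
  have "wcode KL w \<in> ?f ` wcode KL ` aprods {0..2 * m}" if "w \<in> window KL m" for w
  proof -
    obtain q where q: "q \<in> aprods {0..2 * m}" "weq KL (tconj m w) q" using \<open>w \<in> window KL m\<close> by (auto simp: window_def)
    have "weq KL w (replicate m Li @ q @ replicate m Lt)" by (rule L.weq_tconjD[OF q(2)])
    also have "weq KL (replicate m Li @ q @ replicate m Lt) (replicate m Li @ from_nat (wcode KL q) @ replicate m Lt)"
      by (intro weq_append weq_refl weq_sym[OF weq_wcode])
    finally have "wcode KL w = ?f (wcode KL q)" by (simp add: wcode_eq_iff)
    then show ?thesis using q(1) by blast
  qed
  then have "wcode KL ` window KL m \<subseteq> ?f ` wcode KL ` aprods {0..2 * m}" by blast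
  then show ?thesis using finite_aprods_KL finite_subset by blast
qed

text \<open>A conjugate of the word is a product with indices up to \<open>2 * m\<close>. Stage
  \<open>2 * m\<close> has finite exponent, and a product that is trivial there is trivial in the
  limit.\<close>

lemma torsion:
  assumes "expo w = 0"
  shows "\<exists>k. wpow w (2 ^ k) \<in> KL"
proof -
  let ?m = "length w"
  obtain q where q: "q \<in> aprods {0..2 * ?m}" "weq KL (tconj ?m w) q"
    using L.expo_zero_window[OF assms] by (auto simp: window_def)
  obtain k where "\<And>w. wpow w (2 ^ k) \<in> KK (2 * ?m)" using exponent_KK by blast
  then have "wpow q (2 ^ k) \<in> KL" by (intro aprods_KL[OF aprods_wpow[OF q(1)]])
  have "weq KL (tconj ?m (wpow w j)) (wpow q j)" for j
  proof (induction j)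
    case 0
    show ?case using L.winv_right[of "replicate ?m Lt"] by (simp add: winv_replicate)
  next
    case (Suc j)
    have "weq KL (tconj ?m (w @ wpow w j)) (tconj ?m w @ tconj ?m (wpow w j))" by (rule L.tconj_append)
    also have "weq KL (tconj ?m w @ tconj ?m (wpow w j)) (q @ wpow q j)" by (rule weq_append[OF q(2) Suc])
    finally show ?case by simp
  qed
  also have "weq KL (wpow q (2 ^ k)) []" using \<open>wpow q (2 ^ k) \<in> KL\<close> by (simp add: L.weq_Nil_iff)
  finally have "weq KL (wpow w (2 ^ k)) (replicate ?m Li @ [] @ replicate ?m Lt)"
    by (rule L.weq_tconjD)
  also have "weq KL (replicate ?m Li @ [] @ replicate ?m Lt) []"
    using L.winv_left[of "replicate ?m Lt"] by (simp add: winv_replicate)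
  finally have "wpow w (2 ^ k) \<in> KL" by (simp add: L.weq_Nil_iff)
  then show ?thesis by blast
qed

section \<open>The locally finite kernel of the exponent map\<close>

abbreviation "N \<equiv> wcode KL ` KZ"

lemma N_normal: "N \<lhd> G" and G_Mod_N: "G Mod N \<cong> wgroup KZ"
  using wgroup_quotient[OF KL_trivial_words KZ_trivial_words] by (auto simp: tower_limit_def)

lemma N_subgroup: "subgroup N G"
  by (rule normal_imp_subgroup[OF N_normal])

lemma p_group_in_N:
  assumes H: "subgroup H G" "H \<subseteq> N"
  shows "p_group 2 (G\<lparr>carrier := H\<rparr>)"
proof (rule p_group_subgroupI[OF two_is_prime_nat L.group_wgroup H(1)])
  fix x assume "x \<in> H"
  then obtain w where w: "x = wcode KL w" "expo w = 0" using H(2) by auto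
  obtain k where "wpow w (2 ^ k) \<in> KL" using torsion[OF w(2)] by blast
  then have "x [^]\<^bsub>G\<^esub> ((2::nat) ^ k) = \<one>\<^bsub>G\<^esub>"
    by (simp add: w(1) wcode_eq_iff L.weq_Nil_iff)
  then show "\<exists>k. x [^]\<^bsub>G\<^esub> ((2::nat) ^ k) = \<one>\<^bsub>G\<^esub>" by blast
qed

lemma N_eq_Union: "N = (\<Union>m. wcode KL ` window KL m)"
  unfolding Union_window[symmetric] by blast

lemma window_chain: "wcode KL ` window KL m \<subseteq> wcode KL ` window KL (max m m')"
  by (intro image_mono L.window_mono) simp

lemma finite_subset_window:
  assumes "finite S" "S \<subseteq> N"
  shows "\<exists>m. S \<subseteq> wcode KL ` window KL m"
  using assms
proof (induction rule: finite_induct)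
  case (insert x S)
  from insert.prems have "S \<subseteq> N" by (rule insert_subset[THEN iffD1, THEN conjunct2])
  then obtain m where m: "S \<subseteq> wcode KL ` window KL m" using insert.IH by (elim meta_impE exE)
  from insert.prems have "x \<in> N" by (rule insert_subset[THEN iffD1, THEN conjunct1])
  then have "x \<in> (\<Union>m. wcode KL ` window KL m)" unfolding N_eq_Union .
  then obtain m' where m': "x \<in> wcode KL ` window KL m'" by (elim UN_E)
  have "x \<in> wcode KL ` window KL (max m m')"
    using window_chain[of m' m] m' unfolding max.commute[of m m'] by (rule subsetD)
  moreover have "S \<subseteq> wcode KL ` window KL (max m m')"
    using m window_chain by (rule order_trans)
  ultimately have "insert x S \<subseteq> wcode KL ` window KL (max m m')" by (rule insert_subset[THEN iffD2, OF conjI])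
  then show ?case by (rule exI)
qed simp

text \<open>Finitely many elements of \<open>N\<close> lie in a common window, so they generate a
  finite 2-group.\<close>

lemma N_locally_nilpotent: "locally_nilpotent (G\<lparr>carrier := N\<rparr>)"
  unfolding locally_nilpotent_def
proof (intro conjI allI impI)
  show "group (G\<lparr>carrier := N\<rparr>)" by (rule L.wg.subgroup_imp_group[OF N_subgroup])
  fix H assume H: "subgroup H (G\<lparr>carrier := N\<rparr>) \<and> finitely_generated (G\<lparr>carrier := N, carrier := H\<rparr>)"
  have HN: "H \<subseteq> N" using subgroup.subset[of H "G\<lparr>carrier := N\<rparr>"] H by simp
  have HG: "subgroup H G" using L.wg.incl_subgroup[OF N_subgroup] H by blast
  obtain S where S: "finite S" "S \<subseteq> H" "generate (G\<lparr>carrier := H\<rparr>) S = H"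
    using H by (auto simp: finitely_generated_def)
  obtain m where m: "S \<subseteq> wcode KL ` window KL m" using finite_subset_window[OF S(1) order_trans[OF S(2) HN]] by (elim exE)
  have "H = generate G S" using S L.wg.generate_consistent[OF S(2) HG] by simp
  also have "\<dots> \<subseteq> wcode KL ` window KL m" by (rule L.wg.generate_subgroup_incl[OF m L.subgroup_window])
  finally have "finite H" using finite_window finite_subset by blast
  then show "nilpotent_group (G\<lparr>carrier := N, carrier := H\<rparr>)"
    using finite_p_group_nilpotent[OF two_is_prime_nat p_group_in_N[OF HG HN]] by simp
qed

text \<open>The quotient by \<open>N\<close> is abelian, and \<open>N\<close> is the increasing
  union of the finite windows.\<close>

lemma G_elementary_amenable: "elementary_amenable G"
proof (rule elementary_amenable.extension[OF N_normal])
  show "group (wgroup KZ)" "elementary_amenable (wgroup KZ)"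
    using wgroup_KZ(1) by (auto intro: elementary_amenable.abelian simp: comm_group_def)
  show "wgroup KZ \<cong> G Mod N"
    using group.iso_sym[OF normal.factorgroup_is_group[OF N_normal] G_Mod_N] .
  have sub: "subgroup (wcode KL ` window KL m) (G\<lparr>carrier := N\<rparr>)" for m
    by (rule L.wg.subgroup_incl[OF L.subgroup_window N_subgroup]) (use window_KL_expo in auto)
  show "elementary_amenable (G\<lparr>carrier := N\<rparr>)"
  proof (rule elementary_amenable.directed_union[where \<H> = "range (\<lambda>m. wcode KL ` window KL m)"])
    show g: "group (G\<lparr>carrier := N\<rparr>)" by (rule L.wg.subgroup_imp_group[OF N_subgroup])
    show "subgroup H (G\<lparr>carrier := N\<rparr>)" if "H \<in> range (\<lambda>m. wcode KL ` window KL m)" for H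
      using that sub by blast
    show "elementary_amenable (G\<lparr>carrier := N, carrier := H\<rparr>)" if Hm: "H \<in> range (\<lambda>m. wcode KL ` window KL m)" for H
    proof -
      obtain m where m: "H = wcode KL ` window KL m" using Hm by (elim rangeE)
      have "group (G\<lparr>carrier := H\<rparr>)" unfolding m by (rule L.wg.subgroup_imp_group[OF L.subgroup_window])
      then show ?thesis using finite_window m by (intro elementary_amenable.finite) auto
    qed
    show "\<exists>L\<in>range (\<lambda>m. wcode KL ` window KL m). H \<subseteq> L \<and> K \<subseteq> L"
      if HK: "H \<in> range (\<lambda>m. wcode KL ` window KL m)" "K \<in> range (\<lambda>m. wcode KL ` window KL m)" for H K
    proof -
      obtain m m' where "H = wcode KL ` window KL m" "K = wcode KL ` window KL m'" using HK by blast
      then show ?thesis using window_chain[of m m'] window_chain[of m' m] by (auto simp: max.commute)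
    qed
    show "\<Union> (range (\<lambda>m. wcode KL ` window KL m)) = carrier (G\<lparr>carrier := N\<rparr>)" using N_eq_Union by simp
  qed simp
qed

section \<open>Finite 2-quotients\<close>

lemma finite_2_quotient:
  assumes L: "trivial_words L" "KL \<subseteq> L" and fin: "finite (range (wcode L))"
    and pow: "\<And>w. wpow w (2 ^ k) \<in> L" and w: "w \<notin> L"
  shows "\<exists>M. M \<lhd> G \<and> wcode KL w \<notin> M \<and> finite (carrier (G Mod M)) \<and> p_group 2 (G Mod M)"
proof (intro exI conjI)
  let ?M = "wcode KL ` L"
  note q = wgroup_quotient[OF KL_trivial_words L]
  show M: "?M \<lhd> G" by (rule q(1))
  show "wcode KL w \<notin> ?M"
  proof
    assume "wcode KL w \<in> ?M"
    then obtain w' where "w' \<in> L" "weq KL w w'" by (auto simp: wcode_eq_iff)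
    then show False using w weq_in weq_mono[OF KL_trivial_words L] by blast
  qed
  show "finite (carrier (G Mod ?M))" using iso_finite[OF q(2)] fin by (simp add: carrier_wgroup)
  show "p_group 2 (G Mod ?M)"
  proof (rule p_group_FactGroup[OF two_is_prime_nat M])
    fix x assume "x \<in> carrier G"
    then obtain u where "x = wcode KL u" by (rule wgroup_cases)
    then have "x [^]\<^bsub>G\<^esub> ((2::nat) ^ k) \<in> ?M" using pow by simp
    then show "\<exists>k. x [^]\<^bsub>G\<^esub> ((2::nat) ^ k) \<in> ?M" by blast
  qed
qed

lemma G_residual:
  assumes "g \<in> carrier G" "g \<noteq> \<one>\<^bsub>G\<^esub>"
  shows "\<exists>M. M \<lhd> G \<and> g \<notin> M \<and> finite (carrier (G Mod M)) \<and> p_group 2 (G Mod M)"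
proof -
  obtain w where w: "g = wcode KL w" using assms(1) by (rule wgroup_cases)
  then have "w \<notin> KL" using assms(2) by (auto simp: wcode_eq_iff L.weq_Nil_iff)
  then consider n where "w \<notin> KK n" | "expo w \<noteq> 0" by (auto simp: tower_limit_def)
  then show ?thesis
  proof cases
    case 1
    obtain k where k: "\<And>w. wpow w (2 ^ k) \<in> KK n" using exponent_KK by blast
    show ?thesis unfolding w by (rule finite_2_quotient[OF st.trivial_words_axioms KL_subset finite_KK k 1])
  next
    case 2
    \<comment> \<open>With this \<open>k\<close> the modulus \<open>2 ^ k\<close> exceeds the
      absolute value of \<open>expo w\<close>, so the exponent stays nonzero modulo
      \<open>2 ^ k\<close>.\<close>
    define k where "k = nat \<bar>expo w\<bar>"
    let ?L = "{w. (2::int) ^ k dvd expo w}"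
    interpret E: trivial_words ?L by (rule KE_trivial_words)
    have "expo w < 2 ^ k \<and> - expo w < 2 ^ k"
    proof -
      have "int k < 2 ^ k" by (metis of_nat_less_two_power)
      then show ?thesis by (auto simp: k_def)
    qed
    then have "w \<notin> ?L" using 2 linorder_neqE[of "expo w" 0] zdvd_imp_le[of "2 ^ k" "expo w"] zdvd_imp_le[of "2 ^ k" "- expo w"] by auto
    moreover have "wpow v (2 ^ k) \<in> ?L" for v by (simp add: expo_wpow)
    moreover have "finite (range (wcode ?L))"
    proof -
      have "wcode ?L v \<in> (\<lambda>i. wcode ?L (wpow [Lt] i)) ` {..<2 ^ k}" for v
      proof
        let ?i = "nat (expo v mod 2 ^ k)"
        have "(2::int) ^ k dvd expo v mod 2 ^ k - expo v" by (metis mod_eq_dvd_iff mod_mod_trivial)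
        then have "winv v @ wpow [Lt] ?i \<in> ?L" by (simp add: expo_wpow)
        then show "wcode ?L v = wcode ?L (wpow [Lt] ?i)" by (simp add: wcode_eq_iff E.weq_iff)
        show "?i \<in> {..<2 ^ k}" by (simp add: nat_less_iff)
      qed
      then have "range (wcode ?L) \<subseteq> (\<lambda>i. wcode ?L (wpow [Lt] i)) ` {..<2 ^ k}" by blast
      then show ?thesis by (rule finite_subset) simp
    qed
    moreover have "KL \<subseteq> ?L" by (auto simp: tower_limit_def)
    ultimately show ?thesis unfolding w by (intro finite_2_quotient[OF E.trivial_words_axioms])
  qed
qed

text \<open>Infinitely many elements \<open>aw i\<close> fall into one coset of \<open>H\<close>,
  and their quotients make the intersection of \<open>H\<close> with \<open>N\<close> infinite. But
  a cyclic \<open>H\<close> meets \<open>N\<close> in a finite group: if its generator has exponent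
  zero, \<open>H\<close> lies in a finite window, and otherwise the intersection is trivial.\<close>

lemma not_virtually_cyclic: "\<not> virtually_cyclic G"
proof
  assume "virtually_cyclic G"
  then obtain H where H: "subgroup H G" "cyclic_group (G\<lparr>carrier := H\<rparr>)" "finite (rcosets\<^bsub>G\<^esub> H)"
    by (auto simp: virtually_cyclic_def)
  let ?A = "(\<lambda>i. wcode KL (aw i)) ` {1..}"
  have inf: "infinite ?A" using finite_imageD[OF _ inj_aw] infinite_Ici by blast
  have A: "?A \<subseteq> carrier G" by auto
  have "(\<lambda>a. H #>\<^bsub>G\<^esub> a) ` ?A \<subseteq> rcosets\<^bsub>G\<^esub> H" using A by (auto simp: RCOSETS_def)
  then have "finite ((\<lambda>a. H #>\<^bsub>G\<^esub> a) ` ?A)" using H(3) finite_subset by blast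
  then obtain a where a: "a \<in> ?A" "infinite {b \<in> ?A. H #>\<^bsub>G\<^esub> b = H #>\<^bsub>G\<^esub> a}"
    using pigeonhole_infinite[OF inf] by blast
  let ?B = "{b \<in> ?A. H #>\<^bsub>G\<^esub> b = H #>\<^bsub>G\<^esub> a}"
  let ?C = "(\<lambda>b. b \<otimes>\<^bsub>G\<^esub> inv\<^bsub>G\<^esub> a) ` ?B"
  have aG: "a \<in> carrier G" using a A by blast
  have "inj_on (\<lambda>b. b \<otimes>\<^bsub>G\<^esub> inv\<^bsub>G\<^esub> a) ?B"
    using A aG by (intro inj_onI) (auto simp del: L.inv_wgroup)
  then have infC: "infinite ?C" using a(2) finite_imageD by blast
  have CH: "?C \<subseteq> H"
  proof
    fix x assume "x \<in> ?C"
    then obtain b where b: "b \<in> ?A" "H #>\<^bsub>G\<^esub> b = H #>\<^bsub>G\<^esub> a" "x = b \<otimes>\<^bsub>G\<^esub> inv\<^bsub>G\<^esub> a" by blast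
    have bG: "b \<in> carrier G" using b A by blast
    have "b \<in> H #>\<^bsub>G\<^esub> a" using L.wg.rcos_self[OF bG H(1)] b(2) by simp
    then show "x \<in> H" using subgroup.rcos_module_imp[OF H(1) L.group_wgroup aG] b(3) by simp
  qed
  have CN: "?C \<subseteq> N"
  proof
    fix x assume "x \<in> ?C"
    then obtain b where b: "b \<in> ?A" "x = b \<otimes>\<^bsub>G\<^esub> inv\<^bsub>G\<^esub> a" by blast
    have "b \<in> N" "a \<in> N" using a(1) b(1) by auto
    then show "x \<in> N" unfolding b(2)
      by (intro subgroup.m_closed[OF N_subgroup] subgroup.m_inv_closed[OF N_subgroup])
  qed
  interpret HG: group "G\<lparr>carrier := H\<rparr>" by (rule L.wg.subgroup_imp_group[OF H(1)])
  obtain x where x': "x \<in> H" "H = range (\<lambda>n::int. x [^]\<^bsub>G\<lparr>carrier := H\<rparr>\<^esub> n)"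
    using H(2)[unfolded HG.cyclic_group] by (elim bexE) simp
  have x: "x \<in> H" "H = range (\<lambda>n::int. x [^]\<^bsub>G\<^esub> n)"
    using x' unfolding L.wg.int_pow_consistent[OF H(1) x'(1)] by simp_all
  obtain u where u: "x = wcode KL u" by (rule wgroup_cases[OF subgroup.mem_carrier[OF H(1) x(1)]])
  show False
  proof (cases "expo u = 0")
    case True
    then have "x \<in> wcode KL ` window KL (length u)" using L.expo_zero_window u by blast
    then have "H \<subseteq> wcode KL ` window KL (length u)"
      using x(2) L.wg.subgroup_int_pow_closed[OF L.subgroup_window] by auto
    then have "finite H" using finite_window by (rule finite_subset)
    then have "finite ?C" by (rule finite_subset[OF CH])
    with infC show False by (rule notE)
  next
    case False
    have "y = \<one>\<^bsub>G\<^esub>" if y: "y \<in> ?C" for y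
    proof -
      have "y \<in> range (\<lambda>n::int. x [^]\<^bsub>G\<^esub> n)" using subsetD[OF CH y] unfolding x(2)[symmetric] .
      then obtain n :: int where n: "y = x [^]\<^bsub>G\<^esub> n" by (elim rangeE)
      obtain w where w: "y = wcode KL w" "expo w = 0" using subsetD[OF CN y] by blast
      have "y = wcode KL (if n < 0 then winv (wpow u (nat (- n))) else wpow u (nat n))"
        by (simp add: n u int_pow_def2)
      then have "expo w = expo (if n < 0 then winv (wpow u (nat (- n))) else wpow u (nat n))"
        using w(1) expo_KL wcode_eq_iff by metis
      then have "n = 0" using w(2) False by (auto simp: expo_wpow split: if_splits)
      then show ?thesis using n by simp
    qed
    then have "?C \<subseteq> {\<one>\<^bsub>G\<^esub>}" by (intro subsetI, unfold singleton_iff)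
    then have "finite ?C" by (rule finite_subset) simp
    with infC show False by (rule notE)
  qed
qed

end

theorem theorem1p11:
  shows "\<exists>(p::nat) (G :: nat monoid).
    Factorial_Ring.prime p \<and> group G \<and>
    finitely_generated G \<and> lacunary_hyperbolic G \<and> \<not> virtually_cyclic G \<and>
    elementary_amenable G \<and>
    (\<exists>a\<in>carrier G. \<exists>b\<in>carrier G. generate G {a, b} = carrier G) \<and>
    (\<exists>N. N \<lhd> G \<and> locally_nilpotent (G\<lparr>carrier := N\<rparr>) \<and> p_group p (G\<lparr>carrier := N\<rparr>) \<and>
         G Mod N \<cong> integer_group) \<and>
    residually (\<lambda>Q. finite (carrier Q) \<and> p_group p Q) G \<and>
    residually nilpotent_group G"
proof -
  obtain c d where cd: "\<And>n. c n = 6 * n * d n + 1" "mono d"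
    "\<And>n. (n + 1) * (diam (tower c n) n + 1) \<le> d n"
    using ex_scales by blast
  interpret positive_tower c by unfold_locales (simp add: cd(1))
  show ?thesis
  proof (intro exI conjI)
    show "Factorial_Ring.prime (2::nat)" by (rule two_is_prime_nat)
    show "group G" by (rule L.group_wgroup)
    show "lacunary_hyperbolic G" by (rule lacunary_hyperbolic_wgroup[OF cd])
    show "finitely_generated G"
      unfolding finitely_generated_def
      using L.generate_wgroup by (intro exI[of _ "{wcode KL [La], wcode KL [Lt]}"]) auto
    show "\<not> virtually_cyclic G" by (rule not_virtually_cyclic)
    show "elementary_amenable G" by (rule G_elementary_amenable)
    show "\<exists>a\<in>carrier G. \<exists>b\<in>carrier G. generate G {a, b} = carrier G"
      using L.generate_wgroup wcode_carrier by blast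
    show "N \<lhd> G" by (rule N_normal)
    show "locally_nilpotent (G\<lparr>carrier := N\<rparr>)" by (rule N_locally_nilpotent)
    show "p_group 2 (G\<lparr>carrier := N\<rparr>)" by (rule p_group_in_N[OF N_subgroup order_refl])
    show "G Mod N \<cong> integer_group" by (rule iso_trans[OF G_Mod_N wgroup_KZ(2)])
    show "residually (\<lambda>Q. finite (carrier Q) \<and> p_group 2 Q) G"
      unfolding residually_def using L.group_wgroup G_residual by blast
    show "residually nilpotent_group G"
      unfolding residually_def
      using L.group_wgroup G_residual finite_p_group_nilpotent[OF two_is_prime_nat] by blast
  qed
qed

end
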